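(* Consider the problem $\min_{x\in\Omega} f(x)=\frac1n\sum_{i=1}^n f_i(x)$ with $f_i(x)=\mathbb{E}_{\xi_i}[F_i(x,\xi_i)]$, and suppose that Assumptions (A1)--(A6) listed in the context hold. For a horizon $T\ge 1$ let $\{x_{i,k}\}$ be generated by the algorithm Com-DSZO (described in the context) with parameters $\mu=1/\sqrt{T}$, $\epsilon=\mu/(2\underline{R})$, $\psi\in(0,r^{-1}]$, $\eta_k=\frac{1}{M_1\sqrt{k+c}}$, where $M_1=\left(5+\frac{10}{n}\right)4dL_m$ and $c>4$, and $\gamma>0$ satisfying $\gamma<\min\{1,\delta\kappa_1^{-1},c_0\kappa_2^{-1}\}$. Let $\bar x_k=\frac1n\sum_{i=1}^n x_{i,k}$. Then for any optimal point $x^*\in\Omega$, $$\sum_{k=1}^T\mathbb{E}\big[f(\bar x_k)-f(x^* )\big]\le \mathcal{O}(1)+\mathcal{O}(\sqrt{T})+\mathcal{O}\Big(\frac1T\Big)+\mathcal{O}\Big(\frac{1}{\sqrt T}\Big)+\mathcal{O}\Big(\frac{\kappa_3}{1-\kappa_0}\big(\sqrt{T+c}+\ln(T+c)\big)\Big),$$ where $\kappa_0=\max(\mathbf{C}_1,\mathbf{C}_2)$ and $\kappa_3=nd^2L_f^2\widetilde{\mathbf{C}}_3$, with $\mathbf{C}_1,\mathbf{C}_2,\widetilde{\mathbf{C}}_3$ the constants (depending on $\gamma,\psi,r,\omega,\delta,\beta$) defined in the context.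
   Context: Setting. There are $n$ agents $\mathcal V=\{1,\dots,n\}$; $\Omega\subseteq\mathbb{R}^d$; $\xi_i$ is a random sample from an unknown distribution $\mathcal P_i$; $F_i(\cdot,\xi_i)$ is real-valued and $f_i(x)=\mathbb{E}_{\xi_i}[F_i(x,\xi_i)]$. $\mathcal N_i$ is the set of agents with which $i$ interacts (including $i$ itself in the sums below), and $\mathbf W\in\mathbb{R}^{n\times n}$ is the weight matrix of the communication graph $\mathcal G$ ($\mathbf W_{i,j}=0$ for $j\notin\mathcal N_i$). Assumptions. (A1) $\mathcal G$ is undirected, connected and balanced, so $\mathbf W$ is doubly stochastic; $\mathbf W^{\mathsf T}=\mathbf W$; $\mathrm{null}(\mathbf I-\mathbf W)=\mathrm{span}(\mathbf 1)$; $\mathbf I+\mathbf W\succ0$. Write $\mathbf H=\frac1n\mathbf 1\mathbf 1^{\mathsf T}$; the spectral gap $\delta\in(0,1]$ is defined by $\|\mathbf W-\mathbf H\|_2=1-\delta$, and $\beta=\|\mathbf I-\mathbf W\|_2\in(0,2)$. (A2) $\Omega$ is closed and convex, and there are $\bar R,\underline R>0$ such that $\Omega$ contains the Euclidean ball of radius $\underline R$ centered at $0$ and is contained in the ball of radius $\bar R$ centered at $0$. (A3) For each $i$, $F_i(x,\xi_i)$ is convex and $L_f$-Lipschitz continuous in $x$ on $\Omega$, with $L_f>0$. (A4) There is $\hat\sigma>0$ with $\mathbb{E}_{\xi_i}[\|\nabla_xF_i(x,\xi_i)-\nabla f_i(x)\|^2]\le\hat\sigma^2$ for all $x\in\Omega$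 and all $i$. (A5) The (possibly random) compressor $\mathcal C:\mathbb{R}^d\to\mathbb{R}^d$ is such that, for a scaling factor $r\ge1$, $\mathcal C_r(x)=\frac1r\mathcal C(x)$ satisfies $\mathbb{E}_{\mathcal C}[\|\mathcal C_r(x)-x\|^2]\le(1-\omega)\|x\|^2$ for all $x\in\mathbb{R}^d$, where $\omega\in(0,1]$ and the expectation is over the internal randomness of $\mathcal C$. (A6) Each $f_i$ has $L_m$-Lipschitz gradient: $\|\nabla f_i(x)-\nabla f_i(y)\|\le L_m\|x-y\|$ for all $x,y\in\Omega$. Algorithm Com-DSZO. Inputs $\eta_k,\mu,\epsilon,\psi,\gamma$; $\Omega_\epsilon=\{(1-\epsilon)x: x\in\Omega\}$; $\Pi_{\Omega_\epsilon}$ is Euclidean projection. Initialize $x_{i,0}\in\Omega$, $\hat x_{i,0}=b_{i,0}=\mathbf 0_d$, $q_{i,0}=\mathcal C(x_{i,0})$. For $k=0,1,\dots$ each agent $i$ draws a fresh $u_{i,k}$ uniformly from the unit sphere of $\mathbb{R}^d$ and a fresh sample $\xi_{i,k}\sim\mathcal P_i$, forms $\mathbf g_i^\mu(x_{i,k})=\frac d\mu\big(F_i(x_{i,k}+\mu u_{i,k},\xi_{i,k})-F_i(x_{i,k},\xi_{i,k})\big)u_{i,k}$, and sets $\hat x_{i,k+1}=\hat x_{i,k}+\psi q_{i,k}$; $b_{i,k+1}=b_{i,k}+\psi\big(q_{i,k}-\sum_{j\in\mathcal N_i}\mathbf W_{i,j}q_{j,k}\big)$; $x_{i,k+1}=\Pi_{\Omega_\epsilon}[x_{i,k}-\gamma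 b_{i,k+1}-\eta_k\mathbf g_i^\mu(x_{i,k})]$; $q_{i,k+1}=\mathcal C(x_{i,k+1}-\hat x_{i,k+1})$. Constants. $c_0=\frac{\psi r\omega}{2}$; $\kappa_1=\frac\delta4+2(1+c_0^{-1})^2\gamma\beta^2$; $\kappa_2=(1+c_0^{-1})^2\gamma\beta^2+(1+\frac2\delta)\beta^2$ (so the condition on $\gamma$ is implicit in $\gamma$). $\mathbf C_1=\mathbf A_1+\mathbf B_1$, $\mathbf C_2=\mathbf A_2+\mathbf B_2$ with $\mathbf A_1=(1+\frac{\gamma\delta}2)^2(1-\gamma\delta)^2$, $\mathbf A_2=(1+\frac{2}{\gamma\delta})\gamma^2\beta^2$, $\mathbf B_1=2(1+c_0^{-1})(1+c_0)\gamma^2\beta^2(1-\psi r\omega)$, $\mathbf B_2=\big[(1+c_0)+(1+c_0^{-1})^2\gamma^2\beta^2\big](1-\psi r\omega)$; $\widetilde{\mathbf C}_3=4(1+\frac{\gamma\delta}2)(1+\frac{2}{\gamma\delta})+2(1+c_0^{-1})$. $\beta(k)=\mathcal O(\alpha(k))$ means $\limsup_{k\to\infty}\beta(k)/\alpha(k)<+\infty$ (here in the variable $T$).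
   Formalization: Assumption (A3) is required on some open convex neighbourhood U of Ω (with F_i(x,ξ_i) integrable for x in U), not only on Ω, because the queries x+μu leave Ω, where the values of F_i would otherwise be arbitrary and the bound fails. *)

theory Defs
  imports "HOL-Probability.Probability" "HOL-Library.Landau_Symbols"
begin

text \<open>
  The agents are the elements of a finite type \<open>'n\<close>, whose number is
  \<open>CARD('n)\<close>; the edges of the communication graph form a relation on \<open>'n\<close>.
\<close>

definition neighbours :: "('n \<times> 'n) set \<Rightarrow> 'n \<Rightarrow> 'n set" where
  "neighbours E i = insert i (E `` {i})"

definition doubly_stochastic :: "real^'n^'n \<Rightarrow> bool" where
  "doubly_stochastic W \<longleftrightarrow>
     (\<forall>i j. 0 \<le> W $ i $ j) \<and> (\<forall>i. (\<Sum>j\<in>UNIV. W $ i $ j) = 1) \<and> (\<forall>j. (\<Sum>i\<in>UNIV. W $ i $ j) = 1)"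

definition averaging_matrix :: "real^'n^'n" where
  "averaging_matrix = (\<chi> i j. 1 / real CARD('n))"

definition spectral_norm :: "real^'n^'n \<Rightarrow> real" where
  "spectral_norm A = onorm ((*v) A)"

definition spectral_gap :: "real^'n^'n \<Rightarrow> real" where
  "spectral_gap W = 1 - spectral_norm (W - averaging_matrix)"

definition laplacian_norm :: "real^'n^'n \<Rightarrow> real" where
  "laplacian_norm W = spectral_norm (mat 1 - W)"

definition network_assumption :: "('n \<times> 'n) set \<Rightarrow> real^'n^'n \<Rightarrow> bool" where
  "network_assumption E W \<longleftrightarrow>
     sym E \<and> (\<forall>i j. (i, j) \<in> E\<^sup>*) \<and>
     (\<forall>i j. j \<notin> neighbours E i \<longrightarrow> W $ i $ j = 0) \<and>
     doubly_stochastic W \<and> transpose W = W \<and>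
     {v. (mat 1 - W) *v v = 0} = span {1} \<and>
     (\<forall>v. v \<noteq> 0 \<longrightarrow> v \<bullet> ((mat 1 + W) *v v) > 0) \<and>
     0 < spectral_gap W \<and> spectral_gap W \<le> 1 \<and>
     0 < laplacian_norm W \<and> laplacian_norm W < 2"

definition gradient :: "('v::euclidean_space \<Rightarrow> real) \<Rightarrow> 'v \<Rightarrow> 'v" where
  "gradient g x = (THE D. GDERIV g x :> D)"

definition local_objective ::
    "('n \<Rightarrow> 's measure) \<Rightarrow> ('n \<Rightarrow> 'v \<Rightarrow> 's \<Rightarrow> real) \<Rightarrow> 'n \<Rightarrow> 'v \<Rightarrow> real" where
  "local_objective P F i x = (\<integral>s. F i x s \<partial>P i)"

definition objective ::
    "('n::finite \<Rightarrow> 's measure) \<Rightarrow> ('n \<Rightarrow> 'v \<Rightarrow> 's \<Rightarrow> real) \<Rightarrow> 'v \<Rightarrow> real" where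
  "objective P F x = (\<Sum>i\<in>UNIV. local_objective P F i x) / real CARD('n)"

definition constraint_assumption :: "'v::euclidean_space set \<Rightarrow> real \<Rightarrow> real \<Rightarrow> bool" where
  "constraint_assumption \<Omega> R_in R_out \<longleftrightarrow>
     closed \<Omega> \<and> convex \<Omega> \<and> 0 < R_in \<and> 0 < R_out \<and> cball 0 R_in \<subseteq> \<Omega> \<and> \<Omega> \<subseteq> cball 0 R_out"

text \<open>
  \<open>U\<close> is the domain on which the sampled objectives are convex and Lipschitz continuous. It is an
  open neighbourhood of the constraint set, and not the constraint set itself, because a perturbed
  query point \<open>x + \<mu> u\<close> with \<open>x \<in> (1 - \<mu> / (2 R_in)) \<Omega>\<close> can be as far as
  \<open>\<mu> / 2\<close> outside of \<open>\<Omega>\<close>. The integrability clause is what makes the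
  expectation in \<^const>\<open>local_objective\<close> meaningful.
\<close>

definition lipschitz_convex_assumption ::
    "'v::euclidean_space set \<Rightarrow> 'v set \<Rightarrow> ('n \<Rightarrow> 's measure) \<Rightarrow> ('n \<Rightarrow> 'v \<Rightarrow> 's \<Rightarrow> real) \<Rightarrow> real \<Rightarrow> bool"
  where
  "lipschitz_convex_assumption \<Omega> U P F Lf \<longleftrightarrow>
     open U \<and> convex U \<and> \<Omega> \<subseteq> U \<and> 0 < Lf \<and>
     (\<forall>i. prob_space (P i) \<and>
          (\<forall>x\<in>U. integrable (P i) (F i x)) \<and>
          (\<forall>s\<in>space (P i). convex_on U (\<lambda>x. F i x s) \<and> Lf-lipschitz_on U (\<lambda>x. F i x s)))"

definition gradient_noise_assumption ::
    "'v::euclidean_space set \<Rightarrow> ('n \<Rightarrow> 's measure) \<Rightarrow> ('n \<Rightarrow> 'v \<Rightarrow> 's \<Rightarrow> real) \<Rightarrow> real \<Rightarrow> bool" where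
  "gradient_noise_assumption \<Omega> P F \<sigma> \<longleftrightarrow>
     0 < \<sigma> \<and>
     (\<forall>i. \<forall>x\<in>\<Omega>.
        (\<forall>s\<in>space (P i). (\<lambda>y. F i y s) differentiable (at x)) \<and>
        integrable (P i)
          (\<lambda>s. (norm (gradient (\<lambda>y. F i y s) x - gradient (local_objective P F i) x))\<^sup>2) \<and>
        (\<integral>s. (norm (gradient (\<lambda>y. F i y s) x - gradient (local_objective P F i) x))\<^sup>2 \<partial>P i)
          \<le> \<sigma>\<^sup>2)"

definition smooth_assumption ::
    "'v::euclidean_space set \<Rightarrow> ('n \<Rightarrow> 's measure) \<Rightarrow> ('n \<Rightarrow> 'v \<Rightarrow> 's \<Rightarrow> real) \<Rightarrow> real \<Rightarrow> bool" where
  "smooth_assumption \<Omega> P F Lm \<longleftrightarrow>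
     0 < Lm \<and>
     (\<forall>i. (\<forall>x\<in>\<Omega>. local_objective P F i differentiable (at x)) \<and>
          (\<forall>x\<in>\<Omega>. \<forall>y\<in>\<Omega>. norm (gradient (local_objective P F i) x - gradient (local_objective P F i) y)
                           \<le> Lm * norm (x - y)))"

text \<open>
  A random compressor is a measurable map \<open>C x z\<close> of its input \<open>x\<close> and of an internal random
  seed \<open>z\<close> drawn from \<open>Q\<close>; a deterministic compressor ignores \<open>z\<close>.
\<close>

definition compressor_assumption ::
    "'z measure \<Rightarrow> ('v::euclidean_space \<Rightarrow> 'z \<Rightarrow> 'v) \<Rightarrow> real \<Rightarrow> real \<Rightarrow> bool" where
  "compressor_assumption Q C r \<omega> \<longleftrightarrow>
     prob_space Q \<and> (\<lambda>(x, z). C x z) \<in> borel \<Otimes>\<^sub>M Q \<rightarrow>\<^sub>M borel \<and>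
     1 \<le> r \<and> 0 < \<omega> \<and> \<omega> \<le> 1 \<and>
     (\<forall>x. (\<integral>\<^sup>+z. ennreal ((norm ((1 / r) *\<^sub>R C x z - x))\<^sup>2) \<partial>Q) \<le> ennreal ((1 - \<omega>) * (norm x)\<^sup>2))"

text \<open>
  The radial projection of the uniform distribution on the unit ball is the uniform distribution on
  the unit sphere. Restricting the space to the sphere only discards the null event \<open>sgn 0 = 0\<close>;
  it forces random directions to lie on the sphere surely.
\<close>

definition uniform_sphere :: "'v::euclidean_space measure" where
  "uniform_sphere =
     restrict_space (distr (uniform_measure lborel (ball 0 1)) borel sgn) (sphere 0 1)"

text \<open>
  The direction \<open>u i k\<close>, the data sample \<open>\<xi> i k\<close> and the compressor seed \<open>\<zeta> i k\<close>
  of agent \<open>i\<close> at iteration \<open>k\<close> are all mutually independent: the distribution of each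
  triple is a product measure, and the triples are independent over all pairs \<open>(i, k)\<close>.
\<close>

definition fresh_randomness ::
    "'w measure \<Rightarrow> ('n \<Rightarrow> 's measure) \<Rightarrow> 'z measure \<Rightarrow>
     ('n \<Rightarrow> nat \<Rightarrow> 'w \<Rightarrow> 'v::euclidean_space) \<Rightarrow> ('n \<Rightarrow> nat \<Rightarrow> 'w \<Rightarrow> 's) \<Rightarrow> ('n \<Rightarrow> nat \<Rightarrow> 'w \<Rightarrow> 'z) \<Rightarrow> bool"
  where
  "fresh_randomness M P Q u \<xi> \<zeta> \<longleftrightarrow>
     prob_space M \<and>
     prob_space.indep_vars M (\<lambda>(i, k). uniform_sphere \<Otimes>\<^sub>M (P i \<Otimes>\<^sub>M Q))
       (\<lambda>(i, k) w. (u i k w, \<xi> i k w, \<zeta> i k w)) UNIV \<and>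
     (\<forall>i k. distr M (uniform_sphere \<Otimes>\<^sub>M (P i \<Otimes>\<^sub>M Q)) (\<lambda>w. (u i k w, \<xi> i k w, \<zeta> i k w))
             = uniform_sphere \<Otimes>\<^sub>M (P i \<Otimes>\<^sub>M Q))"

definition shrunk :: "real \<Rightarrow> 'v::real_vector set \<Rightarrow> 'v set" where
  "shrunk \<epsilon> \<Omega> = (\<lambda>x. (1 - \<epsilon>) *\<^sub>R x) ` \<Omega>"

definition zo_gradient ::
    "('v::euclidean_space \<Rightarrow> 's \<Rightarrow> real) \<Rightarrow> real \<Rightarrow> 'v \<Rightarrow> 'v \<Rightarrow> 's \<Rightarrow> 'v" where
  "zo_gradient G \<mu> x u s = (real DIM('v) / \<mu> * (G (x + \<mu> *\<^sub>R u) s - G x s)) *\<^sub>R u"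

record ('n, 'v) network_state =
  iterate :: "'n \<Rightarrow> 'v"
  estimate :: "'n \<Rightarrow> 'v"
  mismatch :: "'n \<Rightarrow> 'v"
  message :: "'n \<Rightarrow> 'v"

text \<open>
  The fields hold, for every agent, the quantities usually written \<open>x\<close>, \<open>x\<close>-hat,
  \<open>b\<close> and \<open>q\<close>. The arguments \<open>u\<close>, \<open>s\<close>, \<open>z\<close> are one realisation of the
  randomness; the Euclidean projection is \<^const>\<open>closest_point\<close>.
\<close>

primrec com_dszo ::
    "('n \<times> 'n) set \<Rightarrow> real^'n^'n \<Rightarrow> ('n \<Rightarrow> 'v::euclidean_space \<Rightarrow> 's \<Rightarrow> real) \<Rightarrow> ('v \<Rightarrow> 'z \<Rightarrow> 'v) \<Rightarrow> 'v set \<Rightarrow>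
     (nat \<Rightarrow> real) \<Rightarrow> real \<Rightarrow> real \<Rightarrow> real \<Rightarrow> real \<Rightarrow> ('n \<Rightarrow> 'v) \<Rightarrow>
     ('n \<Rightarrow> nat \<Rightarrow> 'v) \<Rightarrow> ('n \<Rightarrow> nat \<Rightarrow> 's) \<Rightarrow> ('n \<Rightarrow> nat \<Rightarrow> 'z) \<Rightarrow> nat \<Rightarrow> ('n::finite, 'v) network_state"
  where
  "com_dszo E W F C \<Omega> \<eta> \<mu> \<epsilon> \<psi> \<gamma> x0 u s z 0 =
     \<lparr> iterate = x0, estimate = (\<lambda>i. 0), mismatch = (\<lambda>i. 0), message = (\<lambda>i. C (x0 i) (z i 0)) \<rparr>"
| "com_dszo E W F C \<Omega> \<eta> \<mu> \<epsilon> \<psi> \<gamma> x0 u s z (Suc k) =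
     (let st = com_dszo E W F C \<Omega> \<eta> \<mu> \<epsilon> \<psi> \<gamma> x0 u s z k;
          x = iterate st;
          q = message st;
          h' = (\<lambda>i. estimate st i + \<psi> *\<^sub>R q i);
          b' = (\<lambda>i. mismatch st i + \<psi> *\<^sub>R (q i - (\<Sum>j\<in>neighbours E i. (W $ i $ j) *\<^sub>R q j)));
          x' = (\<lambda>i. closest_point (shrunk \<epsilon> \<Omega>)
                      (x i - \<gamma> *\<^sub>R b' i - \<eta> k *\<^sub>R zo_gradient (F i) \<mu> (x i) (u i k) (s i k)))
      in \<lparr> iterate = x', estimate = h', mismatch = b',
           message = (\<lambda>i. C (x' i - h' i) (z i (Suc k))) \<rparr>)"

definition network_average :: "('n::finite, 'v::real_vector) network_state \<Rightarrow> 'v" where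
  "network_average st = (1 / real CARD('n)) *\<^sub>R (\<Sum>i\<in>UNIV. iterate st i)"

definition const_c0 :: "real \<Rightarrow> real \<Rightarrow> real \<Rightarrow> real" where
  "const_c0 \<psi> r \<omega> = \<psi> * r * \<omega> / 2"

definition const_\<kappa>1 :: "real \<Rightarrow> real \<Rightarrow> real \<Rightarrow> real \<Rightarrow> real" where
  "const_\<kappa>1 c0 \<gamma> \<delta> \<beta> = \<delta> / 4 + 2 * (1 + 1 / c0)\<^sup>2 * \<gamma> * \<beta>\<^sup>2"

definition const_\<kappa>2 :: "real \<Rightarrow> real \<Rightarrow> real \<Rightarrow> real \<Rightarrow> real" where
  "const_\<kappa>2 c0 \<gamma> \<delta> \<beta> = (1 + 1 / c0)\<^sup>2 * \<gamma> * \<beta>\<^sup>2 + (1 + 2 / \<delta>) * \<beta>\<^sup>2"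

definition const_C1 :: "real \<Rightarrow> real \<Rightarrow> real \<Rightarrow> real \<Rightarrow> real \<Rightarrow> real \<Rightarrow> real" where
  "const_C1 \<psi> r \<omega> \<gamma> \<delta> \<beta> =
     (let c0 = const_c0 \<psi> r \<omega>;
          A1 = (1 + \<gamma> * \<delta> / 2)\<^sup>2 * (1 - \<gamma> * \<delta>)\<^sup>2;
          B1 = 2 * (1 + 1 / c0) * (1 + c0) * \<gamma>\<^sup>2 * \<beta>\<^sup>2 * (1 - \<psi> * r * \<omega>)
      in A1 + B1)"

definition const_C2 :: "real \<Rightarrow> real \<Rightarrow> real \<Rightarrow> real \<Rightarrow> real \<Rightarrow> real \<Rightarrow> real" where
  "const_C2 \<psi> r \<omega> \<gamma> \<delta> \<beta> =
     (let c0 = const_c0 \<psi> r \<omega>;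
          A2 = (1 + 2 / (\<gamma> * \<delta>)) * \<gamma>\<^sup>2 * \<beta>\<^sup>2;
          B2 = ((1 + c0) + (1 + 1 / c0)\<^sup>2 * \<gamma>\<^sup>2 * \<beta>\<^sup>2) * (1 - \<psi> * r * \<omega>)
      in A2 + B2)"

definition const_C3 :: "real \<Rightarrow> real \<Rightarrow> real \<Rightarrow> real \<Rightarrow> real \<Rightarrow> real" where
  "const_C3 \<psi> r \<omega> \<gamma> \<delta> =
     4 * (1 + \<gamma> * \<delta> / 2) * (1 + 2 / (\<gamma> * \<delta>)) + 2 * (1 + 1 / const_c0 \<psi> r \<omega>)"

definition const_\<kappa>0 :: "real \<Rightarrow> real \<Rightarrow> real \<Rightarrow> real \<Rightarrow> real \<Rightarrow> real \<Rightarrow> real" where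
  "const_\<kappa>0 \<psi> r \<omega> \<gamma> \<delta> \<beta> = max (const_C1 \<psi> r \<omega> \<gamma> \<delta> \<beta>) (const_C2 \<psi> r \<omega> \<gamma> \<delta> \<beta>)"

end

theory Submission
  imports Defs
begin

text \<open>
  Fix everything except the horizon. The five summands allow any bound of order \<open>\<surd>T\<close>, for large \<open>T\<close>;
  the proof puts the whole sum into the \<open>\<surd>T\<close> summand and takes the other four to be zero.

  The descent is measured at the consensus point whose components are all \<open>z = (1 - \<epsilon>) x\<^sup>*\<close>, which lies in the
  shrunk constraint set. Since projection does not increase distances, one iteration bounds
  \<open>2 \<eta>\<^sub>k \<langle>X - z, g\<rangle>\<close>, where \<open>g\<close> stacks the two-point gradient estimates, by the decrease of the
  squared distance to \<open>z\<close>, plus a multiple of (disagreement of the agents)\<open>\<^sup>2\<close> +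
  (error of the compressed estimates)\<open>\<^sup>2\<close>, plus a multiple of \<open>\<eta>\<^sub>k\<^sup>2\<close> (\<open>distance_step\<close>). After division
  by \<open>\<eta>\<^sub>k\<close>, which is of order \<open>1 / \<surd>k\<close>, the decreases telescope to something of order \<open>\<surd>T\<close>.

  On the left, the expected inner product dominates \<open>f\<^sub>i(x) - f\<^sub>i(z)\<close> up to \<open>2 \<mu> L\<close>
  (\<open>sphere_gradient\<close>): averaged over the sphere, the two-point estimate is a gradient of the convex function
  \<open>f\<^sub>i\<close> smoothed over a ball of radius \<open>\<mu>\<close>. With \<open>\<mu> = 1 / \<surd>T\<close> this bias, and the bias from
  replacing \<open>x\<^sup>*\<close> by \<open>z\<close>, contribute order \<open>\<surd>T\<close> in total.

  It remains to see that the two error terms, squared and divided by \<open>\<eta>\<^sub>k\<close>, also sum to order \<open>\<surd>T\<close>. Their root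
  mean squares satisfy a coupled linear recursion with input of order \<open>\<eta>\<^sub>k\<close> (\<open>second_moment_step\<close>).
  The condition on \<open>\<gamma>\<close> makes a weighted sum of the two contract (\<open>error_bounds_contraction\<close>), so this
  sum is of the order of \<open>\<eta>\<^sub>k\<close> in the averaged sense of \<open>contraction_weighted_square_sum\<close>.

  Two points concern measurability and independence. The sampled objectives are well behaved only on the neighbourhood \<open>U\<close>
  of the constraint set, and only separately measurable; they are replaced by an extension that is jointly measurable and
  Lipschitz on the whole space (\<open>lipschitz_extension_exists\<close>). For large \<open>T\<close> all queries stay in
  \<open>U\<close>, so that the algorithm does not see the difference (\<open>com_dszo_eq\<close>). The state at iteration
  \<open>k\<close> is a measurable function of the draws made before \<open>k\<close>, so expectations over a fresh draw can be
  taken with the state held fixed (\<open>distr_past_present\<close>, \<open>expectation_fresh_draw\<close>).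
\<close>

section \<open>Sums along slowly decreasing step sizes\<close>

lemma sum_inverse_sqrt_le:
  assumes "0 \<le> c"
  shows "(\<Sum>k=1..T. 1 / sqrt (real k + c)) \<le> 2 * sqrt (real T)"
proof (induction T)
  case (Suc T)
  have "1 / sqrt (real (Suc T) + c) \<le> 1 / sqrt (real (Suc T))"
    using assms by (intro divide_left_mono) auto
  also have "\<dots> \<le> 2 * sqrt (real (Suc T)) - 2 * sqrt (real T)"
  proof -
    let ?a = "sqrt (real (Suc T))" and ?b = "sqrt (real T)"
    have ab: "?b \<le> ?a" "0 \<le> ?b" "0 < ?a" by auto
    have "?a * ?a - ?b * ?b = 1" by simp
    then have "1 = (?a - ?b) * (?a + ?b)" by (simp add: algebra_simps)
    also have "\<dots> \<le> (?a - ?b) * (2 * ?a)" using ab by (intro mult_left_mono) auto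
    finally have "1 / ?a \<le> (?a - ?b) * 2" using ab(3) by (simp only: pos_divide_le_eq mult.assoc)
    then show ?thesis by simp
  qed
  finally show ?case using Suc by simp
qed simp

text \<open>
  Summation by parts: with weights that grow, the sum is largest when every drop of \<open>D\<close> is postponed to the
  end, where it costs the last weight times the range of \<open>D\<close>. With \<open>w k = 1 / \<eta> k\<close> this turns a
  one-step decrease, divided by the step size, into a bound of order \<open>1 / \<eta> T\<close>.
\<close>

lemma weighted_telescope_le:
  fixes w D :: "nat \<Rightarrow> real"
  assumes w: "\<And>k. 0 \<le> w k" "\<And>k. w k \<le> w (Suc k)"
    and D: "\<And>k. 1 \<le> k \<Longrightarrow> 0 \<le> D k" "\<And>k. 1 \<le> k \<Longrightarrow> D k \<le> B"
  shows "(\<Sum>k=1..T. w k * (D k - D (Suc k))) \<le> w T * B"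
proof -
  have B: "0 \<le> B" using D[of 1] by simp
  have "(\<Sum>k=1..T. w k * (D k - D (Suc k))) \<le> w T * (B - D (Suc T))"
  proof (induction T)
    case 0
    then show ?case using w(1)[of 0] D(2)[of 1] by simp
  next
    case (Suc T)
    have "w T * (B - D (Suc T)) \<le> w (Suc T) * (B - D (Suc T))"
      using w(2)[of T] D(2)[of "Suc T"] by (intro mult_right_mono) auto
    with Suc show ?case by (simp add: algebra_simps)
  qed
  also have "\<dots> \<le> w T * B" using w(1)[of T] D(1)[of "Suc T"] by (intro mult_left_mono) auto
  finally show ?thesis .
qed

text \<open>
  A contraction driven by an input of size \<open>1 / \<surd>k\<close> settles at size \<open>1 / \<surd>k\<close>, so the
  summands below should be of size \<open>1 / \<surd>k\<close>. An induction on that pointwise bound would have to treat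
  small \<open>k\<close> separately and is avoided: convexity of the square turns the recursion into
  \<open>\<tau> V\<^sub>k\<^sup>2 \<le> V\<^sub>k\<^sup>2 - V\<^sub>k\<^sub>+\<^sub>1\<^sup>2 + K\<^sup>2 / (\<tau> (k + c))\<close>, and the weighted telescope applies
  because \<open>V\<close> is bounded.
\<close>

lemma contraction_weighted_square_sum:
  fixes V :: "nat \<Rightarrow> real"
  assumes V0: "\<And>k. 0 \<le> V k"
    and step: "\<And>k. 1 \<le> k \<Longrightarrow> V (Suc k) \<le> (1 - \<tau>) * V k + K / sqrt (real k + c)"
    and \<tau>: "0 < \<tau>" "\<tau> \<le> 1" and K: "0 \<le> K" and c: "0 \<le> c"
  shows "\<exists>B\<ge>0. \<forall>T. (\<Sum>k=1..T. sqrt (real k + c) * (V k)\<^sup>2) \<le> B * sqrt (real T + c)"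
proof -
  have convex: "((1 - \<tau>) * a + \<tau> * b)\<^sup>2 \<le> (1 - \<tau>) * a\<^sup>2 + \<tau> * b\<^sup>2" for a b :: real
  proof -
    have "(1 - \<tau>) * a\<^sup>2 + \<tau> * b\<^sup>2 - ((1 - \<tau>) * a + \<tau> * b)\<^sup>2 = \<tau> * (1 - \<tau>) * (a - b)\<^sup>2"
      by (simp add: power2_eq_square algebra_simps)
    also have "\<dots> \<ge> 0" using \<tau> by simp
    finally show ?thesis by simp
  qed
  define Z where "Z = max (V 1) (K / \<tau>)"
  have Vb: "V k \<le> Z" if "1 \<le> k" for k
    using that
  proof (induction k rule: dec_induct)
    case base
    show ?case by (simp add: Z_def)
  next
    case (step k)
    have "K / sqrt (real k + c) \<le> K"
      using K c step(1) by (simp add: divide_le_eq mult_le_cancel_left1 real_le_rsqrt)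
    moreover have "K \<le> \<tau> * Z" using \<tau> by (simp add: Z_def max_def field_simps)
    moreover have "(1 - \<tau>) * V k \<le> (1 - \<tau>) * Z" using step \<tau> by (intro mult_left_mono) auto
    ultimately show ?case using assms(2)[OF step(1)] by (simp add: algebra_simps)
  qed
  have Z: "0 \<le> Z" using Vb[of 1] V0[of 1] by simp
  define S where "S k = (V k)\<^sup>2" for k
  let ?w = "\<lambda>k. sqrt (real k + c)"
  have main: "\<tau> * (?w k * S k) \<le> ?w k * (S k - S (Suc k)) + K\<^sup>2 / \<tau> * (1 / ?w k)" if k: "1 \<le> k" for k
  proof -
    have w: "0 < ?w k" using k c by simp
    have "V (Suc k) \<le> (1 - \<tau>) * V k + \<tau> * (K / ?w k / \<tau>)"
      using step[OF k] \<tau> by simp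
    then have "S (Suc k) \<le> ((1 - \<tau>) * V k + \<tau> * (K / ?w k / \<tau>))\<^sup>2"
      unfolding S_def using V0 by (intro power_mono) auto
    also have "\<dots> \<le> (1 - \<tau>) * S k + \<tau> * (K / ?w k / \<tau>)\<^sup>2"
      unfolding S_def by (rule convex)
    also have "\<tau> * (K / ?w k / \<tau>)\<^sup>2 = K\<^sup>2 / \<tau> / (?w k)\<^sup>2"
      using \<tau> by (simp add: power2_eq_square)
    finally have "\<tau> * S k \<le> S k - S (Suc k) + K\<^sup>2 / \<tau> / (?w k)\<^sup>2" by (simp add: algebra_simps)
    from mult_left_mono[OF this, of "?w k"] w
    have "?w k * (\<tau> * S k) \<le> ?w k * (S k - S (Suc k)) + ?w k * (K\<^sup>2 / \<tau> / (?w k)\<^sup>2)"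
      by (simp only: distrib_left less_imp_le)
    moreover have "t * (q / t\<^sup>2) = q * (1 / t)" if "0 < t" for q t :: real
      using that by (simp add: power2_eq_square)
    ultimately show ?thesis using w by (simp only: mult.left_commute[of \<tau>])
  qed
  show ?thesis
  proof (intro exI[of _ "(Z\<^sup>2 + 2 * (K\<^sup>2 / \<tau>)) / \<tau>"] conjI allI)
    fix T
    have "\<tau> * (\<Sum>k=1..T. ?w k * S k) \<le> (\<Sum>k=1..T. ?w k * (S k - S (Suc k)) + K\<^sup>2 / \<tau> * (1 / ?w k))"
      unfolding sum_distrib_left using main by (intro sum_mono) auto
    also have "\<dots> = (\<Sum>k=1..T. ?w k * (S k - S (Suc k))) + K\<^sup>2 / \<tau> * (\<Sum>k=1..T. 1 / ?w k)"
      by (simp add: sum.distrib sum_distrib_left)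
    also have "(\<Sum>k=1..T. ?w k * (S k - S (Suc k))) \<le> ?w T * Z\<^sup>2"
      using c Vb V0 Z by (intro weighted_telescope_le) (auto simp: S_def intro!: power_mono)
    also have "K\<^sup>2 / \<tau> * (\<Sum>k=1..T. 1 / ?w k) \<le> K\<^sup>2 / \<tau> * (2 * ?w T)"
      using \<tau> c by (intro mult_left_mono order_trans[OF sum_inverse_sqrt_le]) auto
    finally have "\<tau> * (\<Sum>k=1..T. ?w k * S k) \<le> (Z\<^sup>2 + 2 * (K\<^sup>2 / \<tau>)) * ?w T"
      by (simp add: algebra_simps)
    then show "(\<Sum>k=1..T. ?w k * (V k)\<^sup>2) \<le> (Z\<^sup>2 + 2 * (K\<^sup>2 / \<tau>)) / \<tau> * ?w T"
      using \<tau> by (simp add: S_def pos_le_divide_eq mult.commute)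
  qed (use \<tau> in simp)
qed

section \<open>Vector-valued gossip\<close>

definition mix :: "real^'n^'n \<Rightarrow> 'v::euclidean_space^'n \<Rightarrow> 'v^'n" where
  "mix A X = (\<chi> i. \<Sum>j\<in>UNIV. A $ i $ j *\<^sub>R X $ j)"

definition mean :: "'v::euclidean_space^'n \<Rightarrow> 'v" where
  "mean X = (1 / real CARD('n)) *\<^sub>R (\<Sum>i\<in>UNIV. X $ i)"

definition disagreement :: "'v::euclidean_space^'n \<Rightarrow> real" where
  "disagreement X = norm (X - vec (mean X))"

definition project :: "'v::euclidean_space set \<Rightarrow> 'v^'n \<Rightarrow> 'v^'n" where
  "project S X = (\<chi> i. closest_point S (X $ i))"

lemma norm_vec_power2: "(norm (X :: 'v::euclidean_space^'n))\<^sup>2 = (\<Sum>i\<in>UNIV. (norm (X $ i))\<^sup>2)"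
  by (simp add: power2_norm_eq_inner inner_vec_def)

lemma norm_vec_mono:
  fixes X :: "'v::euclidean_space^'n" and Y :: "'u::euclidean_space^'n"
  assumes "\<And>i. norm (X $ i) \<le> norm (Y $ i)"
  shows "norm X \<le> norm Y"
  unfolding norm_vec_def by (intro L2_set_mono) (auto simp: assms)

lemma norm_vec_uniform_bound:
  fixes X :: "'v::euclidean_space^'n"
  assumes "\<And>i. norm (X $ i) \<le> R" and R: "0 \<le> R"
  shows "norm X \<le> sqrt (real CARD('n)) * R"
proof (rule power2_le_imp_le)
  have "(norm X)\<^sup>2 \<le> (\<Sum>i\<in>(UNIV::'n set). R\<^sup>2)"
    unfolding norm_vec_power2 using assms by (intro sum_mono power_mono) auto
  then show "(norm X)\<^sup>2 \<le> (sqrt (real CARD('n)) * R)\<^sup>2" by (simp add: power_mult_distrib)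
qed (use R in simp)

lemma mix_add: "mix A (X + Y) = mix A X + mix A Y"
  by (simp add: mix_def vec_eq_iff scaleR_add_right sum.distrib)

lemma mix_scaleR: "mix A (t *\<^sub>R X) = t *\<^sub>R mix A X"
  by (simp add: mix_def vec_eq_iff scaleR_sum_right mult.commute)

lemma mix_diff: "mix A (X - Y) = mix A X - mix A Y"
  by (simp add: mix_def vec_eq_iff scaleR_diff_right sum_subtractf)

lemma mix_matrix_diff: "mix (A - B) X = mix A X - mix B X"
  by (simp add: mix_def vec_eq_iff scaleR_diff_left sum_subtractf)

lemma mix_identity:
  fixes X :: "'v::euclidean_space^'n"
  shows "mix (mat 1) X = X"
proof -
  have "(\<Sum>j\<in>UNIV. (mat 1 :: real^'n^'n) $ i $ j *\<^sub>R X $ j) = X $ i" for i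
  proof -
    have "(\<Sum>j\<in>UNIV. (mat 1 :: real^'n^'n) $ i $ j *\<^sub>R X $ j) = (\<Sum>j\<in>UNIV. if i = j then X $ j else 0)"
      by (intro sum.cong) (auto simp: mat_def)
    then show ?thesis by simp
  qed
  then show ?thesis by (simp add: mix_def vec_eq_iff)
qed

lemma mix_averaging: "mix averaging_matrix X = vec (mean X)"
  by (simp add: mix_def averaging_matrix_def mean_def vec_eq_iff scaleR_sum_right)

lemma continuous_on_mix: "continuous_on S (mix A)"
  unfolding mix_def[abs_def] by (intro continuous_intros)

text \<open>
  Acting on \<open>'v\<close>-valued network vectors is acting on each coordinate separately, so the operator
  norm is the one of the scalar matrix.
\<close>

lemma norm_mix_le:
  fixes X :: "'v::euclidean_space^'n"
  shows "norm (mix A X) \<le> spectral_norm A * norm X"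
proof (rule power2_le_imp_le)
  have bl: "bounded_linear ((*v) A)" by (rule matrix_vector_mul_bounded_linear)
  have s0: "0 \<le> spectral_norm A" unfolding spectral_norm_def by (rule onorm_pos_le[OF bl])
  let ?co = "\<lambda>b. (\<chi> j. X $ j \<bullet> b) :: real^'n"
  have split: "(norm (Y :: 'v^'n))\<^sup>2 = (\<Sum>b\<in>Basis. (norm ((\<chi> j. Y $ j \<bullet> b) :: real^'n))\<^sup>2)" for Y
  proof -
    have "(norm Y)\<^sup>2 = (\<Sum>i\<in>UNIV. \<Sum>b\<in>Basis. (Y $ i \<bullet> b)\<^sup>2)"
      unfolding norm_vec_power2 power2_norm_eq_inner
      by (subst euclidean_inner) (simp add: power2_eq_square)
    also have "\<dots> = (\<Sum>b\<in>Basis. \<Sum>i\<in>UNIV. (Y $ i \<bullet> b)\<^sup>2)" by (rule sum.swap)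
    finally show ?thesis by (simp add: norm_vec_power2)
  qed
  have co: "(\<chi> j. mix A X $ j \<bullet> b) = A *v ?co b" for b
    by (simp add: vec_eq_iff mix_def matrix_vector_mult_def inner_sum_left)
  have "(norm (mix A X))\<^sup>2 = (\<Sum>b\<in>Basis. (norm (A *v ?co b))\<^sup>2)"
    by (subst split) (simp add: co)
  also have "\<dots> \<le> (\<Sum>b\<in>Basis. (spectral_norm A * norm (?co b))\<^sup>2)"
    unfolding spectral_norm_def by (intro sum_mono power_mono onorm[OF bl]) auto
  also have "\<dots> = (spectral_norm A)\<^sup>2 * (\<Sum>b\<in>Basis. (norm (?co b))\<^sup>2)"
    by (simp add: power_mult_distrib sum_distrib_left)
  also have "\<dots> = (spectral_norm A * norm X)\<^sup>2"
    by (simp add: split[of X] power_mult_distrib)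
  finally show "(norm (mix A X))\<^sup>2 \<le> (spectral_norm A * norm X)\<^sup>2" .
  show "0 \<le> spectral_norm A * norm X" using s0 by simp
qed

lemma mean_add: "mean (X + Y) = mean X + mean Y"
  by (simp add: mean_def sum.distrib scaleR_add_right)

lemma mean_diff: "mean (X - Y) = mean X - mean Y"
  by (simp add: mean_def sum_subtractf scaleR_diff_right)

lemma mean_scaleR: "mean (t *\<^sub>R X) = t *\<^sub>R mean X"
  by (simp add: mean_def scaleR_sum_right mult.commute)

lemma mean_vec: "mean (vec v :: 'v::euclidean_space^'n) = v"
  by (simp add: mean_def sum_constant_scaleR)

text \<open>
  The mean is the best approximation of a network vector by a constant one. This is what lets projection be handled
  agent by agent: compare the projected vector with the projection of the mean.
\<close>

lemma disagreement_le_dist: "disagreement (X :: 'v::euclidean_space^'n) \<le> norm (X - vec v)"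
proof (rule power2_le_imp_le)
  let ?Y = "X - vec (mean X)" and ?w = "mean X - v"
  have "?Y \<bullet> (vec ?w :: 'v^'n) = (\<Sum>i\<in>UNIV. ?Y $ i) \<bullet> ?w"
    by (simp add: inner_vec_def inner_sum_left)
  also have "(\<Sum>i\<in>UNIV. ?Y $ i) = real CARD('n) *\<^sub>R mean ?Y" by (simp add: mean_def)
  also have "mean ?Y = 0" by (simp only: mean_diff mean_vec diff_self)
  finally have orth: "?Y \<bullet> (vec ?w :: 'v^'n) = 0" by simp
  have "X - vec v = ?Y + vec ?w" by (simp add: vec_eq_iff)
  then have "(norm (X - vec v))\<^sup>2 = (norm ?Y)\<^sup>2 + (norm (vec ?w :: 'v^'n))\<^sup>2"
    using norm_add_Pythagorean[of ?Y "vec ?w"] orth by (simp only: orthogonal_def)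
  then show "(disagreement X)\<^sup>2 \<le> (norm (X - vec v))\<^sup>2" by (simp add: disagreement_def)
qed simp

lemma disagreement_le_norm: "disagreement X \<le> norm X"
  using disagreement_le_dist[of X 0] by (simp add: vec_def zero_vec_def[symmetric])

lemma disagreement_add: "disagreement (X + Y) \<le> disagreement X + disagreement Y"
proof -
  have "X + Y - vec (mean (X + Y)) = (X - vec (mean X)) + (Y - vec (mean Y))"
    by (simp add: mean_add vec_eq_iff)
  then show ?thesis unfolding disagreement_def by (metis norm_triangle_ineq)
qed

lemma disagreement_nonneg: "0 \<le> disagreement X" by (simp add: disagreement_def)

lemma project_nonexpansive:
  fixes X :: "'v::euclidean_space^'n"
  assumes "convex S" "closed S" "S \<noteq> {}"
  shows "norm (project S X - project S Y) \<le> norm (X - Y)"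
  by (rule norm_vec_mono) (use closest_point_lipschitz[OF assms] in \<open>simp add: project_def dist_norm\<close>)

lemma project_self: "(\<And>i. X $ i \<in> S) \<Longrightarrow> project S X = X"
  by (simp add: project_def closest_point_self vec_eq_iff)

lemma disagreement_project:
  assumes "convex S" "closed S" "S \<noteq> {}"
  shows "disagreement (project S X) \<le> disagreement X"
proof -
  have "project S (vec (mean X)) = vec (closest_point S (mean X))"
    by (simp add: project_def vec_eq_iff)
  then have "disagreement (project S X) \<le> norm (project S X - project S (vec (mean X)))"
    using disagreement_le_dist by metis
  also have "\<dots> \<le> disagreement X"
    unfolding disagreement_def by (rule project_nonexpansive[OF assms])
  finally show ?thesis .
qed

locale gossip =
  fixes E :: "('n::finite \<times> 'n) set" and W :: "real^'n^'n"
  assumes network: "network_assumption E W"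
begin

definition laplacian :: "'v::euclidean_space^'n \<Rightarrow> 'v^'n" where
  "laplacian X = X - mix W X"

definition \<delta> where "\<delta> = spectral_gap W"
definition \<beta> where "\<beta> = laplacian_norm W"

lemma gap: "0 < \<delta>" "\<delta> \<le> 1" and laplacian_norm_pos: "0 < \<beta>"
  using network by (auto simp: network_assumption_def \<delta>_def \<beta>_def)

lemma row_sum: "(\<Sum>j\<in>UNIV. W $ i $ j) = 1" and col_sum: "(\<Sum>i\<in>UNIV. W $ i $ j) = 1"
  and symmetric: "W $ i $ j = W $ j $ i"
proof -
  show "(\<Sum>j\<in>UNIV. W $ i $ j) = 1" "(\<Sum>i\<in>UNIV. W $ i $ j) = 1"
    using network by (auto simp: network_assumption_def doubly_stochastic_def)
  have "transpose W = W" using network by (simp add: network_assumption_def)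
  then show "W $ i $ j = W $ j $ i" by (metis (no_types) transpose_def vec_lambda_beta)
qed

lemma sum_neighbours: "(\<Sum>j\<in>neighbours E i. W $ i $ j *\<^sub>R q j) = (\<Sum>j\<in>UNIV. W $ i $ j *\<^sub>R (q j :: 'v::real_vector))"
  by (rule sum.mono_neutral_left) (use network in \<open>auto simp: network_assumption_def\<close>)

lemma mix_vec: "mix W (vec v) = vec v"
  by (simp add: mix_def vec_eq_iff scaleR_sum_left[symmetric] row_sum)

lemma mean_mix: "mean (mix W X) = mean X"
proof -
  have "(\<Sum>i\<in>UNIV. \<Sum>j\<in>UNIV. W $ i $ j *\<^sub>R X $ j) = (\<Sum>j\<in>UNIV. \<Sum>i\<in>UNIV. W $ i $ j *\<^sub>R X $ j)"
    by (rule sum.swap)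
  also have "\<dots> = (\<Sum>j\<in>UNIV. X $ j)" by (simp add: scaleR_sum_left[symmetric] col_sum)
  finally show ?thesis by (simp add: mean_def mix_def)
qed

lemma laplacian_add: "laplacian (X + Y) = laplacian X + laplacian Y"
  by (simp add: laplacian_def mix_add)

lemma laplacian_diff: "laplacian (X - Y) = laplacian X - laplacian Y"
  by (simp add: laplacian_def mix_diff)

lemma laplacian_scaleR: "laplacian (t *\<^sub>R X) = t *\<^sub>R laplacian X"
  by (simp add: laplacian_def mix_scaleR scaleR_diff_right)

lemma laplacian_vec: "laplacian (vec v) = 0"
  by (simp add: laplacian_def mix_vec)

lemma laplacian_self_adjoint: "laplacian X \<bullet> Y = X \<bullet> laplacian Y"
proof -
  have "mix W X \<bullet> Y = (\<Sum>i\<in>UNIV. \<Sum>j\<in>UNIV. W $ i $ j * (X $ j \<bullet> Y $ i))"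
    by (simp add: mix_def inner_vec_def inner_sum_left)
  also have "\<dots> = (\<Sum>j\<in>UNIV. \<Sum>i\<in>UNIV. W $ i $ j * (X $ j \<bullet> Y $ i))" by (rule sum.swap)
  also have "\<dots> = (\<Sum>j\<in>UNIV. \<Sum>i\<in>UNIV. W $ j $ i * (X $ j \<bullet> Y $ i))" by (simp only: symmetric)
  also have "\<dots> = X \<bullet> mix W Y"
    by (simp add: mix_def inner_vec_def inner_sum_right)
  finally show ?thesis by (simp add: laplacian_def inner_diff_left inner_diff_right)
qed

lemma norm_laplacian_le: "norm (laplacian X) \<le> \<beta> * norm X"
  using norm_mix_le[of "mat 1 - W" X]
  by (simp add: mix_matrix_diff mix_identity laplacian_def \<beta>_def laplacian_norm_def)

lemma norm_laplacian_le_disagreement: "norm (laplacian X) \<le> \<beta> * disagreement X"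
  using norm_laplacian_le[of "X - vec (mean X)"]
  by (simp add: laplacian_diff laplacian_vec disagreement_def)

text \<open>
  Subtracting the mean is harmless for the mixing step because a doubly stochastic matrix fixes constant vectors and
  preserves means; on the rest, mixing is multiplication by \<open>W - H\<close>, of norm \<open>1 - \<delta>\<close>.
\<close>

lemma norm_mix_minus_mean: "norm (mix W X - vec (mean X)) \<le> (1 - \<delta>) * disagreement X"
proof -
  have "mix (W - averaging_matrix) (X - vec (mean X)) = mix W X - vec (mean X)"
    by (simp only: mix_matrix_diff mix_diff mix_averaging mix_vec mean_vec) simp
  then show ?thesis
    using norm_mix_le[of "W - averaging_matrix" "X - vec (mean X)"]
    by (simp add: disagreement_def \<delta>_def spectral_gap_def)
qed

lemma disagreement_relaxation:
  assumes "0 \<le> \<gamma>" "\<gamma> \<le> 1"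
  shows "disagreement (X - \<gamma> *\<^sub>R laplacian X) \<le> (1 - \<gamma> * \<delta>) * disagreement X"
proof -
  have mean: "mean (X - \<gamma> *\<^sub>R laplacian X) = mean X"
    by (simp add: laplacian_def mean_diff mean_scaleR mean_mix)
  have "X - \<gamma> *\<^sub>R laplacian X - vec (mean X)
      = (1 - \<gamma>) *\<^sub>R (X - vec (mean X)) + \<gamma> *\<^sub>R (mix W X - vec (mean X))"
    by (simp add: laplacian_def algebra_simps)
  then have "disagreement (X - \<gamma> *\<^sub>R laplacian X)
      \<le> norm ((1 - \<gamma>) *\<^sub>R (X - vec (mean X))) + norm (\<gamma> *\<^sub>R (mix W X - vec (mean X)))"
    unfolding disagreement_def mean by (metis norm_triangle_ineq)
  also have "\<dots> = (1 - \<gamma>) * disagreement X + \<gamma> * norm (mix W X - vec (mean X))"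
    using assms by (simp add: disagreement_def)
  also have "\<dots> \<le> (1 - \<gamma>) * disagreement X + \<gamma> * ((1 - \<delta>) * disagreement X)"
    using assms by (intro add_left_mono mult_left_mono norm_mix_minus_mean) auto
  finally show ?thesis by (simp add: algebra_simps)
qed

text \<open>
  On a vector with mean zero, mixing shrinks the norm to a fraction \<open>1 - \<delta>\<close> or less, so the Laplacian must move it
  by at least a fraction \<open>\<delta>\<close>. Such a vector is obtained by centring one that the Laplacian does not annihilate.
\<close>

lemma gap_le_laplacian_norm: "\<delta> \<le> \<beta>"
proof -
  have "onorm ((*v) (mat 1 - W)) \<noteq> 0"
    using laplacian_norm_pos by (simp add: \<beta>_def laplacian_norm_def spectral_norm_def)
  then obtain v where v: "(mat 1 - W) *v v \<noteq> 0"
    by (meson matrix_vector_mul_bounded_linear onorm_eq_0)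
  have m: "A *v x = mix A x" for A :: "real^'n^'n" and x
    by (simp add: mix_def matrix_vector_mult_def vec_eq_iff)
  define Y where "Y = v - vec (mean v)"
  have "laplacian v \<noteq> 0" using v by (simp add: m mix_matrix_diff mix_identity laplacian_def)
  moreover have "laplacian Y = laplacian v" by (simp add: Y_def laplacian_diff laplacian_vec)
  moreover have "laplacian (0 :: real^'n) = 0" using laplacian_diff[of "0 :: real^'n" 0] by simp
  ultimately have "Y \<noteq> 0" by metis
  have Y: "mean Y = 0" by (simp only: Y_def mean_diff mean_vec diff_self)
  then have dis: "disagreement Y = norm Y" by (simp add: disagreement_def vec_def zero_vec_def[symmetric])
  have "norm Y - norm (mix W Y) \<le> norm (laplacian Y)"
    unfolding laplacian_def by (rule norm_triangle_ineq2)
  also have "\<dots> \<le> \<beta> * norm Y" by (rule norm_laplacian_le)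
  finally have "norm Y - norm (mix W Y) \<le> \<beta> * norm Y" .
  moreover have "norm (mix W Y) \<le> (1 - \<delta>) * norm Y"
    using norm_mix_minus_mean[of Y] Y dis by (simp add: vec_def zero_vec_def[symmetric])
  ultimately have "\<delta> * norm Y \<le> \<beta> * norm Y" by (simp add: algebra_simps)
  then show ?thesis using \<open>Y \<noteq> 0\<close> by simp
qed

text \<open>
  One iteration with all randomness frozen: \<open>X\<close> and \<open>X'\<close> are consecutive iterates, \<open>H\<close> the
  updated compressed estimates and \<open>g\<close> the gradient estimates. In all three bounds the Laplacian of
  \<open>H\<close> is split into the Laplacian of \<open>X\<close>, which is controlled by the disagreement, and that of
  the estimation error \<open>X - H\<close>.
\<close>

context
  fixes S :: "'v::euclidean_space set" and X H X' g :: "'v^'n" and \<gamma> \<eta> :: real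
  assumes S: "convex S" "closed S" "S \<noteq> {}"
    and \<gamma>: "0 \<le> \<gamma>" "\<gamma> \<le> 1" and \<eta>: "0 \<le> \<eta>"
    and step: "X' = project S (X - \<gamma> *\<^sub>R laplacian H - \<eta> *\<^sub>R g)"
begin

lemma disagreement_step:
  "disagreement X' \<le> (1 - \<gamma> * \<delta>) * disagreement X + \<gamma> * \<beta> * norm (X - H) + \<eta> * norm g"
proof -
  have "X - \<gamma> *\<^sub>R laplacian H - \<eta> *\<^sub>R g
      = (X - \<gamma> *\<^sub>R laplacian X) + (\<gamma> *\<^sub>R laplacian (X - H) + - (\<eta> *\<^sub>R g))"
    by (simp add: laplacian_diff algebra_simps)
  then have "disagreement X' \<le> disagreement ((X - \<gamma> *\<^sub>R laplacian X) + (\<gamma> *\<^sub>R laplacian (X - H) + - (\<eta> *\<^sub>R g)))"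
    unfolding step using disagreement_project[OF S] by metis
  also have "\<dots> \<le> disagreement (X - \<gamma> *\<^sub>R laplacian X) + norm (\<gamma> *\<^sub>R laplacian (X - H) + - (\<eta> *\<^sub>R g))"
    by (rule order_trans[OF disagreement_add]) (simp add: disagreement_le_norm)
  also have "\<dots> \<le> (1 - \<gamma> * \<delta>) * disagreement X + (\<gamma> * norm (laplacian (X - H)) + \<eta> * norm g)"
    using \<gamma> \<eta> by (intro add_mono disagreement_relaxation norm_triangle_le) auto
  also have "\<gamma> * norm (laplacian (X - H)) \<le> \<gamma> * (\<beta> * norm (X - H))"
    using \<gamma> by (intro mult_left_mono norm_laplacian_le) auto
  finally show ?thesis by simp
qed

lemma norm_laplacian_estimate: "norm (laplacian H) \<le> \<beta> * (disagreement X + norm (X - H))"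
proof -
  have "laplacian H = laplacian X - laplacian (X - H)" by (simp add: laplacian_diff)
  then have "norm (laplacian H) \<le> norm (laplacian X) + norm (laplacian (X - H))"
    by (metis norm_triangle_ineq4)
  also have "\<dots> \<le> \<beta> * disagreement X + \<beta> * norm (X - H)"
    by (intro add_mono norm_laplacian_le norm_laplacian_le_disagreement)
  finally show ?thesis by (simp add: algebra_simps)
qed

lemma estimate_error_step:
  assumes X: "\<And>i. X $ i \<in> S"
  shows "norm (X' - H) \<le> \<gamma> * \<beta> * disagreement X + (1 + \<gamma> * \<beta>) * norm (X - H) + \<eta> * norm g"
proof -
  have "norm (X' - X) \<le> norm (X - \<gamma> *\<^sub>R laplacian H - \<eta> *\<^sub>R g - X)"
    using project_nonexpansive[OF S, of _ X] project_self[of X S] X unfolding step by metis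
  also have "X - \<gamma> *\<^sub>R laplacian H - \<eta> *\<^sub>R g - X = - (\<gamma> *\<^sub>R laplacian H + \<eta> *\<^sub>R g)" by simp
  also have "norm (- (\<gamma> *\<^sub>R laplacian H + \<eta> *\<^sub>R g)) \<le> \<gamma> * norm (laplacian H) + \<eta> * norm g"
    unfolding norm_minus_cancel using \<gamma> \<eta> by (intro norm_triangle_le) auto
  also have "\<gamma> * norm (laplacian H) \<le> \<gamma> * (\<beta> * (disagreement X + norm (X - H)))"
    using \<gamma> by (intro mult_left_mono norm_laplacian_estimate) auto
  finally have "norm (X' - X) \<le> \<gamma> * (\<beta> * (disagreement X + norm (X - H))) + \<eta> * norm g" by simp
  moreover have "norm (X' - H) \<le> norm (X' - X) + norm (X - H)"
    using norm_triangle_ineq[of "X' - X" "X - H"] by simp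
  ultimately show ?thesis by (simp add: algebra_simps)
qed

text \<open>
  The correction term has no first-order effect on the distance to a constant vector: the Laplacian is self-adjoint and
  annihilates constants, so its inner product with \<open>X - vec z\<close> is quadratic in the disagreement and the
  estimation error.
\<close>

lemma distance_step:
  assumes z: "z \<in> S"
  shows "2 * \<eta> * ((X - vec z) \<bullet> g) \<le> (norm (X - vec z))\<^sup>2 - (norm (X' - vec z))\<^sup>2
    + (3 * \<gamma> * \<beta> + 4 * \<gamma>\<^sup>2 * \<beta>\<^sup>2) * ((disagreement X)\<^sup>2 + (norm (X - H))\<^sup>2) + 2 * \<eta>\<^sup>2 * (norm g)\<^sup>2"
proof -
  let ?a = "disagreement X" and ?y = "norm (X - H)" and ?d = "\<gamma> *\<^sub>R laplacian H + \<eta> *\<^sub>R g"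
  have b: "0 \<le> \<beta>" using laplacian_norm_pos by simp
  have "norm (X' - vec z) \<le> norm (X - \<gamma> *\<^sub>R laplacian H - \<eta> *\<^sub>R g - vec z)"
    using project_nonexpansive[OF S, of _ "vec z"] project_self[of "vec z" S] z unfolding step
    by (metis vec_component)
  then have "(norm (X' - vec z))\<^sup>2 \<le> (norm ((X - vec z) - ?d))\<^sup>2"
    by (intro power_mono) (auto simp: algebra_simps)
  also have "\<dots> = (norm (X - vec z))\<^sup>2 - 2 * ((X - vec z) \<bullet> ?d) + (norm ?d)\<^sup>2"
    unfolding power2_norm_eq_inner by (simp add: inner_diff_left inner_diff_right inner_commute)
  also have "(X - vec z) \<bullet> ?d = \<gamma> * ((X - vec z) \<bullet> laplacian H) + \<eta> * ((X - vec z) \<bullet> g)"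
    by (simp add: inner_add_right)
  finally have A: "2 * \<eta> * ((X - vec z) \<bullet> g) \<le> (norm (X - vec z))\<^sup>2 - (norm (X' - vec z))\<^sup>2
      + 2 * \<gamma> * - ((X - vec z) \<bullet> laplacian H) + (norm ?d)\<^sup>2"
    by (simp add: algebra_simps)
  have "(X - vec z) \<bullet> laplacian H = laplacian X \<bullet> H"
    by (simp add: laplacian_self_adjoint[symmetric] laplacian_diff laplacian_vec)
  also have "\<dots> = laplacian X \<bullet> X - laplacian X \<bullet> (X - H)" by (simp add: inner_diff_right)
  also have "laplacian X \<bullet> X = laplacian X \<bullet> (X - vec (mean X))"
    by (simp add: inner_diff_right laplacian_self_adjoint laplacian_vec)
  finally have "- ((X - vec z) \<bullet> laplacian H) \<le> norm (laplacian X) * ?a + norm (laplacian X) * ?y"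
    using Cauchy_Schwarz_ineq2[of "laplacian X" "X - vec (mean X)"]
      Cauchy_Schwarz_ineq2[of "laplacian X" "X - H"] unfolding disagreement_def by linarith
  also have "\<dots> = norm (laplacian X) * (?a + ?y)" by (simp add: algebra_simps)
  also have "\<dots> \<le> \<beta> * ?a * (?a + ?y)"
    by (intro mult_right_mono norm_laplacian_le_disagreement) (simp add: disagreement_nonneg)
  also have "\<dots> = \<beta> * (?a\<^sup>2 + ?a * ?y)" by (simp add: power2_eq_square algebra_simps)
  also have "\<dots> \<le> \<beta> * (3 / 2 * (?a\<^sup>2 + ?y\<^sup>2))"
  proof (intro mult_left_mono b)
    show "?a\<^sup>2 + ?a * ?y \<le> 3 / 2 * (?a\<^sup>2 + ?y\<^sup>2)"
    proof -
      have "2 * (?a * ?y) \<le> ?a\<^sup>2 + ?y\<^sup>2" using sum_squares_bound[of ?a ?y] by (simp only: mult.assoc)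
      then show ?thesis using zero_le_power2[of ?y] unfolding distrib_left by linarith
    qed
  qed
  finally have B: "2 * \<gamma> * - ((X - vec z) \<bullet> laplacian H) \<le> 2 * \<gamma> * (\<beta> * (3 / 2 * (?a\<^sup>2 + ?y\<^sup>2)))"
    using \<gamma> by (intro mult_left_mono) auto
  have sq: "(p + q)\<^sup>2 \<le> 2 * p\<^sup>2 + 2 * q\<^sup>2" for p q :: real
    using sum_squares_bound[of p q] by (simp add: power2_sum)
  have "norm ?d \<le> \<gamma> * norm (laplacian H) + \<eta> * norm g"
    using \<gamma> \<eta> by (intro norm_triangle_le) auto
  also have "\<dots> \<le> \<gamma> * (\<beta> * (?a + ?y)) + \<eta> * norm g"
    using \<gamma> by (intro add_right_mono mult_left_mono norm_laplacian_estimate) auto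
  finally have "(norm ?d)\<^sup>2 \<le> (\<gamma> * (\<beta> * (?a + ?y)) + \<eta> * norm g)\<^sup>2" by (intro power_mono) auto
  also have "\<dots> \<le> 2 * (\<gamma> * (\<beta> * (?a + ?y)))\<^sup>2 + 2 * (\<eta> * norm g)\<^sup>2" by (rule sq)
  also have "\<dots> = 2 * (\<gamma>\<^sup>2 * \<beta>\<^sup>2) * (?a + ?y)\<^sup>2 + 2 * \<eta>\<^sup>2 * (norm g)\<^sup>2" by (simp add: power_mult_distrib)
  also have "\<dots> \<le> 2 * (\<gamma>\<^sup>2 * \<beta>\<^sup>2) * (2 * ?a\<^sup>2 + 2 * ?y\<^sup>2) + 2 * \<eta>\<^sup>2 * (norm g)\<^sup>2"
    by (intro add_right_mono mult_left_mono sq) auto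
  finally have C: "(norm ?d)\<^sup>2 \<le> 2 * (\<gamma>\<^sup>2 * \<beta>\<^sup>2) * (2 * ?a\<^sup>2 + 2 * ?y\<^sup>2) + 2 * \<eta>\<^sup>2 * (norm g)\<^sup>2" .
  have "(3 * \<gamma> * \<beta> + 4 * \<gamma>\<^sup>2 * \<beta>\<^sup>2) * (?a\<^sup>2 + ?y\<^sup>2)
      = 2 * \<gamma> * (\<beta> * (3 / 2 * (?a\<^sup>2 + ?y\<^sup>2))) + 2 * (\<gamma>\<^sup>2 * \<beta>\<^sup>2) * (2 * ?a\<^sup>2 + 2 * ?y\<^sup>2)"
    by (simp add: algebra_simps)
  with A B C show ?thesis by linarith
qed

end

end

section \<open>The coupled error recursion\<close>

text \<open>
  The first component bounds the root mean square of the disagreement, the second one that of the estimation error.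
  Index \<open>k\<close> belongs to iteration \<open>k + 1\<close>: the initial point need not lie in the shrunk
  constraint set, so the recursion is started after one iteration, from the crude bound \<open>B\<close>.
\<close>

primrec error_bounds ::
    "real \<Rightarrow> real \<Rightarrow> real \<Rightarrow> real \<Rightarrow> (nat \<Rightarrow> real) \<Rightarrow> real \<Rightarrow> nat \<Rightarrow> real \<times> real" where
  "error_bounds \<gamma> \<delta> \<beta> \<rho> g B 0 = (B, B)"
| "error_bounds \<gamma> \<delta> \<beta> \<rho> g B (Suc k) =
     (let a = fst (error_bounds \<gamma> \<delta> \<beta> \<rho> g B k); e = snd (error_bounds \<gamma> \<delta> \<beta> \<rho> g B k)
      in ((1 - \<gamma> * \<delta>) * a + \<gamma> * \<beta> * (\<rho> * e) + g (Suc k),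
          \<gamma> * \<beta> * a + (1 + \<gamma> * \<beta>) * (\<rho> * e) + g (Suc k)))"

text \<open>
  The weights \<open>(1, lam)\<close> play the role of a left eigenvector of the recursion matrix. The disagreement column
  contracts as soon as \<open>lam < \<delta> / \<beta>\<close>; the factor \<open>1 / (1 + \<delta>)\<close> provides the slack. The
  column of the estimation error has the weighted sum
  \<open>lam (1 - c0) (1 + \<gamma> (\<beta> + \<beta>\<^sup>2 (1 + \<delta>) / \<delta>))\<close>. Because \<open>\<delta> \<le> \<beta>\<close>, the factor of \<open>\<gamma>\<close> is
  at most \<open>(1 + 2 / \<delta>) \<beta>\<^sup>2 \<le> \<kappa>\<^sub>2\<close>, and \<open>\<gamma> \<kappa>\<^sub>2 < c0\<close> leaves at most
  \<open>lam (1 - c0) (1 + c0) < lam\<close>.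
\<close>

lemma error_bounds_contraction:
  fixes \<gamma> \<delta> \<beta> c0 :: real
  assumes \<gamma>: "0 < \<gamma>" "\<gamma> < 1" and \<delta>: "0 < \<delta>" "\<delta> \<le> 1" and \<beta>: "\<delta> \<le> \<beta>" and c0: "0 < c0" "c0 \<le> 1"
    and small: "\<gamma> * const_\<kappa>2 c0 \<gamma> \<delta> \<beta> < c0"
  defines "lam \<equiv> \<delta> / (\<beta> * (1 + \<delta>))"
  shows "\<exists>\<tau>. 0 < \<tau> \<and> \<tau> \<le> 1 \<and> (\<forall>a e. 0 \<le> a \<longrightarrow> 0 \<le> e \<longrightarrow>
      ((1 - \<gamma> * \<delta>) * a + \<gamma> * \<beta> * ((1 - c0) * e)) + lam * (\<gamma> * \<beta> * a + (1 + \<gamma> * \<beta>) * ((1 - c0) * e))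
        \<le> (1 - \<tau>) * (a + lam * e))"
proof (intro exI conjI allI impI)
  define \<tau> where "\<tau> = min (\<gamma> * \<delta>\<^sup>2 / (1 + \<delta>)) (c0\<^sup>2)"
  have \<beta>0: "0 < \<beta>" using \<delta> \<beta> by simp
  have lam: "0 < lam" using \<delta> \<beta>0 by (simp add: lam_def)
  show "0 < \<tau>" using \<gamma> \<delta> c0 by (simp add: \<tau>_def)
  have "c0\<^sup>2 \<le> 1" using c0 by (simp add: power_le_one)
  then show "\<tau> \<le> 1" by (simp add: \<tau>_def)
  fix a e :: real assume a: "0 \<le> a" and e: "0 \<le> e"
  have A: "(1 - \<gamma> * \<delta>) + lam * (\<gamma> * \<beta>) \<le> 1 - \<tau>"
  proof -
    have "lam * (\<gamma> * \<beta>) = \<gamma> * \<delta> / (1 + \<delta>)" using \<beta>0 by (simp add: lam_def)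
    moreover have "\<gamma> * \<delta> - \<gamma> * \<delta> / (1 + \<delta>) = \<gamma> * \<delta>\<^sup>2 / (1 + \<delta>)"
      using \<delta> by (simp add: field_simps power2_eq_square)
    ultimately show ?thesis by (simp add: \<tau>_def)
  qed
  have Ee: "\<gamma> * \<beta> * (1 - c0) + lam * ((1 + \<gamma> * \<beta>) * (1 - c0)) \<le> (1 - \<tau>) * lam"
  proof -
    have "\<beta> * \<delta> * \<delta> \<le> \<beta> * \<delta> * \<beta>" using \<beta> \<beta>0 \<delta> by (intro mult_left_mono) simp_all
    then have "\<beta> + \<beta>\<^sup>2 * (1 + \<delta>) / \<delta> \<le> (1 + 2 / \<delta>) * \<beta>\<^sup>2"
      using \<delta> by (simp add: field_simps power2_eq_square mult_ac)
    also have "\<dots> \<le> const_\<kappa>2 c0 \<gamma> \<delta> \<beta>" using \<gamma> by (simp add: const_\<kappa>2_def)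
    finally have "\<gamma> * (\<beta> + \<beta>\<^sup>2 * (1 + \<delta>) / \<delta>) \<le> \<gamma> * const_\<kappa>2 c0 \<gamma> \<delta> \<beta>"
      using \<gamma> by (intro mult_left_mono) simp_all
    with small have x: "\<gamma> * (\<beta> + \<beta>\<^sup>2 * (1 + \<delta>) / \<delta>) \<le> c0" by simp
    define y where "y = \<gamma> * (\<beta>\<^sup>2 * (1 + \<delta>) / \<delta>)"
    have y: "\<gamma> * \<beta> = lam * y" using \<delta> \<beta>0 by (simp add: y_def lam_def power2_eq_square)
    have "\<gamma> * \<beta> * (1 - c0) + lam * ((1 + \<gamma> * \<beta>) * (1 - c0))
        = lam * y * (1 - c0) + lam * ((1 + \<gamma> * \<beta>) * (1 - c0))" by (simp only: y[symmetric])
    also have "\<dots> = lam * ((1 - c0) * (1 + (\<gamma> * \<beta> + y)))" by (simp add: algebra_simps)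
    also have "\<gamma> * \<beta> + y = \<gamma> * (\<beta> + \<beta>\<^sup>2 * (1 + \<delta>) / \<delta>)" by (simp only: y_def distrib_left)
    also have "lam * ((1 - c0) * (1 + \<gamma> * (\<beta> + \<beta>\<^sup>2 * (1 + \<delta>) / \<delta>))) \<le> lam * ((1 - c0) * (1 + c0))"
      using lam c0 x by (intro mult_left_mono) simp_all
    also have "\<dots> = lam * (1 - c0\<^sup>2)" by (simp add: power2_eq_square algebra_simps)
    also have "\<dots> \<le> lam * (1 - \<tau>)" using lam by (intro mult_left_mono) (simp_all add: \<tau>_def)
    finally show ?thesis by (simp add: mult.commute)
  qed
  have "((1 - \<gamma> * \<delta>) * a + \<gamma> * \<beta> * ((1 - c0) * e)) + lam * (\<gamma> * \<beta> * a + (1 + \<gamma> * \<beta>) * ((1 - c0) * e))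
      = ((1 - \<gamma> * \<delta>) + lam * (\<gamma> * \<beta>)) * a + (\<gamma> * \<beta> * (1 - c0) + lam * ((1 + \<gamma> * \<beta>) * (1 - c0))) * e"
    by (simp add: algebra_simps)
  also have "\<dots> \<le> (1 - \<tau>) * a + ((1 - \<tau>) * lam) * e"
    by (intro add_mono mult_right_mono A Ee a e)
  finally show "((1 - \<gamma> * \<delta>) * a + \<gamma> * \<beta> * ((1 - c0) * e)) + lam * (\<gamma> * \<beta> * a + (1 + \<gamma> * \<beta>) * ((1 - c0) * e))
        \<le> (1 - \<tau>) * (a + lam * e)" by (simp add: algebra_simps)
qed

section \<open>The two-point estimate as a gradient of a smoothed function\<close>

lemma lborel_integral_translate:
  fixes g :: "'v::euclidean_space \<Rightarrow> real"
  assumes [measurable]: "g \<in> borel_measurable borel"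
  shows "(\<integral>v. g (v + a) \<partial>lborel) = (\<integral>v. g v \<partial>lborel)"
proof -
  have "(\<integral>v. g v \<partial>lborel) = (\<integral>v. g v \<partial>distr lborel borel ((+) a))"
    by (simp add: lborel_distr_plus)
  also have "\<dots> = (\<integral>v. g (v + a) \<partial>lborel)"
    by (subst integral_distr) (auto simp: add.commute)
  finally show ?thesis by simp
qed

lemma lborel_integral_dilate:
  fixes g :: "'v::euclidean_space \<Rightarrow> real"
  assumes [measurable]: "g \<in> borel_measurable borel" and "0 < t"
  shows "(\<integral>v. g v \<partial>lborel) = t ^ DIM('v) * (\<integral>v. g (t *\<^sub>R v) \<partial>lborel)"
proof -
  have "(\<integral>v. g v \<partial>lborel)
      = (\<integral>v. g v \<partial>density (distr lborel borel (\<lambda>x. 0 + t *\<^sub>R x)) (\<lambda>_. \<bar>t\<bar>^DIM('v)))"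
    using lborel_affine[of t "0::'v"] assms by simp
  also have "\<dots> = (\<integral>v. t ^ DIM('v) * g v \<partial>distr lborel borel (\<lambda>x. 0 + t *\<^sub>R x))"
    using assms by (subst integral_density) (auto)
  also have "\<dots> = (\<integral>v. t ^ DIM('v) * g (t *\<^sub>R v) \<partial>lborel)"
    by (subst integral_distr) auto
  finally show ?thesis by simp
qed

lemma sgn_borel [measurable]: "(sgn :: 'v::euclidean_space \<Rightarrow> 'v) \<in> borel_measurable borel"
  unfolding sgn_div_norm[abs_def] by measurable

text \<open>
  A function of the direction alone integrates over a ball like the volume of the ball. This links the shells of the
  ramp to the uniform distribution on the sphere, which is defined by radial projection.
\<close>

lemma integral_ball_radial:
  fixes \<psi> :: "'v::euclidean_space \<Rightarrow> real"
  assumes [measurable]: "\<psi> \<in> borel_measurable borel" and t: "0 < t"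
  shows "(\<integral>v. indicator (ball 0 t) v * \<psi> (sgn v) \<partial>lborel)
       = t ^ DIM('v) * (\<integral>v. indicator (ball 0 1) v * \<psi> (sgn v) \<partial>lborel)"
proof -
  have "(\<integral>v. indicator (ball 0 t) v * \<psi> (sgn v) \<partial>lborel)
      = t ^ DIM('v) * (\<integral>v. indicator (ball 0 t) (t *\<^sub>R v) * \<psi> (sgn (t *\<^sub>R v)) \<partial>lborel)"
    by (intro lborel_integral_dilate[OF _ t] borel_measurable_times borel_measurable_indicator
        measurable_compose[OF sgn_borel]) auto
  also have "(\<lambda>v. indicator (ball 0 t) (t *\<^sub>R v) * \<psi> (sgn (t *\<^sub>R v)))
           = (\<lambda>v::'v. indicator (ball 0 1) v * \<psi> (sgn v))"
    using t by (auto simp: fun_eq_iff indicator_def sgn_scaleR)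
  finally show ?thesis .
qed

text \<open>
  A Lipschitz approximation of the indicator of the unit ball. Its gradient is \<open>- sgn v / \<theta>\<close> on the shell
  \<open>1 - \<theta> < norm v < 1\<close> and zero elsewhere, so that integrating against the gradient approximates integration
  over the unit sphere.
\<close>

definition ramp :: "real \<Rightarrow> 'v::real_normed_vector \<Rightarrow> real" where
  "ramp \<theta> v = max 0 (min 1 ((1 - norm v) / \<theta>))"

lemma ramp_measurable [measurable]: "(ramp \<theta> :: 'v::euclidean_space \<Rightarrow> real) \<in> borel_measurable borel"
  unfolding ramp_def[abs_def] by measurable

lemma ramp_bounds: "0 \<le> ramp \<theta> v" "ramp \<theta> v \<le> 1" "\<bar>ramp \<theta> v\<bar> \<le> 1"
  by (auto simp: ramp_def)

lemma ramp_eq_0: "0 < \<theta> \<Longrightarrow> 1 \<le> norm v \<Longrightarrow> ramp \<theta> v = 0"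
  by (auto simp: ramp_def max_def min_def divide_simps split: if_splits)

lemma ramp_eq_1: "0 < \<theta> \<Longrightarrow> norm v \<le> 1 - \<theta> \<Longrightarrow> ramp \<theta> v = 1"
  by (auto simp: ramp_def max_def min_def divide_simps split: if_splits)

lemma ramp_eq_mid: "0 < \<theta> \<Longrightarrow> 1 - \<theta> \<le> norm v \<Longrightarrow> norm v \<le> 1 \<Longrightarrow> ramp \<theta> v = (1 - norm v) / \<theta>"
  by (auto simp: ramp_def max_def min_def divide_simps split: if_splits)

lemma ramp_lipschitz:
  assumes "0 < \<theta>" shows "\<bar>ramp \<theta> v - ramp \<theta> w\<bar> \<le> norm (v - w) / \<theta>"
proof -
  have "\<bar>ramp \<theta> v - ramp \<theta> w\<bar> \<le> \<bar>(1 - norm v) / \<theta> - (1 - norm w) / \<theta>\<bar>"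
    unfolding ramp_def by (auto simp: max_def min_def abs_if)
  also have "\<dots> = \<bar>norm w - norm v\<bar> / \<theta>"
    using assms by (simp add: diff_divide_distrib[symmetric])
  also have "\<dots> \<le> norm (v - w) / \<theta>"
    using assms by (intro divide_right_mono) (metis norm_minus_commute norm_triangle_ineq3, simp)
  finally show ?thesis .
qed

lemma ramp_directional_derivative:
  fixes v h :: "'v::euclidean_space"
  assumes \<theta>: "0 < \<theta>" "\<theta> < 1" and v: "norm v \<noteq> 1" "norm v \<noteq> 1 - \<theta>"
    and s: "s \<longlonglongrightarrow> 0" "\<And>n. s n \<noteq> 0"
  shows "(\<lambda>n. (ramp \<theta> v - ramp \<theta> (v + s n *\<^sub>R h)) / s n)
           \<longlonglongrightarrow> (if 1 - \<theta> < norm v \<and> norm v < 1 then sgn v \<bullet> h / \<theta> else 0)"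
proof -
  have lim: "(\<lambda>n. v + s n *\<^sub>R h) \<longlonglongrightarrow> v"
    by (rule tendsto_eq_intros refl s)+ simp
  have nlim: "(\<lambda>n. norm (v + s n *\<^sub>R h)) \<longlonglongrightarrow> norm v"
    by (intro tendsto_norm lim)
  consider "norm v < 1 - \<theta>" | "1 - \<theta> < norm v" "norm v < 1" | "norm v > 1"
    using v by linarith
  then show ?thesis
  proof cases
    case 1
    have "\<forall>\<^sub>F n in sequentially. norm (v + s n *\<^sub>R h) < 1 - \<theta>"
      using order_tendstoD(2)[OF nlim] 1 by blast
    then have "\<forall>\<^sub>F n in sequentially. (ramp \<theta> v - ramp \<theta> (v + s n *\<^sub>R h)) / s n = 0"
      by eventually_elim (use 1 \<theta> in \<open>simp add: ramp_eq_1\<close>)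
    then show ?thesis using 1 by (auto intro: tendsto_eventually)
  next
    case 3
    have "\<forall>\<^sub>F n in sequentially. norm (v + s n *\<^sub>R h) > 1"
      using order_tendstoD(1)[OF nlim] 3 by blast
    then have "\<forall>\<^sub>F n in sequentially. (ramp \<theta> v - ramp \<theta> (v + s n *\<^sub>R h)) / s n = 0"
      by eventually_elim (use 3 \<theta> in \<open>simp add: ramp_eq_0\<close>)
    then show ?thesis using 3 by (auto intro: tendsto_eventually)
  next
    case 2
    have v0: "v \<noteq> 0" using 2 \<theta> by auto
    have "((\<lambda>r. norm (v + r *\<^sub>R h)) has_derivative (\<lambda>r. (r *\<^sub>R h) \<bullet> sgn v)) (at 0)"
      by (rule has_derivative_compose[where g=norm and f="\<lambda>r. v + r *\<^sub>R h" and f'="\<lambda>r. r *\<^sub>R h", simplified])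
         (auto intro!: derivative_eq_intros simp: has_derivative_norm v0)
    then have "((\<lambda>r. norm (v + r *\<^sub>R h)) has_field_derivative (h \<bullet> sgn v)) (at 0)"
      unfolding has_field_derivative_def
      by (rule has_derivative_eq_rhs) (simp add: fun_eq_iff mult.commute)
    then have "((\<lambda>r. (norm (v + r *\<^sub>R h) - norm v) / r) \<longlongrightarrow> h \<bullet> sgn v) (at 0)"
      by (simp add: DERIV_def)
    moreover have "filterlim s (at 0) sequentially"
      using s by (simp add: filterlim_at)
    ultimately have "(\<lambda>n. (norm (v + s n *\<^sub>R h) - norm v) / s n) \<longlonglongrightarrow> h \<bullet> sgn v"
      by (rule filterlim_compose)
    then have A: "(\<lambda>n. (norm (v + s n *\<^sub>R h) - norm v) / s n / \<theta>) \<longlonglongrightarrow> h \<bullet> sgn v / \<theta>"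
      using \<theta> by (intro tendsto_divide) auto
    have "\<forall>\<^sub>F n in sequentially. norm (v + s n *\<^sub>R h) > 1 - \<theta>"
      "\<forall>\<^sub>F n in sequentially. norm (v + s n *\<^sub>R h) < 1"
      using order_tendstoD[OF nlim] 2 by blast+
    then have "\<forall>\<^sub>F n in sequentially. (norm (v + s n *\<^sub>R h) - norm v) / s n / \<theta>
        = (ramp \<theta> v - ramp \<theta> (v + s n *\<^sub>R h)) / s n"
      by eventually_elim
         (use 2 \<theta> s(2) in \<open>simp add: ramp_eq_mid field_simps\<close>)
    from Lim_transform_eventually[OF A this] 2 show ?thesis
      by (simp add: inner_commute)
  qed
qed

lemma integrable_bounded_support:
  fixes g :: "'v::euclidean_space \<Rightarrow> real"
  assumes [measurable]: "g \<in> borel_measurable borel"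
    and "\<And>v. norm v \<le> R \<Longrightarrow> \<bar>g v\<bar> \<le> B" and "\<And>v. R < norm v \<Longrightarrow> g v = 0"
  shows "integrable lborel g"
proof (rule Bochner_Integration.integrable_bound[where f="\<lambda>v. indicator (cball 0 R) v * B"])
  have "emeasure lborel (cball (0::'v) R) < \<infinity>" by (rule emeasure_lborel_cball_finite)
  then show "integrable lborel (\<lambda>v::'v. indicator (cball 0 R) v * B)"
    by (intro integrable_mult_left) (simp add: integrable_indicator_iff)
  show "AE v in lborel. norm (g v) \<le> norm (indicator (cball 0 R) v * B)"
    using assms(2,3) by (intro AE_I2) (force simp: indicator_def not_le)
qed simp

lemma AE_not_sphere: "AE (v::'v::euclidean_space) in lborel. v \<notin> sphere a e"
  using negligible_sphere[of a e]
  by (intro AE_not_in) (auto simp: negligible_iff_null_sets null_sets_completion_iff)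

lemma ramp_integral_bounds:
  fixes \<theta> :: real
  assumes \<theta>: "0 < \<theta>" "\<theta> < 1"
  defines "vol \<equiv> (\<integral>(v::'v::euclidean_space). indicator (ball 0 1) v * 1 \<partial>lborel)"
  shows "(1 - \<theta>) ^ DIM('v) * vol \<le> (\<integral>(v::'v). ramp \<theta> v \<partial>lborel)"
    and "(\<integral>(v::'v). ramp \<theta> v \<partial>lborel) \<le> vol"
proof -
  have int: "integrable lborel (ramp \<theta> :: 'v \<Rightarrow> real)"
    by (rule integrable_bounded_support[where R=1 and B=1])
       (use \<theta> in \<open>auto simp: ramp_bounds ramp_eq_0\<close>)
  have intb: "integrable lborel (\<lambda>v::'v. indicator (ball 0 t) v * 1 :: real)" for t
    by (rule integrable_bounded_support[where R="\<bar>t\<bar>" and B=1]) (auto simp: indicator_def)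
  have "(1 - \<theta>) ^ DIM('v) * vol = (\<integral>(v::'v). indicator (ball 0 (1 - \<theta>)) v * 1 \<partial>lborel)"
    unfolding vol_def using \<theta> by (subst integral_ball_radial[where \<psi>="\<lambda>_. 1"]) auto
  also have "\<dots> \<le> (\<integral>(v::'v). ramp \<theta> v \<partial>lborel)"
    by (intro integral_mono int intb) (use \<theta> in \<open>auto simp: indicator_def ramp_eq_1 ramp_bounds\<close>)
  finally show "(1 - \<theta>) ^ DIM('v) * vol \<le> (\<integral>(v::'v). ramp \<theta> v \<partial>lborel)" .
  show "(\<integral>(v::'v). ramp \<theta> v \<partial>lborel) \<le> vol"
    unfolding vol_def
    by (intro integral_mono int intb) (use \<theta> in \<open>auto simp: indicator_def ramp_eq_0 ramp_bounds\<close>)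
qed

text \<open>
  A discrete integration by parts. Convexity bounds the decrease of \<open>f\<close> along the segment from
  \<open>x + \<mu> v\<close> towards \<open>z + \<mu> v\<close> from below by the proportional part of
  \<open>f(x + \<mu> v) - f(z + \<mu> v)\<close>. Integrate this against the ramp, use translation invariance to move the shift from
  \<open>f\<close> to the ramp, divide by the length of the shift and let it tend to zero: the right-hand side becomes the
  integral of \<open>f\<close> against the directional derivative of the ramp. No derivative of \<open>f\<close> appears.
\<close>

lemma convex_shell_inequality:
  fixes f :: "'v::euclidean_space \<Rightarrow> real"
  assumes lip: "L-lipschitz_on UNIV f" and conv: "convex_on K f"
    and K: "cball x \<mu> \<subseteq> K" "cball z \<mu> \<subseteq> K" and \<mu>: "0 < \<mu>" and \<theta>: "0 < \<theta>" "\<theta> < 1"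
  defines "h \<equiv> (x - z) /\<^sub>R \<mu>"
  shows "(f x - f z - 2 * \<mu> * L) * (\<integral>(v::'v). ramp \<theta> v \<partial>lborel)
    \<le> (\<integral>v. (if 1 - \<theta> < norm v \<and> norm v < 1 then (f (x + \<mu> *\<^sub>R v) - f x) * (sgn v \<bullet> h) / \<theta> else 0) \<partial>lborel)"
proof -
  define \<phi> where "\<phi> v = f (x + \<mu> *\<^sub>R v) - f x" for v
  define c where "c = f x - f z - 2 * \<mu> * L"
  have L: "0 \<le> L" using lip by (rule lipschitz_on_nonneg)
  have fl: "\<bar>f a - f b\<bar> \<le> L * norm (a - b)" for a b
    using lipschitz_onD[OF lip, of a b] by (simp add: dist_norm)
  have fm [measurable]: "f \<in> borel_measurable borel"
    by (intro borel_measurable_continuous_onI lipschitz_on_continuous_on[OF lip])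
  have \<phi>m [measurable]: "\<phi> \<in> borel_measurable borel"
    unfolding \<phi>_def[abs_def] by measurable
  have \<phi>b: "\<bar>\<phi> v\<bar> \<le> L * \<mu> * norm v" for v
    using fl[of "x + \<mu> *\<^sub>R v" x] \<mu> by (simp add: \<phi>_def mult.assoc)
  have \<phi>b': "\<bar>\<phi> v\<bar> \<le> L * \<mu> * R" if "norm v \<le> R" for v R
    using \<phi>b[of v] mult_left_mono[OF that, of "L * \<mu>"] L \<mu> by simp
  define s where "s n = 1 / real (Suc n)" for n
  have s0: "0 < s n" and s1: "s n \<le> 1" for n by (auto simp: s_def divide_simps)
  have slim: "s \<longlonglongrightarrow> 0" unfolding s_def by (rule LIMSEQ_Suc) (rule lim_1_over_n)
  let ?q = "\<lambda>n v. (ramp \<theta> v - ramp \<theta> (v + s n *\<^sub>R h)) / s n"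
  let ?lim = "\<lambda>v. if 1 - \<theta> < norm v \<and> norm v < 1 then sgn v \<bullet> h / \<theta> else 0"
  define R where "R = 1 + norm h"
  have supp: "ramp \<theta> (v + t *\<^sub>R h) = 0" if "R < norm v" "0 \<le> t" "t \<le> 1" for v t
  proof -
    have "norm (t *\<^sub>R h) \<le> norm h" using that by (simp add: mult_left_le_one_le)
    with norm_triangle_ineq2[of v "- (t *\<^sub>R h)"] that(1) show ?thesis
      using \<theta> by (intro ramp_eq_0) (auto simp: R_def)
  qed
  have supp0: "ramp \<theta> v = 0" if "R < norm v" for v :: 'v using supp[OF that, of 0] by simp
  \<comment> \<open>Before the limit: the difference quotient of the ramp in place of its derivative.\<close>
  have lower: "c * (\<integral>(v::'v). ramp \<theta> v \<partial>lborel) \<le> (\<integral>v. \<phi> v * ?q n v \<partial>lborel)" for n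
  proof -
    have i1: "integrable lborel (\<lambda>v. \<phi> v * ramp \<theta> v)"
      by (rule integrable_bounded_support[where R=R and B="L * \<mu> * R"])
         (use ramp_bounds(3) in \<open>auto simp: supp0 abs_mult intro!: mult_right_le_one_le[THEN order_trans] \<phi>b'\<close>)
    have i2: "integrable lborel (\<lambda>v. \<phi> v * ramp \<theta> (v + s n *\<^sub>R h))"
      by (rule integrable_bounded_support[where R=R and B="L * \<mu> * R"])
         (use ramp_bounds(3) in \<open>auto simp: supp s1 less_imp_le[OF s0] abs_mult
            intro!: mult_right_le_one_le[THEN order_trans] \<phi>b'\<close>)
    have i3: "integrable lborel (\<lambda>v. \<phi> (v - s n *\<^sub>R h) * ramp \<theta> v)"
    proof (rule integrable_bounded_support[where R=1 and B="L * \<mu> * R"])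
      show "\<bar>\<phi> (v - s n *\<^sub>R h) * ramp \<theta> v\<bar> \<le> L * \<mu> * R" if "norm v \<le> 1" for v
      proof -
        have "norm (v - s n *\<^sub>R h) \<le> norm v + norm (s n *\<^sub>R h)" by (rule norm_triangle_ineq4)
        also have "\<dots> \<le> R" using that s0[of n] s1[of n] unfolding R_def
          by (intro add_mono) (auto simp: mult_left_le_one_le)
        finally show ?thesis
          using ramp_bounds(3) by (auto simp: abs_mult intro!: mult_right_le_one_le[THEN order_trans] \<phi>b')
      qed
    qed (use \<theta> in \<open>auto simp: ramp_eq_0\<close>)
    have i4: "integrable lborel (ramp \<theta> :: 'v \<Rightarrow> real)"
      by (rule integrable_bounded_support[where R=1 and B=1])
         (use \<theta> in \<open>auto simp: ramp_bounds ramp_eq_0\<close>)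
    have shift: "(\<integral>v. \<phi> v * ramp \<theta> (v + s n *\<^sub>R h) \<partial>lborel) = (\<integral>v. \<phi> (v - s n *\<^sub>R h) * ramp \<theta> v \<partial>lborel)"
      using lborel_integral_translate[of "\<lambda>v. \<phi> (v - s n *\<^sub>R h) * ramp \<theta> v" "s n *\<^sub>R h"] by simp
    have key: "s n * c * ramp \<theta> v \<le> \<phi> v * ramp \<theta> v - \<phi> (v - s n *\<^sub>R h) * ramp \<theta> v" for v
    proof (cases "norm v \<le> 1")
      case True
      let ?a = "x + \<mu> *\<^sub>R v" and ?b = "z + \<mu> *\<^sub>R v"
      have mem: "?a \<in> K" "?b \<in> K"
        using K True \<mu> by (auto simp: subset_iff dist_norm)
      have eq: "x + \<mu> *\<^sub>R (v - s n *\<^sub>R h) = (1 - s n) *\<^sub>R ?a + s n *\<^sub>R ?b"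
      proof -
        have xz: "x = z + \<mu> *\<^sub>R h" using \<mu> by (simp add: h_def)
        show ?thesis by (simp add: xz algebra_simps)
      qed
      have "f ((1 - s n) *\<^sub>R ?a + s n *\<^sub>R ?b) \<le> (1 - s n) * f ?a + s n * f ?b"
        using s0[of n] s1[of n] mem by (intro convex_onD[OF conv]) auto
      then have "s n * (f ?a - f ?b) \<le> \<phi> v - \<phi> (v - s n *\<^sub>R h)"
        unfolding \<phi>_def eq by (simp add: algebra_simps)
      moreover have "c \<le> f ?a - f ?b"
      proof -
        have "\<bar>f ?a - f x\<bar> \<le> L * \<mu>" "\<bar>f ?b - f z\<bar> \<le> L * \<mu>"
          using fl[of ?a x] fl[of ?b z] True \<mu> L
          by (auto intro!: order_trans[OF _ mult_left_mono[of "\<mu> * norm v" \<mu> L]] simp: mult.assoc)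
        then show ?thesis unfolding c_def by (simp add: algebra_simps abs_le_iff)
      qed
      then have "s n * c \<le> s n * (f ?a - f ?b)" using s0[of n] by simp
      ultimately have "s n * c \<le> \<phi> v - \<phi> (v - s n *\<^sub>R h)" by linarith
      from mult_right_mono[OF this ramp_bounds(1)[of \<theta> v]] show ?thesis by (simp add: left_diff_distrib)
    qed (use \<theta> in \<open>simp add: ramp_eq_0\<close>)
    have "s n * c * (\<integral>(v::'v). ramp \<theta> v \<partial>lborel) = (\<integral>(v::'v). s n * c * ramp \<theta> v \<partial>lborel)" by simp
    also have "\<dots> \<le> (\<integral>v. \<phi> v * ramp \<theta> v - \<phi> (v - s n *\<^sub>R h) * ramp \<theta> v \<partial>lborel)"
      by (intro integral_mono Bochner_Integration.integrable_diff i1 i3 integrable_mult_right i4 key)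
    also have "\<dots> = (\<integral>v. \<phi> v * ramp \<theta> v \<partial>lborel) - (\<integral>v. \<phi> v * ramp \<theta> (v + s n *\<^sub>R h) \<partial>lborel)"
      using i1 i3 by (simp add: shift)
    also have "\<dots> = (\<integral>v. \<phi> v * ramp \<theta> v - \<phi> v * ramp \<theta> (v + s n *\<^sub>R h) \<partial>lborel)"
      using i1 i2 by simp
    also have "\<dots> = (\<integral>v. s n * (\<phi> v * ?q n v) \<partial>lborel)"
      using s0[of n] by (intro Bochner_Integration.integral_cong) (auto simp: field_simps)
    finally show ?thesis using s0[of n] by (simp add: pos_le_divide_eq mult_ac)
  qed
  have "(\<lambda>n. \<integral>v. \<phi> v * ?q n v \<partial>lborel) \<longlonglongrightarrow> (\<integral>v. \<phi> v * ?lim v \<partial>lborel)"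
  proof (rule integral_dominated_convergence)
    let ?w = "\<lambda>v::'v. indicator (cball 0 R) v * (L * \<mu> * R * (norm h / \<theta>))"
    show "integrable lborel ?w"
    proof (rule integrable_bounded_support)
      show "\<bar>?w v\<bar> \<le> \<bar>L * \<mu> * R * (norm h / \<theta>)\<bar>" for v :: 'v by (simp add: indicator_def)
      show "R < norm v \<Longrightarrow> ?w v = 0" for v :: 'v by simp
    qed (intro borel_measurable_times borel_measurable_indicator, auto)
    have "AE (v::'v) in lborel. v \<notin> sphere 0 1" "AE (v::'v) in lborel. v \<notin> sphere 0 (1 - \<theta>)"
      by (rule AE_not_sphere)+
    then show "AE v in lborel. (\<lambda>n. \<phi> v * ?q n v) \<longlonglongrightarrow> \<phi> v * ?lim v"
    proof eventually_elim
      case (elim v)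
      then show ?case
        by (intro tendsto_mult tendsto_const ramp_directional_derivative \<theta> slim) (use s0 in \<open>auto simp: less_imp_neq[symmetric]\<close>)
    qed
    show "AE v in lborel. norm (\<phi> v * ?q n v) \<le> ?w v" for n
    proof (rule AE_I2)
      fix v :: 'v
      show "norm (\<phi> v * ?q n v) \<le> ?w v"
      proof (cases "norm v \<le> R")
        case True
        have "\<bar>ramp \<theta> v - ramp \<theta> (v + s n *\<^sub>R h)\<bar> \<le> s n * norm h / \<theta>"
          using ramp_lipschitz[OF \<theta>(1), of v "v + s n *\<^sub>R h"] s0[of n] by simp
        then have "\<bar>?q n v\<bar> \<le> norm h / \<theta>"
          using s0[of n] \<theta>(1) by (simp add: abs_mult divide_simps mult_ac)
        with \<phi>b'[OF True] have "\<bar>\<phi> v\<bar> * \<bar>?q n v\<bar> \<le> L * \<mu> * R * (norm h / \<theta>)"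
          by (intro mult_mono) auto
        then show ?thesis using True by (simp add: abs_mult)
      next
        case False
        then show ?thesis using supp[of v "s n"] supp0[of v] s0[of n] s1[of n] by simp
      qed
    qed
  qed measurable
  from LIMSEQ_le_const[OF this] lower
  have "c * (\<integral>(v::'v). ramp \<theta> v \<partial>lborel) \<le> (\<integral>v. \<phi> v * ?lim v \<partial>lborel)" by blast
  also have "(\<lambda>v. \<phi> v * ?lim v) = (\<lambda>v. if 1 - \<theta> < norm v \<and> norm v < 1
      then (f (x + \<mu> *\<^sub>R v) - f x) * (sgn v \<bullet> h) / \<theta> else 0)"
    by (auto simp: \<phi>_def)
  finally show ?thesis unfolding c_def .
qed

lemma AE_lborel_nonzero: "AE (v::'v::euclidean_space) in lborel. v \<noteq> 0"
  by (rule AE_I'[of "{0}"]) (auto intro: countable_imp_null_set_lborel)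

lemma unit_ball_measure:
  fixes a :: "'v::euclidean_space"
  shows "emeasure lborel (ball a 1) = ennreal (measure lborel (ball a 1))" "0 < measure lborel (ball a 1)"
  using emeasure_lborel_ball_finite[of a 1]
  by (auto intro!: emeasure_eq_ennreal_measure simp: content_ball_pos)

lemma uniform_sphere_integral:
  fixes \<psi> :: "'v::euclidean_space \<Rightarrow> real"
  assumes [measurable]: "\<psi> \<in> borel_measurable borel"
  shows "(\<integral>u. \<psi> u \<partial>uniform_sphere)
       = (\<integral>v. indicator (ball 0 1) v * \<psi> (sgn v) \<partial>lborel) / measure lborel (ball (0::'v) 1)"
proof -
  let ?vol = "measure lborel (ball (0::'v) 1)"
  have m: "(\<lambda>v. indicator (sphere (0::'v) 1) (sgn v) * \<psi> (sgn v)) \<in> borel_measurable borel"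
      "(\<lambda>v. indicator (ball (0::'v) 1) v / ?vol) \<in> borel_measurable borel"
      "(\<lambda>v. indicator (ball (0::'v) 1) v * \<psi> (sgn v)) \<in> borel_measurable borel"
    by (intro borel_measurable_times borel_measurable_divide borel_measurable_indicator borel_measurable_const
        measurable_compose[OF sgn_borel] assms, auto intro!: borel_measurable_indicator)+
  note emb = unit_ball_measure(1)[of "0::'v"] and volpos = unit_ball_measure(2)[of "0::'v"]
  have unif: "uniform_measure lborel (ball (0::'v) 1)
      = density lborel (\<lambda>v. ennreal (indicator (ball 0 1) v / ?vol))"
    unfolding uniform_measure_def emb using volpos
    by (intro arg_cong[where f="density lborel"] ext) (auto simp: indicator_def divide_ennreal[symmetric] ennreal_1)
  have "(\<integral>u. \<psi> u \<partial>uniform_sphere)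
      = (\<integral>u. indicator (sphere 0 1) u *\<^sub>R \<psi> u \<partial>distr (uniform_measure lborel (ball 0 1)) borel sgn)"
    unfolding uniform_sphere_def by (rule integral_restrict_space) simp
  also have "\<dots> = (\<integral>v. indicator (sphere 0 1) (sgn v) *\<^sub>R \<psi> (sgn v) \<partial>uniform_measure lborel (ball (0::'v) 1))"
    by (rule integral_distr)
       (auto simp: sgn_borel intro!: borel_measurable_scaleR borel_measurable_times borel_measurable_indicator)
  also have "\<dots> = (\<integral>v. indicator (ball 0 1) v / ?vol * (indicator (sphere 0 1) (sgn v) * \<psi> (sgn v)) \<partial>lborel)"
    unfolding unif by (subst integral_density) (auto intro!: m)
  also have "\<dots> = (\<integral>v. indicator (ball 0 1) v * \<psi> (sgn v) / ?vol \<partial>lborel)"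
  proof (rule integral_cong_AE)
    show "AE v in lborel. indicator (ball 0 1) v / ?vol * (indicator (sphere 0 1) (sgn v) * \<psi> (sgn v))
        = indicator (ball 0 1) v * \<psi> (sgn v) / ?vol"
      using AE_lborel_nonzero by eventually_elim (simp add: norm_sgn)
  qed (use m in \<open>auto simp del: times_divide_eq_left times_divide_eq_right\<close>)
  finally show ?thesis by simp
qed

lemma prob_space_uniform_sphere: "prob_space (uniform_sphere :: 'v::euclidean_space measure)"
proof -
  let ?D = "distr (uniform_measure lborel (ball (0::'v) 1)) borel sgn"
  have p: "prob_space ?D"
    by (intro prob_space.prob_space_distr prob_space_uniform_measure)
       (use unit_ball_measure[of "0::'v"] in \<open>auto simp: sgn_borel\<close>)
  have "AE v in uniform_measure lborel (ball (0::'v) 1). sgn v \<in> sphere 0 1"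
    using AE_lborel_nonzero by (intro AE_uniform_measureI) (auto elim!: eventually_mono simp: norm_sgn)
  then have "AE u in ?D. u \<in> sphere 0 1"
    by (subst AE_distr_iff) (auto simp: sgn_borel)
  then have "emeasure ?D (sphere 0 1) = 1"
    using prob_space.emeasure_eq_1_AE[OF p, of "sphere 0 1"] by simp
  then show ?thesis
    unfolding uniform_sphere_def
    by (intro prob_spaceI) (simp add: space_restrict_space emeasure_restrict_space)
qed

lemma power_ramp_limit:
  "((\<lambda>\<theta>::real. (1 - (1 - \<theta>) ^ m) / \<theta>) \<longlongrightarrow> real m) (at_right 0)"
proof -
  have "((\<lambda>\<theta>::real. - ((1 - \<theta>) ^ m)) has_field_derivative real m) (at 0)"
    by (auto intro!: derivative_eq_intros)
  then have "((\<lambda>\<theta>::real. (1 - (1 - \<theta>) ^ m) / \<theta>) \<longlongrightarrow> real m) (at 0)"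
    by (simp add: DERIV_def)
  then show ?thesis by (rule filterlim_mono[OF _ order_refl at_le]) simp
qed

text \<open>
  The limit \<open>\<theta> \<rightarrow> 0\<close> of the shell inequality. On a shell of width \<open>\<theta>\<close> the value of
  \<open>f\<close> may be replaced by the one at the radial projection, with an error of order \<open>\<theta>\<close>; and the
  volume of the shell divided by \<open>\<theta>\<close> tends to the dimension times the volume of the ball, which produces the
  factor \<open>DIM('v)\<close> of the estimator.
\<close>

lemma sphere_gradient:
  fixes f :: "'v::euclidean_space \<Rightarrow> real"
  assumes lip: "L-lipschitz_on UNIV f" and conv: "convex_on K f"
    and K: "cball x \<mu> \<subseteq> K" "cball z \<mu> \<subseteq> K" and \<mu>: "0 < \<mu>"
  shows "f x - f z - 2 * \<mu> * L
    \<le> (\<integral>u. real DIM('v) / \<mu> * (f (x + \<mu> *\<^sub>R u) - f x) * (u \<bullet> (x - z)) \<partial>uniform_sphere)"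
proof -
  define h where "h = (x - z) /\<^sub>R \<mu>"
  define \<psi> where "\<psi> u = (f (x + \<mu> *\<^sub>R u) - f x) * (u \<bullet> h)" for u
  define J where "J = (\<integral>v. indicator (ball 0 1) v * \<psi> (sgn v) \<partial>lborel)"
  define vol where "vol = measure lborel (ball (0::'v) 1)"
  define c where "c = f x - f z - 2 * \<mu> * L"
  have volpos: "0 < vol" unfolding vol_def by (simp add: content_ball_pos)
  have vol_eq: "vol = (\<integral>(v::'v). indicator (ball 0 1) v * 1 \<partial>lborel)" by (simp add: vol_def)
  have L: "0 \<le> L" using lip by (rule lipschitz_on_nonneg)
  have fl: "\<bar>f a - f b\<bar> \<le> L * norm (a - b)" for a b
    using lipschitz_onD[OF lip, of a b] by (simp add: dist_norm)
  have fm [measurable]: "f \<in> borel_measurable borel"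
    by (intro borel_measurable_continuous_onI lipschitz_on_continuous_on[OF lip])
  have \<psi>m [measurable]: "\<psi> \<in> borel_measurable borel"
    unfolding \<psi>_def[abs_def] by measurable
  have \<psi>sm [measurable]: "(\<lambda>v. \<psi> (sgn v)) \<in> borel_measurable borel"
    by (rule measurable_compose[OF sgn_borel \<psi>m])
  have \<psi>b: "\<bar>\<psi> (sgn v)\<bar> \<le> L * \<mu> * norm h" for v
  proof -
    have n1: "norm (sgn v) \<le> 1" by (simp add: norm_sgn)
    have "\<bar>f (x + \<mu> *\<^sub>R sgn v) - f x\<bar> \<le> L * (\<mu> * norm (sgn v))"
      using fl[of "x + \<mu> *\<^sub>R sgn v" x] \<mu> by simp
    also have "\<dots> \<le> L * \<mu>" using n1 L \<mu> by (simp add: mult_left_le mult_left_mono)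
    finally have a: "\<bar>f (x + \<mu> *\<^sub>R sgn v) - f x\<bar> \<le> L * \<mu>" .
    have "\<bar>sgn v \<bullet> h\<bar> \<le> norm (sgn v) * norm h" by (rule Cauchy_Schwarz_ineq2)
    also have "\<dots> \<le> norm h" using n1 by (simp add: mult_left_le_one_le)
    finally show ?thesis using a L \<mu> unfolding \<psi>_def abs_mult by (intro mult_mono) auto
  qed
  have intball: "integrable lborel (\<lambda>v. indicator (ball 0 t) v * \<psi> (sgn v))" for t
    by (rule integrable_bounded_support[where R="\<bar>t\<bar>" and B="L * \<mu> * norm h"])
       (use \<psi>b L \<mu> in \<open>auto simp: indicator_def\<close>)
  have intb: "integrable lborel (\<lambda>v::'v. indicator (ball 0 t) v * 1 :: real)" for t
    by (rule integrable_bounded_support[where R="\<bar>t\<bar>" and B=1]) (auto simp: indicator_def)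
  define \<rho> where "\<rho> \<theta> = 1 - (1 - \<theta>) ^ DIM('v)" for \<theta> :: real
  \<comment> \<open>\<open>\<rho> \<theta>\<close> is the fraction of the ball taken up by the shell.\<close>
  have bound: "c * (\<integral>(v::'v). ramp \<theta> v \<partial>lborel) \<le> \<rho> \<theta> / \<theta> * J + L * \<mu> * norm h * (\<rho> \<theta> * vol)"
    if \<theta>: "0 < \<theta>" "\<theta> < 1" for \<theta>
  proof -
    let ?g = "\<lambda>v. if 1 - \<theta> < norm v \<and> norm v < 1 then (f (x + \<mu> *\<^sub>R v) - f x) * (sgn v \<bullet> h) / \<theta> else 0"
    let ?sh = "\<lambda>v::'v. indicator (ball 0 1) v - indicator (ball 0 (1 - \<theta>)) v :: real"
    have shell: "AE (v::'v) in lborel. (1 - \<theta> < norm v \<and> norm v < 1) = (?sh v = 1) \<and> (?sh v = 0 \<or> ?sh v = 1)"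
    proof -
      have "AE (v::'v) in lborel. v \<notin> sphere 0 (1 - \<theta>)"
        by (rule AE_not_sphere)
      then show ?thesis by (rule eventually_mono) (use \<theta> in \<open>auto simp: indicator_def\<close>)
    qed
    have est: "?g v \<le> ?sh v * \<psi> (sgn v) / \<theta> + L * \<mu> * norm h * ?sh v"
      if "(1 - \<theta> < norm v \<and> norm v < 1) = (?sh v = 1)" "?sh v = 0 \<or> ?sh v = 1" for v
    proof (cases "1 - \<theta> < norm v \<and> norm v < 1")
      case True
      then have sh: "?sh v = 1" using that by simp
      have "v \<noteq> 0" using True \<theta> by auto
      have "x + \<mu> *\<^sub>R v - (x + \<mu> *\<^sub>R sgn v) = \<mu> *\<^sub>R ((norm v - 1) *\<^sub>R sgn v)"
        using \<open>v \<noteq> 0\<close> by (simp add: sgn_div_norm algebra_simps)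
      then have "norm (x + \<mu> *\<^sub>R v - (x + \<mu> *\<^sub>R sgn v)) = \<mu> * (1 - norm v)"
        using \<mu> True \<open>v \<noteq> 0\<close> by (simp add: norm_sgn abs_mult)
      also have "\<dots> \<le> \<mu> * \<theta>" using True \<mu> by (intro mult_left_mono) auto
      finally have "L * norm (x + \<mu> *\<^sub>R v - (x + \<mu> *\<^sub>R sgn v)) \<le> L * (\<mu> * \<theta>)"
        using L by (rule mult_left_mono)
      with fl[of "x + \<mu> *\<^sub>R v" "x + \<mu> *\<^sub>R sgn v"]
      have a: "\<bar>f (x + \<mu> *\<^sub>R v) - f (x + \<mu> *\<^sub>R sgn v)\<bar> \<le> L * \<mu> * \<theta>" by simp
      have b: "\<bar>sgn v \<bullet> h\<bar> \<le> norm h"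
        using Cauchy_Schwarz_ineq2[of "sgn v" h] \<open>v \<noteq> 0\<close> by (simp add: norm_sgn)
      have "(f (x + \<mu> *\<^sub>R v) - f (x + \<mu> *\<^sub>R sgn v)) * (sgn v \<bullet> h) \<le> L * \<mu> * \<theta> * norm h"
        using mult_mono[OF a b] \<theta> L \<mu> by (auto simp: abs_mult[symmetric] dest: abs_le_D1)
      then have "(f (x + \<mu> *\<^sub>R v) - f x) * (sgn v \<bullet> h) \<le> \<psi> (sgn v) + \<theta> * (L * \<mu> * norm h)"
        unfolding \<psi>_def by (simp add: algebra_simps)
      from divide_right_mono[OF this, of \<theta>] True sh \<theta> show ?thesis
        by (simp add: add_divide_distrib)
    qed (use that in auto)
    have m1: "integrable lborel (\<lambda>v. ?sh v * \<psi> (sgn v))"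
      using Bochner_Integration.integrable_diff[OF intball[of 1] intball[of "1 - \<theta>"]]
      by (simp add: left_diff_distrib)
    have m2: "integrable lborel ?sh"
      using Bochner_Integration.integrable_diff[OF intb[of 1] intb[of "1 - \<theta>"]] by simp
    have m3: "integrable lborel ?g"
    proof (rule integrable_bounded_support[where R=1 and B="L * \<mu> * norm h / \<theta>"])
      show "\<bar>?g v\<bar> \<le> L * \<mu> * norm h / \<theta>" for v
      proof (cases "1 - \<theta> < norm v \<and> norm v < 1")
        case True
        have "\<bar>f (x + \<mu> *\<^sub>R v) - f x\<bar> \<le> L * (\<mu> * norm v)" using fl[of "x + \<mu> *\<^sub>R v" x] \<mu> by simp
        also have "\<dots> \<le> L * \<mu>" using True L \<mu> by (simp add: mult_left_le mult_left_mono)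
        finally have a: "\<bar>f (x + \<mu> *\<^sub>R v) - f x\<bar> \<le> L * \<mu>" .
        have "\<bar>sgn v \<bullet> h\<bar> \<le> norm h"
          using Cauchy_Schwarz_ineq2[of "sgn v" h] mult_left_le_one_le[of "norm h" "norm (sgn v)"]
          by (simp add: norm_sgn split: if_splits)
        with a have "\<bar>f (x + \<mu> *\<^sub>R v) - f x\<bar> * \<bar>sgn v \<bullet> h\<bar> \<le> L * \<mu> * norm h"
          using L \<mu> by (intro mult_mono) auto
        then show ?thesis using True \<theta> by (simp add: abs_mult divide_right_mono)
      qed (use L \<mu> \<theta> in auto)
    next
      have [measurable]: "(\<lambda>v. sgn v \<bullet> h) \<in> borel_measurable borel"
        by (intro borel_measurable_inner sgn_borel) simp
      show "?g \<in> borel_measurable borel" by measurable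
    qed auto
    have "c * (\<integral>(v::'v). ramp \<theta> v \<partial>lborel) \<le> (\<integral>v. ?g v \<partial>lborel)"
      using convex_shell_inequality[OF lip conv K \<mu> \<theta>] unfolding h_def c_def .
    also have "\<dots> \<le> (\<integral>v. ?sh v * \<psi> (sgn v) / \<theta> + L * \<mu> * norm h * ?sh v \<partial>lborel)"
    proof (rule integral_mono_AE)
      show "integrable lborel (\<lambda>v. ?sh v * \<psi> (sgn v) / \<theta> + L * \<mu> * norm h * ?sh v)"
        by (intro Bochner_Integration.integrable_add integrable_divide integrable_mult_right m1 m2)
      show "AE v in lborel. ?g v \<le> ?sh v * \<psi> (sgn v) / \<theta> + L * \<mu> * norm h * ?sh v"
        using shell by eventually_elim (rule est, auto)
    qed (rule m3)
    also have "\<dots> = (\<integral>v. ?sh v * \<psi> (sgn v) \<partial>lborel) / \<theta> + L * \<mu> * norm h * (\<integral>v. ?sh v \<partial>lborel)"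
      using m1 m2 by (subst Bochner_Integration.integral_add) (auto intro: integrable_divide integrable_mult_right)
    also have "(\<integral>v. ?sh v * \<psi> (sgn v) \<partial>lborel) = \<rho> \<theta> * J"
    proof -
      have "(\<integral>v. ?sh v * \<psi> (sgn v) \<partial>lborel) = (\<integral>v. indicator (ball 0 1) v * \<psi> (sgn v) \<partial>lborel)
          - (\<integral>v. indicator (ball 0 (1 - \<theta>)) v * \<psi> (sgn v) \<partial>lborel)"
        unfolding left_diff_distrib by (rule Bochner_Integration.integral_diff[OF intball intball])
      then show ?thesis
        using integral_ball_radial[OF \<psi>m, of "1 - \<theta>"] \<theta> by (simp add: J_def \<rho>_def left_diff_distrib)
    qed
    also have "(\<integral>v. ?sh v \<partial>lborel) = \<rho> \<theta> * vol"
    proof -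
      have "(\<integral>v. ?sh v \<partial>lborel) = (\<integral>(v::'v). indicator (ball 0 1) v * 1 \<partial>lborel)
          - (\<integral>(v::'v). indicator (ball 0 (1 - \<theta>)) v * 1 \<partial>lborel)"
        using Bochner_Integration.integral_diff[OF intb[of 1] intb[of "1 - \<theta>"]] by simp
      then show ?thesis
        using integral_ball_radial[of "\<lambda>_::'v. 1" "1 - \<theta>"] \<theta>
        by (simp add: vol_def \<rho>_def left_diff_distrib)
    qed
    finally show ?thesis by simp
  qed
  have ev: "\<forall>\<^sub>F \<theta>::real in at_right 0. 0 < \<theta> \<and> \<theta> < 1"
    by (intro eventually_conj eventually_at_right_less eventually_at_rightI[where b=1]) auto
  have \<rho>0: "(\<rho> \<longlongrightarrow> 0) (at_right 0)"
  proof -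
    have "((\<lambda>\<theta>. 1 - (1 - \<theta>) ^ DIM('v)) \<longlongrightarrow> 1 - (1 - 0) ^ DIM('v)) (at_right (0::real))"
      by (intro tendsto_intros)
    then show ?thesis by (simp add: \<rho>_def[abs_def])
  qed
  have "((\<lambda>\<theta>. \<integral>(v::'v). ramp \<theta> v \<partial>lborel) \<longlongrightarrow> vol) (at_right 0)"
  proof (rule tendsto_sandwich)
    show "\<forall>\<^sub>F \<theta> in at_right 0. (1 - \<rho> \<theta>) * vol \<le> (\<integral>(v::'v). ramp \<theta> v \<partial>lborel)"
      using ev by eventually_elim (use ramp_integral_bounds(1) in \<open>auto simp: \<rho>_def vol_eq\<close>)
    show "\<forall>\<^sub>F \<theta> in at_right 0. (\<integral>(v::'v). ramp \<theta> v \<partial>lborel) \<le> vol"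
      using ev by eventually_elim (use ramp_integral_bounds(2) in \<open>auto simp: vol_eq\<close>)
    show "((\<lambda>\<theta>. (1 - \<rho> \<theta>) * vol) \<longlongrightarrow> vol) (at_right 0)"
      using tendsto_mult[OF tendsto_diff[OF tendsto_const \<rho>0] tendsto_const, of 1 vol] by simp
  qed simp
  then have l: "((\<lambda>\<theta>. c * (\<integral>(v::'v). ramp \<theta> v \<partial>lborel)) \<longlongrightarrow> c * vol) (at_right 0)"
    by (intro tendsto_intros)
  have r: "((\<lambda>\<theta>. \<rho> \<theta> / \<theta> * J + L * \<mu> * norm h * (\<rho> \<theta> * vol)) \<longlongrightarrow> real DIM('v) * J + L * \<mu> * norm h * (0 * vol)) (at_right 0)"
    using power_ramp_limit[of "DIM('v)"] unfolding \<rho>_def[abs_def, symmetric]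
    by (intro tendsto_intros \<rho>0) (simp add: \<rho>_def)
  have "c * vol \<le> real DIM('v) * J + L * \<mu> * norm h * (0 * vol)"
    by (rule tendsto_le[OF _ r l]) (use ev bound in \<open>auto elim: eventually_mono\<close>)
  then have "c \<le> real DIM('v) * (J / vol)"
    using volpos by (simp add: pos_le_divide_eq)
  also have "J / vol = (\<integral>u. \<psi> u \<partial>uniform_sphere)"
    unfolding J_def vol_def by (rule uniform_sphere_integral[symmetric]) simp
  also have "real DIM('v) * \<dots> = (\<integral>u. real DIM('v) * \<psi> u \<partial>uniform_sphere)" by simp
  also have "(\<lambda>u. real DIM('v) * \<psi> u) = (\<lambda>u. real DIM('v) / \<mu> * (f (x + \<mu> *\<^sub>R u) - f x) * (u \<bullet> (x - z)))"
    by (auto simp: \<psi>_def h_def fun_eq_iff divide_inverse)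
  finally show ?thesis unfolding c_def .
qed

section \<open>Measurable Lipschitz extension\<close>

text \<open>
  The McShane extension, with the infimum restricted to a subset \<open>D\<close>. A countable dense \<open>D\<close> gives the
  same values on the domain and makes the extension jointly measurable when the function depends on a parameter.
\<close>

definition mcshane :: "real \<Rightarrow> 'v::euclidean_space set \<Rightarrow> ('v \<Rightarrow> real) \<Rightarrow> 'v \<Rightarrow> real" where
  "mcshane L D g x = (INF q\<in>D. g q + L * norm (x - q))"

context
  fixes L :: real and D U :: "'v::euclidean_space set" and g :: "'v \<Rightarrow> real"
  assumes lip: "L-lipschitz_on U g" and D: "D \<subseteq> U" "D \<noteq> {}"
begin

lemma mcshane_bdd: "bdd_below ((\<lambda>q. g q + L * norm (x - q)) ` D)"
proof -
  obtain p where p: "p \<in> D" using D by auto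
  have "g p - L * norm (x - p) \<le> g q + L * norm (x - q)" if "q \<in> D" for q
  proof -
    have "\<bar>g p - g q\<bar> \<le> L * norm (p - q)"
      using lipschitz_onD[OF lip, of p q] p that D by (auto simp: dist_norm)
    also have "\<dots> \<le> L * (norm (x - p) + norm (x - q))"
      using norm_triangle_ineq4[of "x - q" "x - p"] lipschitz_on_nonneg[OF lip]
      by (intro mult_left_mono) auto
    finally show ?thesis by (simp add: algebra_simps abs_le_iff)
  qed
  then show ?thesis by (intro bdd_belowI2)
qed

lemma mcshane_lipschitz: "L-lipschitz_on UNIV (mcshane L D g)"
proof (rule lipschitz_onI)
  have L: "0 \<le> L" using lip by (rule lipschitz_on_nonneg)
  then show "0 \<le> L" .
  have "mcshane L D g x - L * norm (x - y) \<le> mcshane L D g y" for x y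
    unfolding mcshane_def[of L D g y]
  proof (rule cINF_greatest[OF D(2)])
    fix q assume "q \<in> D"
    then have "mcshane L D g x \<le> g q + L * norm (x - q)"
      unfolding mcshane_def by (intro cINF_lower mcshane_bdd)
    moreover have "L * norm (x - q) \<le> L * (norm (x - y) + norm (y - q))"
      using norm_triangle_ineq[of "x - y" "y - q"] L by (intro mult_left_mono) auto
    ultimately show "mcshane L D g x - L * norm (x - y) \<le> g q + L * norm (y - q)"
      by (simp add: algebra_simps)
  qed
  from this[of x y for x y] this[of y x for x y]
  show "dist (mcshane L D g x) (mcshane L D g y) \<le> L * dist x y" for x y
    by (smt (verit) dist_norm norm_minus_commute real_norm_def)
qed

lemma mcshane_eq:
  assumes dense: "U \<subseteq> closure D" and x: "x \<in> U"
  shows "mcshane L D g x = g x"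
proof (rule antisym)
  have L: "0 \<le> L" using lip by (rule lipschitz_on_nonneg)
  show "g x \<le> mcshane L D g x"
    unfolding mcshane_def
  proof (rule cINF_greatest[OF D(2)])
    fix q assume "q \<in> D"
    then show "g x \<le> g q + L * norm (x - q)"
      using lipschitz_onD[OF lip, of x q] x D by (auto simp: dist_norm)
  qed
  show "mcshane L D g x \<le> g x"
  proof (rule field_le_epsilon)
    fix e :: real assume e: "0 < e"
    have "x \<in> closure D" using dense x by auto
    then obtain q where q: "q \<in> D" "dist q x < e / (2 * L + 1)"
      using e L closure_approachable by (metis add_nonneg_pos divide_pos_pos mult_nonneg_nonneg zero_le_numeral zero_less_one)
    have "mcshane L D g x \<le> g q + L * norm (x - q)"
      unfolding mcshane_def by (intro cINF_lower mcshane_bdd q)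
    also have "g q \<le> g x + L * norm (x - q)"
      using lipschitz_onD[OF lip, of q x] x q D by (auto simp: dist_norm norm_minus_commute)
    also have "g x + L * norm (x - q) + L * norm (x - q) \<le> g x + (2 * L + 1) * norm (x - q)" by (simp add: algebra_simps)
    also have "(2 * L + 1) * norm (x - q) \<le> e"
      using q(2) L by (simp add: dist_norm norm_minus_commute field_simps)
    finally show "mcshane L D g x \<le> g x + e" by simp
  qed
qed

end

text \<open>
  A countable infimum of functions that are each jointly measurable, because the point \<open>q\<close> at which
  \<open>F\<close> is evaluated is fixed.
\<close>

lemma mcshane_measurable:
  fixes F :: "'v::euclidean_space \<Rightarrow> 's \<Rightarrow> real"
  assumes D: "countable D" "D \<subseteq> U" "D \<noteq> {}"
    and lip: "\<And>s. s \<in> space P \<Longrightarrow> L-lipschitz_on U (\<lambda>x. F x s)"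
    and F: "\<And>q. q \<in> U \<Longrightarrow> F q \<in> borel_measurable P"
  shows "(\<lambda>(x, s). mcshane L D (\<lambda>q. F q s) x) \<in> borel_measurable (borel \<Otimes>\<^sub>M P)"
proof -
  have "(\<lambda>p. INF q\<in>D. F q (snd p) + L * norm (fst p - q)) \<in> borel_measurable (borel \<Otimes>\<^sub>M P)"
  proof (rule borel_measurable_cINF[OF D(1)])
    fix q assume "q \<in> D"
    then have [measurable]: "F q \<in> borel_measurable P" using F D by auto
    show "(\<lambda>p. F q (snd p) + L * norm (fst p - q)) \<in> borel_measurable (borel \<Otimes>\<^sub>M P)"
      by measurable
  next
    fix p assume "p \<in> space (borel \<Otimes>\<^sub>M P :: ('v \<times> 's) measure)"
    then have "snd p \<in> space P" by (auto simp: space_pair_measure)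
    from mcshane_bdd[OF lip[OF this] D(2,3)]
    show "bdd_below ((\<lambda>q. F q (snd p) + L * norm (fst p - q)) ` D)" by simp
  qed
  then show ?thesis by (simp add: mcshane_def case_prod_beta')
qed

lemma lipschitz_extension_exists:
  fixes F :: "'n \<Rightarrow> 'v::euclidean_space \<Rightarrow> 's \<Rightarrow> real"
  assumes A3: "lipschitz_convex_assumption \<Omega> U P F L" and U: "U \<noteq> {}"
  obtains F' where
    "\<And>i. (\<lambda>(x, s). F' i x s) \<in> borel_measurable (borel \<Otimes>\<^sub>M P i)"
    "\<And>i s. s \<in> space (P i) \<Longrightarrow> L-lipschitz_on UNIV (\<lambda>x. F' i x s)"
    "\<And>i x. integrable (P i) (F' i x)"
    "\<And>i x s. x \<in> U \<Longrightarrow> s \<in> space (P i) \<Longrightarrow> F' i x s = F i x s"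
    "\<And>i x. x \<in> U \<Longrightarrow> local_objective P F' i x = local_objective P F i x"
    "\<And>i. convex_on U (local_objective P F' i)"
proof -
  have Uc: "convex U" and Pp: "\<And>i. prob_space (P i)" and Fi: "\<And>i x. x \<in> U \<Longrightarrow> integrable (P i) (F i x)"
    and conv: "\<And>i s. s \<in> space (P i) \<Longrightarrow> convex_on U (\<lambda>x. F i x s)"
    and lip: "\<And>i s. s \<in> space (P i) \<Longrightarrow> L-lipschitz_on U (\<lambda>x. F i x s)"
    using A3 unfolding lipschitz_convex_assumption_def by blast+
  obtain D where D: "countable D" "D \<subseteq> U" "U \<subseteq> closure D" by (rule separable)
  then have D0: "D \<noteq> {}" using U by auto
  define F' where "F' i x s = mcshane L D (\<lambda>q. F i q s) x" for i x s
  have meas: "(\<lambda>(x, s). F' i x s) \<in> borel_measurable (borel \<Otimes>\<^sub>M P i)" for i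
    unfolding F'_def by (rule mcshane_measurable[OF D(1,2) D0 lip]) (use Fi in \<open>auto dest: borel_measurable_integrable\<close>)
  have lip': "L-lipschitz_on UNIV (\<lambda>x. F' i x s)" if "s \<in> space (P i)" for i s
    unfolding F'_def by (rule mcshane_lipschitz[OF lip[OF that] D(2) D0])
  have agree: "F' i x s = F i x s" if "x \<in> U" "s \<in> space (P i)" for i x s
    unfolding F'_def by (rule mcshane_eq[OF lip[OF that(2)] D(2) D0 D(3) that(1)])
  obtain p where p: "p \<in> U" using U by auto
  have int: "integrable (P i) (F' i x)" for i x
  proof (rule Bochner_Integration.integrable_bound)
    interpret Pi: prob_space "P i" by (rule Pp)
    show "integrable (P i) (\<lambda>s. \<bar>F i p s\<bar> + L * dist x p)"
      by (intro Bochner_Integration.integrable_add integrable_abs Fi p) simp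
    show "F' i x \<in> borel_measurable (P i)"
      using measurable_compose[OF measurable_Pair1' meas[of i], of x] by simp
    show "AE s in P i. norm (F' i x s) \<le> norm (\<bar>F i p s\<bar> + L * dist x p)"
    proof (rule AE_I2)
      fix s assume s: "s \<in> space (P i)"
      have "\<bar>F' i x s - F i p s\<bar> \<le> L * dist x p"
        using lipschitz_onD[OF lip'[OF s], of x p] agree[OF p s] by (simp add: dist_real_def)
      then show "norm (F' i x s) \<le> norm (\<bar>F i p s\<bar> + L * dist x p)"
        unfolding real_norm_def by linarith
    qed
  qed
  have loc: "local_objective P F' i x = local_objective P F i x" if "x \<in> U" for i x
    unfolding local_objective_def by (rule Bochner_Integration.integral_cong) (simp_all add: agree that)
  have "convex_on U (local_objective P F' i)" for i
  proof (rule convex_onI[OF _ Uc])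
    fix t :: real and x y assume t: "0 < t" "t < 1" and xy: "x \<in> U" "y \<in> U"
    let ?p = "(1 - t) *\<^sub>R x + t *\<^sub>R y"
    have pU: "?p \<in> U" using t xy Uc by (intro convexD) simp_all
    have "local_objective P F i ?p \<le> (\<integral>s. (1 - t) * F i x s + t * F i y s \<partial>P i)"
      unfolding local_objective_def using t xy convex_onD[OF conv]
      by (intro integral_mono Fi pU Bochner_Integration.integrable_add integrable_mult_right) simp_all
    also have "\<dots> = (1 - t) * local_objective P F i x + t * local_objective P F i y"
      using Fi[OF xy(1)] Fi[OF xy(2)] by (simp add: local_objective_def)
    finally show "local_objective P F' i ?p \<le> (1 - t) * local_objective P F' i x + t * local_objective P F' i y"
      by (simp only: loc pU xy)
  qed
  then show ?thesis using that meas lip' int agree loc by blast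
qed

section \<open>Root mean square bounds and independence\<close>

lemma borel_measurable_vec_lambda [measurable (raw)]:
  fixes f :: "'n::finite \<Rightarrow> 'a \<Rightarrow> 'v::euclidean_space"
  assumes "\<And>i. f i \<in> borel_measurable M"
  shows "(\<lambda>x. \<chi> i. f i x) \<in> borel_measurable M"
proof (subst borel_measurable_euclidean_space, safe)
  fix b :: "'v^'n" assume "b \<in> Basis"
  then obtain i v where "b = axis i v" "v \<in> Basis" by (auto simp: Basis_vec_def)
  then show "(\<lambda>x. (\<chi> i. f i x) \<bullet> b) \<in> borel_measurable M"
    using assms by (simp add: inner_axis)
qed

lemma borel_measurable_vec_nth' [measurable (raw)]:
  fixes f :: "'a \<Rightarrow> 'v::euclidean_space^'n::finite"
  assumes "f \<in> borel_measurable M"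
  shows "(\<lambda>x. f x $ i) \<in> borel_measurable M"
  by (rule borel_measurable_continuous_on[OF _ assms]) (intro continuous_intros)

lemma pair_prob_spaceI: "prob_space A \<Longrightarrow> prob_space B \<Longrightarrow> pair_prob_space A B"
  by (simp add: pair_prob_space_def pair_sigma_finite_def prob_space_imp_sigma_finite)

context prob_space
begin

definition rms_le :: "('a \<Rightarrow> real) \<Rightarrow> real \<Rightarrow> bool" where
  "rms_le f a \<longleftrightarrow> integrable M (\<lambda>w. (f w)\<^sup>2) \<and> (\<integral>w. (f w)\<^sup>2 \<partial>M) \<le> a\<^sup>2"

text \<open>
  Minkowski's inequality with the root mean squares replaced by positive bounds. The coefficients of the pointwise bound
  \<open>(p + q)\<^sup>2 \<le> (a + b) (p\<^sup>2 / a + q\<^sup>2 / b)\<close> are those for which taking expectations gives exactly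
  \<open>(a + b)\<^sup>2\<close>.
\<close>

lemma rms_le_add:
  assumes f: "rms_le f a" and g: "rms_le g b" and ab: "0 < a" "0 < b"
    and t: "t \<in> borel_measurable M" "\<And>w. w \<in> space M \<Longrightarrow> 0 \<le> t w"
      "\<And>w. w \<in> space M \<Longrightarrow> t w \<le> f w + g w"
  shows "rms_le t (a + b)"
proof -
  have sq: "(p + q)\<^sup>2 \<le> (a + b) / a * p\<^sup>2 + (a + b) / b * q\<^sup>2" for p q :: real
  proof -
    have "(a + b) / a * p\<^sup>2 + (a + b) / b * q\<^sup>2 - (p + q)\<^sup>2 = (b * p - a * q)\<^sup>2 / (a * b)"
      using ab by (simp add: field_simps power2_eq_square)
    also have "\<dots> \<ge> 0" using ab by simp
    finally show ?thesis by simp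
  qed
  let ?r = "\<lambda>w. (a + b) / a * (f w)\<^sup>2 + (a + b) / b * (g w)\<^sup>2"
  have ri: "integrable M ?r" using f g unfolding rms_le_def by auto
  have le: "(t w)\<^sup>2 \<le> ?r w" if "w \<in> space M" for w
    by (rule order_trans[OF power_mono sq]) (use t(2,3)[OF that] in auto)
  have ti: "integrable M (\<lambda>w. (t w)\<^sup>2)"
  proof (rule Bochner_Integration.integrable_bound[OF ri])
    show "AE w in M. norm ((t w)\<^sup>2) \<le> norm (?r w)"
    proof (rule AE_I2)
      fix w assume "w \<in> space M"
      have "norm ((t w)\<^sup>2) = (t w)\<^sup>2" by simp
      also have "\<dots> \<le> ?r w" by (rule le) fact
      also have "\<dots> \<le> norm (?r w)" unfolding real_norm_def by (rule abs_ge_self)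
      finally show "norm ((t w)\<^sup>2) \<le> norm (?r w)" .
    qed
  qed (use t(1) in simp)
  have "(\<integral>w. (t w)\<^sup>2 \<partial>M) \<le> (\<integral>w. ?r w \<partial>M)" by (intro integral_mono ti ri le)
  also have "\<dots> = (a + b) / a * (\<integral>w. (f w)\<^sup>2 \<partial>M) + (a + b) / b * (\<integral>w. (g w)\<^sup>2 \<partial>M)"
    using f g unfolding rms_le_def by simp
  also have "\<dots> \<le> (a + b) / a * a\<^sup>2 + (a + b) / b * b\<^sup>2"
    using f g ab unfolding rms_le_def by (intro add_mono mult_left_mono) auto
  also have "\<dots> = (a + b)\<^sup>2" using ab by (simp add: power2_eq_square field_simps)
  finally show ?thesis using ti by (simp add: rms_le_def)
qed

lemma rms_le_const:
  assumes "f \<in> borel_measurable M" "\<And>w. w \<in> space M \<Longrightarrow> \<bar>f w\<bar> \<le> a"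
  shows "rms_le f a"
proof -
  have le: "(f w)\<^sup>2 \<le> a\<^sup>2" if "w \<in> space M" for w
    using assms(2)[OF that] by (metis abs_ge_zero power2_abs power_mono)
  have i: "integrable M (\<lambda>w. (f w)\<^sup>2)"
    by (rule integrable_const_bound[where B="a\<^sup>2"]) (use assms(1) le in auto)
  have "(\<integral>w. (f w)\<^sup>2 \<partial>M) \<le> (\<integral>w. a\<^sup>2 \<partial>M)" by (intro integral_mono i le) auto
  then show ?thesis using i by (simp add: rms_le_def prob_space)
qed

lemma rms_le_cmult: "rms_le f a \<Longrightarrow> rms_le (\<lambda>w. c * f w) (c * a)"
  by (auto simp: rms_le_def power_mult_distrib intro!: mult_left_mono)

lemma rms_leI_nn:
  assumes f [measurable]: "f \<in> borel_measurable M" and le: "(\<integral>\<^sup>+w. ennreal ((f w)\<^sup>2) \<partial>M) \<le> ennreal (a\<^sup>2)"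
  shows "rms_le f a"
proof -
  have i: "integrable M (\<lambda>w. (f w)\<^sup>2)"
    using le by (intro integrableI_bounded) (auto simp: le_less_trans[OF _ ennreal_less_top])
  have "ennreal (\<integral>w. (f w)\<^sup>2 \<partial>M) \<le> ennreal (a\<^sup>2)"
    using le nn_integral_eq_integral[OF i] by simp
  then show ?thesis using i by (simp add: rms_le_def)
qed

lemma rms_le_weaken:
  assumes "rms_le f a" "0 \<le> a" "a \<le> b"
  shows "rms_le f b"
proof -
  have "a\<^sup>2 \<le> b\<^sup>2" using assms(2,3) by (rule power_mono[rotated])
  then show ?thesis using assms(1) unfolding rms_le_def by linarith
qed

lemma rms_le_expectation:
  assumes f: "rms_le f a" "f \<in> borel_measurable M" and a: "0 < a"
  shows "integrable M f" "(\<integral>w. f w \<partial>M) \<le> a"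
proof -
  have am: "p \<le> p\<^sup>2 / (2 * a) + a / 2" "\<bar>p\<bar> \<le> p\<^sup>2 / (2 * a) + a / 2" for p :: real
  proof -
    have *: "p\<^sup>2 / (2 * a) + a / 2 - \<bar>p\<bar> = (\<bar>p\<bar> - a)\<^sup>2 / (2 * a)"
      using a by (simp add: field_simps power2_eq_square)
    have "0 \<le> (\<bar>p\<bar> - a)\<^sup>2 / (2 * a)" using a by simp
    then show "\<bar>p\<bar> \<le> p\<^sup>2 / (2 * a) + a / 2" using * by linarith
    then show "p \<le> p\<^sup>2 / (2 * a) + a / 2" by simp
  qed
  have i: "integrable M (\<lambda>w. (f w)\<^sup>2 / (2 * a) + a / 2)" using f by (auto simp: rms_le_def)
  show fi: "integrable M f"
    by (rule Bochner_Integration.integrable_bound[OF i f(2)])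
       (auto intro!: AE_I2 order_trans[OF am(2) abs_ge_self])
  have "(\<integral>w. f w \<partial>M) \<le> (\<integral>w. (f w)\<^sup>2 / (2 * a) + a / 2 \<partial>M)"
    by (intro integral_mono fi i am)
  also have "\<dots> = (\<integral>w. (f w)\<^sup>2 \<partial>M) / (2 * a) + a / 2"
    using f by (simp add: rms_le_def prob_space)
  also have "\<dots> \<le> a\<^sup>2 / (2 * a) + a / 2"
    using f a by (intro add_right_mono divide_right_mono) (auto simp: rms_le_def)
  also have "\<dots> = a" using a by (simp add: power2_eq_square)
  finally show "(\<integral>w. f w \<partial>M) \<le> a" .
qed

text \<open>
  If a random quantity \<open>st\<close> is a function of the variables with index in \<open>A\<close> only, it is independent of
  any further variable. The factorisation of the joint distribution is stated directly, in the form in which Fubini's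
  theorem uses it. Independence of the two restricted families lives in product spaces over the index sets; it is
  pushed forward from there.
\<close>

lemma distr_past_present:
  fixes T :: "'j \<Rightarrow> 'a \<Rightarrow> 'b"
  assumes indep: "indep_vars N T UNIV" and j: "j \<notin> A"
    and st: "st \<in> PiM A N \<rightarrow>\<^sub>M Z"
    and past: "\<And>t t'. (\<And>a. a \<in> A \<Longrightarrow> t a = t' a) \<Longrightarrow> st t = st t'"
  shows "(\<lambda>w. st (\<lambda>a. T a w)) \<in> M \<rightarrow>\<^sub>M Z"
    and "distr M (Z \<Otimes>\<^sub>M N j) (\<lambda>w. (st (\<lambda>a. T a w), T j w))
       = distr M Z (\<lambda>w. st (\<lambda>a. T a w)) \<Otimes>\<^sub>M distr M (N j) (T j)"
proof -
  let ?RA = "\<lambda>w. restrict (\<lambda>a. T a w) A" and ?RB = "\<lambda>w. restrict (\<lambda>a. T a w) {j}"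
  have iv: "indep_var (PiM A N) ?RA (PiM {j} N) ?RB"
    by (rule indep_var_restrict[OF indep]) (use j in auto)
  have RA [measurable]: "?RA \<in> M \<rightarrow>\<^sub>M PiM A N" and RB [measurable]: "?RB \<in> M \<rightarrow>\<^sub>M PiM {j} N"
    using iv by (auto simp: indep_var_distribution_eq)
  have joint: "distr M (PiM A N) ?RA \<Otimes>\<^sub>M distr M (PiM {j} N) ?RB
      = distr M (PiM A N \<Otimes>\<^sub>M PiM {j} N) (\<lambda>w. (?RA w, ?RB w))"
    using iv by (auto simp: indep_var_distribution_eq)
  have stA: "st (?RA w) = st (\<lambda>a. T a w)" for w by (rule past) simp
  have pr [measurable]: "(\<lambda>b. b j) \<in> PiM {j} N \<rightarrow>\<^sub>M N j" by (rule measurable_component_singleton) simp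
  note [measurable] = st
  show "(\<lambda>w. st (\<lambda>a. T a w)) \<in> M \<rightarrow>\<^sub>M Z"
    using measurable_compose[OF RA st] by (simp add: stA)
  have dA: "distr (distr M (PiM A N) ?RA) Z st = distr M Z (\<lambda>w. st (\<lambda>a. T a w))"
    by (subst distr_distr) (auto simp: o_def stA)
  have dB: "distr (distr M (PiM {j} N) ?RB) (N j) (\<lambda>b. b j) = distr M (N j) (T j)"
    by (subst distr_distr) (auto simp: o_def)
  have "prob_space (distr M (N j) (T j))"
    unfolding dB[symmetric] by (intro prob_space.prob_space_distr prob_space_distr) auto
  then have sf: "sigma_finite_measure (distr (distr M (PiM {j} N) ?RB) (N j) (\<lambda>b. b j))"
    unfolding dB by (rule prob_space_imp_sigma_finite)
  have "distr M Z (\<lambda>w. st (\<lambda>a. T a w)) \<Otimes>\<^sub>M distr M (N j) (T j)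
      = distr (distr M (PiM A N) ?RA \<Otimes>\<^sub>M distr M (PiM {j} N) ?RB) (Z \<Otimes>\<^sub>M N j) (\<lambda>(a, b). (st a, b j))"
    unfolding dA[symmetric] dB[symmetric] by (rule pair_measure_distr[OF _ _ sf]) auto
  also have "\<dots> = distr M (Z \<Otimes>\<^sub>M N j) ((\<lambda>(a, b). (st a, b j)) \<circ> (\<lambda>w. (?RA w, ?RB w)))"
    unfolding joint by (rule distr_distr) measurable
  also have "((\<lambda>(a, b). (st a, b j)) \<circ> (\<lambda>w. (?RA w, ?RB w))) = (\<lambda>w. (st (\<lambda>a. T a w), T j w))"
    by (auto simp: fun_eq_iff stA)
  finally show "distr M (Z \<Otimes>\<^sub>M N j) (\<lambda>w. (st (\<lambda>a. T a w), T j w))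
       = distr M Z (\<lambda>w. st (\<lambda>a. T a w)) \<Otimes>\<^sub>M distr M (N j) (T j)" by simp
qed

end

section \<open>The stochastic process\<close>

text \<open>
  The algorithm for one horizon, with sampled objectives \<open>F\<close> that are Lipschitz continuous on the whole space.
  \<open>S\<close> is the shrunk constraint set; \<open>K\<close> contains all queries made from \<open>S\<close>, and the
  expected objectives are convex there.
\<close>

locale stochastic_run = gossip E W + prob_space M
  for E :: "('n::finite \<times> 'n) set" and W :: "real^'n^'n" and M :: "'w measure" +
  fixes P :: "'n \<Rightarrow> 's measure" and F :: "'n \<Rightarrow> 'v::euclidean_space \<Rightarrow> 's \<Rightarrow> real"
    and Q :: "'z measure" and C :: "'v \<Rightarrow> 'z \<Rightarrow> 'v"
    and u :: "'n \<Rightarrow> nat \<Rightarrow> 'w \<Rightarrow> 'v" and \<xi> :: "'n \<Rightarrow> nat \<Rightarrow> 'w \<Rightarrow> 's" and \<zeta> :: "'n \<Rightarrow> nat \<Rightarrow> 'w \<Rightarrow> 'z"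
    and S K :: "'v set" and x0 :: "'n \<Rightarrow> 'v" and \<eta> :: "nat \<Rightarrow> real"
    and L R \<mu> \<psi> \<gamma> r \<omega> :: real
  assumes F_measurable: "(\<lambda>(x, s). F i x s) \<in> borel_measurable (borel \<Otimes>\<^sub>M P i)"
    and F_lipschitz: "s \<in> space (P i) \<Longrightarrow> L-lipschitz_on UNIV (\<lambda>x. F i x s)"
    and P_prob: "prob_space (P i)"
    and F_integrable: "integrable (P i) (F i x)"
    and objective_convex: "convex_on K (local_objective P F i)"
    and compressor: "compressor_assumption Q C r \<omega>"
    and fresh: "fresh_randomness M P Q u \<xi> \<zeta>"
    and S: "convex S" "closed S" "S \<noteq> {}" and S_bounded: "S \<subseteq> cball 0 R"
    and S_margin: "x \<in> S \<Longrightarrow> cball x \<mu> \<subseteq> K"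
    and init: "norm (x0 i) \<le> R"
    and pos: "0 < L" "0 < R" "0 < \<mu>" "0 < \<psi>" "0 < \<gamma>" "0 < \<eta> k"
    and psi_le: "\<psi> \<le> 1 / r" and gamma_less: "\<gamma> < 1"
begin

abbreviation noise :: "'n \<times> nat \<Rightarrow> ('v \<times> 's \<times> 'z) measure" where
  "noise j \<equiv> uniform_sphere \<Otimes>\<^sub>M (P (fst j) \<Otimes>\<^sub>M Q)"

definition draw :: "'n \<times> nat \<Rightarrow> 'w \<Rightarrow> 'v \<times> 's \<times> 'z" where
  "draw = (\<lambda>(i, k) w. (u i k w, \<xi> i k w, \<zeta> i k w))"

text \<open>
  \<open>\<tau> i\<close> is the draw of agent \<open>i\<close> in the current iteration: direction, sample and compressor seed.
\<close>

definition refine :: "('n \<Rightarrow> 'v \<times> 's \<times> 'z) \<Rightarrow> 'v^'n \<Rightarrow> 'v^'n \<Rightarrow> 'v^'n" where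
  "refine \<tau> X H = H + \<psi> *\<^sub>R (\<chi> i. C (X $ i - H $ i) (snd (snd (\<tau> i))))"

abbreviation zo where
  "zo i x \<tau> \<equiv> zo_gradient (F i) \<mu> x (fst \<tau>) (fst (snd \<tau>))"

definition probe :: "('n \<Rightarrow> 'v \<times> 's \<times> 'z) \<Rightarrow> 'v^'n \<Rightarrow> 'v^'n" where
  "probe \<tau> X = (\<chi> i. zo i (X $ i) (\<tau> i))"

text \<open>
  The state keeps only the iterates and their estimates: the mismatch variable is always the
  Laplacian of the estimates, and the message is determined by the state and a fresh seed.
\<close>

primrec state :: "('n \<times> nat \<Rightarrow> 'v \<times> 's \<times> 'z) \<Rightarrow> nat \<Rightarrow> ('v^'n) \<times> ('v^'n)" where
  "state t 0 = ((\<chi> i. x0 i), 0)"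
| "state t (Suc k) =
     (let X = fst (state t k); H' = refine (\<lambda>i. t (i, k)) X (snd (state t k))
      in (project S (X - \<gamma> *\<^sub>R laplacian H' - \<eta> k *\<^sub>R probe (\<lambda>i. t (i, k)) X), H'))"

lemma state_past:
  "(\<And>j. j \<in> UNIV \<times> {..<k} \<Longrightarrow> t j = t' j) \<Longrightarrow> state t k = state t' k"
proof (induction k)
  case (Suc k)
  have eq: "(\<lambda>i. t (i, k)) = (\<lambda>i. t' (i, k))" using Suc(2) by (auto simp: fun_eq_iff)
  have IH: "state t k = state t' k" using Suc by auto
  show ?case by (simp only: state.simps eq IH)
qed simp

lemma sphere_borel: "(\<lambda>x. x) \<in> uniform_sphere \<rightarrow>\<^sub>M borel"
  unfolding uniform_sphere_def by (rule measurable_restrict_space1) simp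

lemma fst_sphere_borel: "fst \<in> uniform_sphere \<Otimes>\<^sub>M A \<rightarrow>\<^sub>M borel"
  using measurable_compose[OF measurable_fst[of uniform_sphere A] sphere_borel] by simp

lemma F_compose:
  assumes "f \<in> A \<rightarrow>\<^sub>M borel" "g \<in> A \<rightarrow>\<^sub>M P i"
  shows "(\<lambda>a. F i (f a) (g a)) \<in> borel_measurable A"
  using measurable_compose[OF measurable_Pair[OF assms] F_measurable[of i]] by simp

lemma C_compose:
  assumes "f \<in> A \<rightarrow>\<^sub>M borel" "g \<in> A \<rightarrow>\<^sub>M Q"
  shows "(\<lambda>a. C (f a) (g a)) \<in> borel_measurable A"
  using measurable_compose[OF measurable_Pair[OF assms], of "\<lambda>(x, z). C x z" borel] compressor
  by (simp add: compressor_assumption_def)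

lemma zo_gradient_compose:
  assumes [measurable]: "f \<in> A \<rightarrow>\<^sub>M borel" and g: "g \<in> A \<rightarrow>\<^sub>M uniform_sphere \<Otimes>\<^sub>M (P i \<Otimes>\<^sub>M Q)"
  shows "(\<lambda>a. zo i (f a) (g a)) \<in> borel_measurable A"
proof -
  have [measurable]: "(\<lambda>a. fst (g a)) \<in> borel_measurable A"
    by (rule measurable_compose[OF g fst_sphere_borel])
  have s: "(\<lambda>a. fst (snd (g a))) \<in> A \<rightarrow>\<^sub>M P i"
    using g by measurable
  have [measurable]: "(\<lambda>a. F i (f a) (fst (snd (g a)))) \<in> borel_measurable A"
      "(\<lambda>a. F i (f a + \<mu> *\<^sub>R fst (g a)) (fst (snd (g a)))) \<in> borel_measurable A"
    by (rule F_compose[OF _ s], measurable)+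
  show ?thesis unfolding zo_gradient_def by measurable
qed

lemma state_measurable:
  assumes "UNIV \<times> {..<k} \<subseteq> A"
  shows "(\<lambda>t. state t k) \<in> PiM A noise \<rightarrow>\<^sub>M borel \<Otimes>\<^sub>M borel"
  using assms
proof (induction k)
  case (Suc k)
  have "UNIV \<times> {..<k} \<subseteq> A" using Suc(2) by fastforce
  then have IH [measurable]: "(\<lambda>t. state t k) \<in> PiM A noise \<rightarrow>\<^sub>M borel \<Otimes>\<^sub>M borel"
    by (rule Suc(1))
  have mem: "(i, k) \<in> A" for i by (rule subsetD[OF Suc(2)]) simp
  have t: "(\<lambda>t. t (i, k)) \<in> PiM A noise \<rightarrow>\<^sub>M uniform_sphere \<Otimes>\<^sub>M (P i \<Otimes>\<^sub>M Q)" for i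
    using measurable_component_singleton[OF mem[of i], of noise] unfolding fst_conv by assumption
  have [measurable]: "(\<lambda>t. C (fst (state t k) $ i - snd (state t k) $ i) (snd (snd (t (i, k)))))
      \<in> borel_measurable (PiM A noise)" for i
  proof (rule C_compose)
    show "(\<lambda>t. snd (snd (t (i, k)))) \<in> PiM A noise \<rightarrow>\<^sub>M Q"
      by (rule measurable_compose[OF t]) measurable
  qed measurable
  have [measurable]: "(\<lambda>t. refine (\<lambda>i. t (i, k)) (fst (state t k)) (snd (state t k))) \<in> borel_measurable (PiM A noise)"
    unfolding refine_def by measurable
  have [measurable]: "(\<lambda>t. probe (\<lambda>i. t (i, k)) (fst (state t k))) \<in> borel_measurable (PiM A noise)"
    unfolding probe_def by (intro borel_measurable_vec_lambda zo_gradient_compose t) measurable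
  have lap: "continuous_on UNIV (laplacian :: 'v^'n \<Rightarrow> 'v^'n)"
    unfolding laplacian_def[abs_def] by (intro continuous_intros continuous_on_mix)
  have [measurable]: "(\<lambda>t. laplacian (refine (\<lambda>i. t (i, k)) (fst (state t k)) (snd (state t k))))
      \<in> borel_measurable (PiM A noise)"
    by (rule borel_measurable_continuous_on[OF lap]) measurable
  have "(\<lambda>t. fst (state t (Suc k))) \<in> borel_measurable (PiM A noise)"
    unfolding state.simps Let_def fst_conv project_def
    by (intro borel_measurable_vec_lambda
        borel_measurable_continuous_on[OF continuous_on_closest_point[OF S]]) measurable
  moreover have "(\<lambda>t. snd (state t (Suc k))) \<in> borel_measurable (PiM A noise)"
    unfolding state.simps Let_def snd_conv by measurable
  ultimately have "(\<lambda>t. (fst (state t (Suc k)), snd (state t (Suc k)))) \<in> PiM A noise \<rightarrow>\<^sub>M borel \<Otimes>\<^sub>M borel"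
    by (rule measurable_Pair)
  then show ?case by (simp only: prod.collapse)
qed simp

lemma draws_independent: "indep_vars noise draw UNIV"
proof -
  have "noise = (\<lambda>(i, k). uniform_sphere \<Otimes>\<^sub>M (P i \<Otimes>\<^sub>M Q))" by auto
  then show ?thesis using fresh by (simp add: fresh_randomness_def draw_def)
qed

lemma distr_draw: "distr M (noise j) (draw j) = noise j"
  using fresh by (cases j) (simp add: fresh_randomness_def draw_def)

lemma draw_measurable [measurable]: "draw j \<in> M \<rightarrow>\<^sub>M noise j"
  using draws_independent unfolding indep_vars_def2 by blast

lemma draw_space: "w \<in> space M \<Longrightarrow> draw j w \<in> space (noise j)"
  using draw_measurable by (rule measurable_space)

lemma noise_sphere: "\<tau> \<in> space (noise j) \<Longrightarrow> norm (fst \<tau>) = 1"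
  by (auto simp: space_pair_measure uniform_sphere_def space_restrict_space)

definition X where "X k w = fst (state (\<lambda>j. draw j w) k)"
definition H where "H k w = snd (state (\<lambda>j. draw j w) k)"

abbreviation draws where "draws k w \<equiv> (\<lambda>i. draw (i, k) w)"

lemma X_0: "X 0 w = (\<chi> i. x0 i)" and H_0: "H 0 w = 0"
  by (simp_all add: X_def H_def)

lemma H_Suc: "H (Suc k) w = refine (draws k w) (X k w) (H k w)"
  and X_Suc: "X (Suc k) w = project S (X k w - \<gamma> *\<^sub>R laplacian (H (Suc k) w) - \<eta> k *\<^sub>R probe (draws k w) (X k w))"
  by (simp_all add: X_def H_def Let_def)

lemma present_not_past: "(i, k) \<notin> UNIV \<times> {..<k :: nat}" by simp

lemma state_random: "(\<lambda>w. (X k w, H k w)) \<in> M \<rightarrow>\<^sub>M borel \<Otimes>\<^sub>M borel"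
  using distr_past_present(1)[OF draws_independent present_not_past state_measurable[OF order_refl] state_past]
  by (simp add: X_def H_def)

lemma X_measurable [measurable]: "X k \<in> borel_measurable M"
  and H_measurable [measurable]: "H k \<in> borel_measurable M"
  using measurable_compose[OF state_random measurable_fst] measurable_compose[OF state_random measurable_snd]
  by simp_all

lemma distr_state_draw:
  "distr M ((borel \<Otimes>\<^sub>M borel) \<Otimes>\<^sub>M noise (i, k)) (\<lambda>w. ((X k w, H k w), draw (i, k) w))
     = distr M (borel \<Otimes>\<^sub>M borel) (\<lambda>w. (X k w, H k w)) \<Otimes>\<^sub>M noise (i, k)"
  using distr_past_present(2)[OF draws_independent present_not_past[of i k] state_measurable[OF order_refl] state_past]
  unfolding distr_draw by (simp add: X_def H_def)

lemma prob_space_P_Q: "prob_space (P i \<Otimes>\<^sub>M Q)" and prob_space_Q: "prob_space Q"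
  and prob_space_noise: "prob_space (noise j)"
proof -
  show Q: "prob_space Q" using compressor by (simp add: compressor_assumption_def)
  have PQ: "prob_space (P i \<Otimes>\<^sub>M Q)" for i
  proof -
    interpret PQ: pair_prob_space "P i" Q using P_prob Q by (rule pair_prob_spaceI)
    show ?thesis by (rule PQ.prob_space_axioms)
  qed
  then show "prob_space (P i \<Otimes>\<^sub>M Q)" .
  interpret UPQ: pair_prob_space uniform_sphere "P (fst j) \<Otimes>\<^sub>M Q"
    using prob_space_uniform_sphere PQ by (rule pair_prob_spaceI)
  show "prob_space (noise j)" by (rule UPQ.prob_space_axioms)
qed

lemma state_pair_prob: "pair_prob_space (distr M (borel \<Otimes>\<^sub>M borel) (\<lambda>w. (X k w, H k w))) (noise (i, k))"
  using prob_space_distr[OF state_random] prob_space_noise by (rule pair_prob_spaceI)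

text \<open>
  The state at iteration \<open>k\<close> may be held fixed while the expectation over the draws of iteration \<open>k\<close> is
  taken. This replaces conditioning on the past.
\<close>

lemma expectation_fresh_draw:
  fixes h :: "(('v^'n) \<times> ('v^'n)) \<times> ('v \<times> 's \<times> 'z) \<Rightarrow> real"
  assumes h [measurable]: "h \<in> borel_measurable ((borel \<Otimes>\<^sub>M borel) \<Otimes>\<^sub>M noise (i, k))"
    and int: "integrable M (\<lambda>w. h ((X k w, H k w), draw (i, k) w))"
  shows "integrable M (\<lambda>w. \<integral>\<tau>. h ((X k w, H k w), \<tau>) \<partial>noise (i, k))"
    and "(\<integral>w. h ((X k w, H k w), draw (i, k) w) \<partial>M) = (\<integral>w. (\<integral>\<tau>. h ((X k w, H k w), \<tau>) \<partial>noise (i, k)) \<partial>M)"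
proof -
  let ?st = "\<lambda>w. (X k w, H k w)" and ?Z = "borel \<Otimes>\<^sub>M borel :: (('v^'n) \<times> ('v^'n)) measure"
  interpret J: pair_prob_space "distr M ?Z ?st" "noise (i, k)" by (rule state_pair_prob)
  note [measurable] = state_random
  have m: "(\<lambda>w. (?st w, draw (i, k) w)) \<in> M \<rightarrow>\<^sub>M ?Z \<Otimes>\<^sub>M noise (i, k)" by measurable
  have "integrable (distr M (?Z \<Otimes>\<^sub>M noise (i, k)) (\<lambda>w. (?st w, draw (i, k) w))) h"
    using int by (subst integrable_distr_eq[OF m h])
  then have i2: "integrable (distr M ?Z ?st \<Otimes>\<^sub>M noise (i, k)) h" unfolding distr_state_draw .
  from J.integrable_fst'[OF i2] have i3: "integrable (distr M ?Z ?st) (\<lambda>x. \<integral>\<tau>. h (x, \<tau>) \<partial>noise (i, k))" .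
  have m2: "(\<lambda>x. \<integral>\<tau>. h (x, \<tau>) \<partial>noise (i, k)) \<in> borel_measurable ?Z"
    using borel_measurable_integrable[OF i3] by simp
  show "integrable M (\<lambda>w. \<integral>\<tau>. h (?st w, \<tau>) \<partial>noise (i, k))"
    using i3 by (subst (asm) integrable_distr_eq[OF state_random m2])
  have "(\<integral>w. h (?st w, draw (i, k) w) \<partial>M) = integral\<^sup>L (distr M ?Z ?st \<Otimes>\<^sub>M noise (i, k)) h"
    unfolding distr_state_draw[symmetric] by (rule integral_distr[OF m h, symmetric])
  also have "\<dots> = (\<integral>x. \<integral>\<tau>. h (x, \<tau>) \<partial>noise (i, k) \<partial>distr M ?Z ?st)"
    by (rule J.integral_fst'[OF i2, symmetric])
  also have "\<dots> = (\<integral>w. (\<integral>\<tau>. h (?st w, \<tau>) \<partial>noise (i, k)) \<partial>M)"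
    by (rule integral_distr[OF state_random m2])
  finally show "(\<integral>w. h (?st w, draw (i, k) w) \<partial>M) = (\<integral>w. (\<integral>\<tau>. h (?st w, \<tau>) \<partial>noise (i, k)) \<partial>M)" .
qed

lemma nn_expectation_fresh_draw:
  fixes h :: "(('v^'n) \<times> ('v^'n)) \<times> ('v \<times> 's \<times> 'z) \<Rightarrow> ennreal"
  assumes h [measurable]: "h \<in> borel_measurable ((borel \<Otimes>\<^sub>M borel) \<Otimes>\<^sub>M noise (i, k))"
  shows "(\<integral>\<^sup>+w. h ((X k w, H k w), draw (i, k) w) \<partial>M)
       = (\<integral>\<^sup>+w. (\<integral>\<^sup>+\<tau>. h ((X k w, H k w), \<tau>) \<partial>noise (i, k)) \<partial>M)"
proof -
  let ?st = "\<lambda>w. (X k w, H k w)" and ?Z = "borel \<Otimes>\<^sub>M borel :: (('v^'n) \<times> ('v^'n)) measure"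
  interpret J: pair_prob_space "distr M ?Z ?st" "noise (i, k)" by (rule state_pair_prob)
  note [measurable] = state_random
  have m: "(\<lambda>w. (?st w, draw (i, k) w)) \<in> M \<rightarrow>\<^sub>M ?Z \<Otimes>\<^sub>M noise (i, k)" by measurable
  have h': "h \<in> borel_measurable (distr M ?Z ?st \<Otimes>\<^sub>M noise (i, k))"
    by (subst measurable_cong_sets[OF sets_pair_measure_cong[OF sets_distr refl] refl]) (rule h)
  have "(\<integral>\<^sup>+w. h (?st w, draw (i, k) w) \<partial>M) = integral\<^sup>N (distr M ?Z ?st \<Otimes>\<^sub>M noise (i, k)) h"
    unfolding distr_state_draw[symmetric]
    by (subst nn_integral_distr[OF m]) (simp_all only: measurable_distr_eq1 h)
  also have "\<dots> = (\<integral>\<^sup>+x. \<integral>\<^sup>+\<tau>. h (x, \<tau>) \<partial>noise (i, k) \<partial>distr M ?Z ?st)"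
    by (rule J.M2.nn_integral_fst[OF h', symmetric])
  also have "\<dots> = (\<integral>\<^sup>+w. (\<integral>\<^sup>+\<tau>. h (?st w, \<tau>) \<partial>noise (i, k)) \<partial>M)"
    using J.M2.borel_measurable_nn_integral_fst[OF h']
    by (intro nn_integral_distr[OF state_random]) simp
  finally show ?thesis .
qed

section \<open>Mean square bounds for disagreement and estimation error\<close>

text \<open>
  Contraction factor of the root mean square estimation error. It is chosen above \<open>\<surd>(1 - \<psi> r \<omega>)\<close> because the
  addition of root mean square bounds requires them to be positive, which the square root is not if
  \<open>\<psi> r \<omega> = 1\<close>.
\<close>

definition \<rho> where "\<rho> = 1 - const_c0 \<psi> r \<omega>"
definition G where "G = sqrt (real CARD('n)) * (real DIM('v) * L)"

lemma r_\<omega>: "1 \<le> r" "0 < \<omega>" "\<omega> \<le> 1"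
  using compressor by (auto simp: compressor_assumption_def)

lemma psi_r: "0 < \<psi> * r" "\<psi> * r \<le> 1"
  using r_\<omega> pos psi_le by (auto simp: field_simps)

lemma psi_r_\<omega>: "0 < \<psi> * r * \<omega>" "\<psi> * r * \<omega> \<le> 1"
  using psi_r r_\<omega> by (auto intro: mult_le_one)

lemma \<rho>: "0 < \<rho>" "\<rho> \<le> 1" "1 - \<psi> * r * \<omega> \<le> \<rho>\<^sup>2"
proof -
  show "0 < \<rho>" "\<rho> \<le> 1" using psi_r_\<omega> by (auto simp: \<rho>_def const_c0_def)
  show "1 - \<psi> * r * \<omega> \<le> \<rho>\<^sup>2" using zero_le_power2[of "\<psi> * r * \<omega> / 2"]
    by (simp add: \<rho>_def const_c0_def power2_eq_square algebra_simps)
qed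

lemma G_pos: "0 < G" using pos by (simp add: G_def)

lemma nn_integral_seed:
  assumes [measurable]: "g \<in> borel_measurable Q"
  shows "(\<integral>\<^sup>+\<tau>. g (snd (snd \<tau>)) \<partial>noise j) = (\<integral>\<^sup>+z. g z \<partial>Q)"
proof -
  interpret Q: prob_space Q by (rule prob_space_Q)
  interpret PQ: prob_space "P (fst j) \<Otimes>\<^sub>M Q" by (rule prob_space_P_Q)
  interpret Pj: prob_space "P (fst j)" by (rule P_prob)
  interpret sph: prob_space "uniform_sphere :: 'v measure" by (rule prob_space_uniform_sphere)
  have "(\<integral>\<^sup>+\<tau>. g (snd (snd \<tau>)) \<partial>noise j)
      = (\<integral>\<^sup>+x. \<integral>\<^sup>+y. g (snd (snd (x, y))) \<partial>(P (fst j) \<Otimes>\<^sub>M Q) \<partial>(uniform_sphere :: 'v measure))"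
    by (rule PQ.nn_integral_fst[symmetric]) measurable
  also have "\<dots> = (\<integral>\<^sup>+y. g (snd y) \<partial>(P (fst j) \<Otimes>\<^sub>M Q))" by (simp add: sph.emeasure_space_1)
  also have "\<dots> = (\<integral>\<^sup>+x. \<integral>\<^sup>+y. g (snd (x, y)) \<partial>Q \<partial>P (fst j))"
    by (rule Q.nn_integral_fst[symmetric]) measurable
  also have "\<dots> = (\<integral>\<^sup>+z. g z \<partial>Q)" by (simp add: Pj.emeasure_space_1)
  finally show ?thesis .
qed

text \<open>
  One step \<open>\<psi> C(v)\<close> towards \<open>v\<close> is a convex combination, with weight \<open>\<psi> r \<le> 1\<close>, of doing
  nothing and of subtracting the rescaled compression \<open>C(v) / r\<close>, so the contraction of the latter is inherited
  in proportion to the weight.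
\<close>

lemma compression_contraction:
  "(\<integral>\<^sup>+\<tau>. ennreal ((norm (v - \<psi> *\<^sub>R C v (snd (snd \<tau>))))\<^sup>2) \<partial>noise j) \<le> ennreal ((1 - \<psi> * r * \<omega>) * (norm v)\<^sup>2)"
proof -
  let ?g = "\<lambda>z. (norm ((1 / r) *\<^sub>R C v z - v))\<^sup>2"
  have Cm [measurable]: "C v \<in> borel_measurable Q"
    using C_compose[of "\<lambda>_. v" Q "\<lambda>z. z"] by simp
  have pt: "(norm (v - \<psi> *\<^sub>R C v z))\<^sup>2 \<le> (1 - \<psi> * r) * (norm v)\<^sup>2 + \<psi> * r * ?g z" for z
  proof -
    have r0: "r \<noteq> 0" using r_\<omega> by simp
    let ?e = "v - (1 / r) *\<^sub>R C v z"
    have eq: "v - \<psi> *\<^sub>R C v z = (1 - \<psi> * r) *\<^sub>R v + (\<psi> * r) *\<^sub>R ?e"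
      using r0 by (simp add: algebra_simps)
    have "(1 - t) * (norm a)\<^sup>2 + t * (norm b)\<^sup>2 - (norm ((1 - t) *\<^sub>R a + t *\<^sub>R b))\<^sup>2
        = t * (1 - t) * (norm (a - b))\<^sup>2" for t :: real and a b :: 'v
      unfolding power2_norm_eq_inner
      by (simp add: inner_add_left inner_add_right inner_diff_left inner_diff_right inner_commute algebra_simps)
    then have "(norm ((1 - t) *\<^sub>R a + t *\<^sub>R b))\<^sup>2 \<le> (1 - t) * (norm a)\<^sup>2 + t * (norm b)\<^sup>2"
      if "0 \<le> t" "t \<le> 1" for t :: real and a b :: 'v
      using that by (smt (verit) mult_nonneg_nonneg zero_le_power2)
    from this[of "\<psi> * r" v ?e] psi_r show ?thesis unfolding eq by (simp add: norm_minus_commute)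
  qed
  have "(\<integral>\<^sup>+\<tau>. ennreal ((norm (v - \<psi> *\<^sub>R C v (snd (snd \<tau>))))\<^sup>2) \<partial>noise j)
      = (\<integral>\<^sup>+z. ennreal ((norm (v - \<psi> *\<^sub>R C v z))\<^sup>2) \<partial>Q)"
    by (rule nn_integral_seed) measurable
  also have "\<dots> \<le> (\<integral>\<^sup>+z. ennreal ((1 - \<psi> * r) * (norm v)\<^sup>2) + ennreal (\<psi> * r) * ennreal (?g z) \<partial>Q)"
    using pt psi_r by (intro nn_integral_mono) (simp add: ennreal_mult[symmetric] ennreal_plus[symmetric] del: ennreal_plus)
  also have "\<dots> = ennreal ((1 - \<psi> * r) * (norm v)\<^sup>2) + ennreal (\<psi> * r) * (\<integral>\<^sup>+z. ennreal (?g z) \<partial>Q)"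
    using prob_space.emeasure_space_1[OF prob_space_Q] by (simp add: nn_integral_add nn_integral_cmult)
  also have "\<dots> \<le> ennreal ((1 - \<psi> * r) * (norm v)\<^sup>2) + ennreal (\<psi> * r) * ennreal ((1 - \<omega>) * (norm v)\<^sup>2)"
    using compressor by (intro add_left_mono mult_left_mono) (auto simp: compressor_assumption_def)
  also have "\<dots> = ennreal ((1 - \<psi> * r) * (norm v)\<^sup>2 + \<psi> * r * ((1 - \<omega>) * (norm v)\<^sup>2))"
    using psi_r r_\<omega> by (simp add: ennreal_mult[symmetric] ennreal_plus[symmetric] del: ennreal_plus)
  also have "(1 - \<psi> * r) * (norm v)\<^sup>2 + \<psi> * r * ((1 - \<omega>) * (norm v)\<^sup>2) = (1 - \<psi> * r * \<omega>) * (norm v)\<^sup>2"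
    by (simp add: algebra_simps)
  finally show ?thesis .
qed

lemma estimate_error_contraction:
  assumes e: "rms_le (\<lambda>w. norm (X k w - H k w)) e" "0 \<le> e"
  shows "rms_le (\<lambda>w. norm (X k w - H (Suc k) w)) (\<rho> * e)"
proof (rule rms_leI_nn)
  show "(\<lambda>w. norm (X k w - H (Suc k) w)) \<in> borel_measurable M" by measurable
  let ?q = "1 - \<psi> * r * \<omega>"
  have comp: "(\<integral>\<^sup>+w. ennreal ((norm ((X k w - H (Suc k) w) $ i))\<^sup>2) \<partial>M)
      \<le> (\<integral>\<^sup>+w. ennreal (?q * (norm ((X k w - H k w) $ i))\<^sup>2) \<partial>M)" for i
  proof -
    let ?h = "\<lambda>p :: (('v^'n) \<times> ('v^'n)) \<times> ('v \<times> 's \<times> 'z).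
      ennreal ((norm ((fst (fst p) $ i - snd (fst p) $ i) - \<psi> *\<^sub>R C (fst (fst p) $ i - snd (fst p) $ i) (snd (snd (snd p)))))\<^sup>2)"
    have [measurable]: "(\<lambda>p. C (fst (fst p) $ i - snd (fst p) $ i) (snd (snd (snd p))))
        \<in> borel_measurable ((borel \<Otimes>\<^sub>M borel) \<Otimes>\<^sub>M noise (i, k))"
      by (rule C_compose) measurable
    have hm: "?h \<in> borel_measurable ((borel \<Otimes>\<^sub>M borel) \<Otimes>\<^sub>M noise (i, k))" by measurable
    have "(\<integral>\<^sup>+w. ennreal ((norm ((X k w - H (Suc k) w) $ i))\<^sup>2) \<partial>M)
        = (\<integral>\<^sup>+w. ?h ((X k w, H k w), draw (i, k) w) \<partial>M)"
      by (intro nn_integral_cong) (simp add: H_Suc refine_def algebra_simps)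
    also have "\<dots> = (\<integral>\<^sup>+w. (\<integral>\<^sup>+\<tau>. ?h ((X k w, H k w), \<tau>) \<partial>noise (i, k)) \<partial>M)"
      by (rule nn_expectation_fresh_draw[OF hm])
    also have "\<dots> \<le> (\<integral>\<^sup>+w. ennreal (?q * (norm ((X k w - H k w) $ i))\<^sup>2) \<partial>M)"
      by (intro nn_integral_mono) (use compression_contraction[where j="(i, k)"] in
          \<open>simp only: fst_conv snd_conv vector_minus_component\<close>)
    finally show ?thesis .
  qed
  have q: "0 \<le> ?q" using psi_r_\<omega> by simp
  have "(\<integral>\<^sup>+w. ennreal ((norm (X k w - H (Suc k) w))\<^sup>2) \<partial>M)
      = (\<Sum>i\<in>UNIV. \<integral>\<^sup>+w. ennreal ((norm ((X k w - H (Suc k) w) $ i))\<^sup>2) \<partial>M)"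
  proof -
    have "ennreal ((norm (X k w - H (Suc k) w))\<^sup>2) = (\<Sum>i\<in>UNIV. ennreal ((norm ((X k w - H (Suc k) w) $ i))\<^sup>2))" for w
      unfolding norm_vec_power2 by (rule sum_ennreal[symmetric]) simp
    then show ?thesis by (simp only:) (rule nn_integral_sum, measurable)
  qed
  also have "\<dots> \<le> (\<Sum>i\<in>UNIV. \<integral>\<^sup>+w. ennreal (?q * (norm ((X k w - H k w) $ i))\<^sup>2) \<partial>M)"
    by (intro sum_mono comp)
  also have "\<dots> = (\<integral>\<^sup>+w. (\<Sum>i\<in>UNIV. ennreal (?q * (norm ((X k w - H k w) $ i))\<^sup>2)) \<partial>M)"
    by (rule nn_integral_sum[symmetric]) measurable
  also have "\<dots> = (\<integral>\<^sup>+w. ennreal (?q * (norm (X k w - H k w))\<^sup>2) \<partial>M)"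
    unfolding norm_vec_power2 sum_distrib_left
    by (intro nn_integral_cong sum_ennreal mult_nonneg_nonneg q zero_le_power2)
  also have "\<dots> = ennreal (\<integral>w. ?q * (norm (X k w - H k w))\<^sup>2 \<partial>M)"
    using e q by (intro nn_integral_eq_integral) (auto simp: rms_le_def)
  also have "\<dots> \<le> ennreal ((\<rho> * e)\<^sup>2)"
  proof (rule ennreal_leI)
    have "(\<integral>w. ?q * (norm (X k w - H k w))\<^sup>2 \<partial>M) = ?q * (\<integral>w. (norm (X k w - H k w))\<^sup>2 \<partial>M)" by simp
    also have "\<dots> \<le> \<rho>\<^sup>2 * e\<^sup>2"
      using e q \<rho>(3) by (intro mult_mono) (auto simp: rms_le_def)
    finally show "(\<integral>w. ?q * (norm (X k w - H k w))\<^sup>2 \<partial>M) \<le> (\<rho> * e)\<^sup>2" by (simp add: power_mult_distrib)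
  qed
  finally show "(\<integral>\<^sup>+w. ennreal ((norm (X k w - H (Suc k) w))\<^sup>2) \<partial>M) \<le> ennreal ((\<rho> * e)\<^sup>2)" .
qed

lemma X_Suc_in_S: "X (Suc k) w $ i \<in> S"
  by (simp only: X_Suc project_def vec_lambda_beta) (rule closest_point_in_set[OF S(2,3)])

lemma X_bounded: "norm (X k w $ i) \<le> R"
proof (cases k)
  case (Suc m)
  have "X (Suc m) w $ i \<in> cball 0 R" using X_Suc_in_S S_bounded by (rule subsetD[rotated])
  then show ?thesis using Suc by simp
qed (simp add: X_0 init)

lemma norm_X: "norm (X k w) \<le> sqrt (real CARD('n)) * R"
  by (intro norm_vec_uniform_bound X_bounded less_imp_le[OF pos(2)])

lemma disagreement_measurable [measurable]:
  assumes [measurable]: "Y \<in> borel_measurable A"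
  shows "(\<lambda>w. disagreement (Y w :: 'v^'n)) \<in> borel_measurable A"
  by (rule borel_measurable_continuous_on[OF _ assms])
     (unfold disagreement_def mean_def vec_def, intro continuous_intros)

lemma zo_gradient_bound:
  assumes "\<tau> \<in> space (noise (i, k))"
  shows "norm (zo i x \<tau>) \<le> real DIM('v) * L"
proof -
  have s: "fst (snd \<tau>) \<in> space (P i)" using assms by (simp add: space_pair_measure mem_Times_iff)
  have n: "norm (fst \<tau>) = 1" by (rule noise_sphere[OF assms])
  have "\<bar>F i (x + \<mu> *\<^sub>R fst \<tau>) (fst (snd \<tau>)) - F i x (fst (snd \<tau>))\<bar> \<le> L * \<mu>"
    using lipschitz_onD[OF F_lipschitz[OF s], of "x + \<mu> *\<^sub>R fst \<tau>" x] n pos by (simp add: dist_norm)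
  then have "real DIM('v) / \<mu> * \<bar>F i (x + \<mu> *\<^sub>R fst \<tau>) (fst (snd \<tau>)) - F i x (fst (snd \<tau>))\<bar>
      \<le> real DIM('v) / \<mu> * (L * \<mu>)"
    using pos by (intro mult_left_mono) auto
  then show ?thesis using n pos by (simp add: zo_gradient_def abs_mult)
qed

lemma norm_probe:
  assumes "w \<in> space M"
  shows "norm (probe (draws k w) Y) \<le> G"
  unfolding G_def
proof (rule norm_vec_uniform_bound)
  show "norm (probe (draws k w) Y $ i) \<le> real DIM('v) * L" for i
    unfolding probe_def vec_lambda_beta by (rule zo_gradient_bound[OF draw_space[OF assms]])
qed (use pos(1) in simp_all)

lemma probe_measurable [measurable]: "(\<lambda>w. probe (draws k w) (X k w)) \<in> borel_measurable M"
proof -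
  have "draw (i, k) \<in> M \<rightarrow>\<^sub>M uniform_sphere \<Otimes>\<^sub>M (P i \<Otimes>\<^sub>M Q)" for i
    using draw_measurable[of "(i, k)"] unfolding fst_conv .
  then show ?thesis
    unfolding probe_def by (intro borel_measurable_vec_lambda zo_gradient_compose borel_measurable_vec_nth' X_measurable)
qed

text \<open>
  The deterministic one-step bounds hold for every outcome, and Minkowski's inequality carries them over to root mean
  squares. Compression acts between the two estimation errors \<open>X - H\<close>, before and after the estimates are
  updated, and contributes the factor \<open>\<rho>\<close>.
\<close>

lemma second_moment_step:
  assumes a: "rms_le (\<lambda>w. disagreement (X (Suc k) w)) a" "0 < a"
    and e: "rms_le (\<lambda>w. norm (X (Suc k) w - H (Suc k) w)) e" "0 < e"
  shows "rms_le (\<lambda>w. disagreement (X (Suc (Suc k)) w))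
      ((1 - \<gamma> * \<delta>) * a + \<gamma> * \<beta> * (\<rho> * e) + \<eta> (Suc k) * G)" (is ?A)
    and "rms_le (\<lambda>w. norm (X (Suc (Suc k)) w - H (Suc (Suc k)) w))
      (\<gamma> * \<beta> * a + (1 + \<gamma> * \<beta>) * (\<rho> * e) + \<eta> (Suc k) * G)" (is ?E)
proof -
  let ?k = "Suc k"
  have y: "rms_le (\<lambda>w. norm (X ?k w - H (Suc ?k) w)) (\<rho> * e)"
    using e by (intro estimate_error_contraction) auto
  have \<gamma>: "0 \<le> \<gamma>" "\<gamma> \<le> 1" using pos gamma_less by auto
  have b: "0 < \<beta>" by (rule laplacian_norm_pos)
  have gd: "\<gamma> * \<delta> < 1" using mult_left_mono[OF gap(2) less_imp_le[OF pos(5)]] gamma_less by simp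
  have g: "rms_le (\<lambda>w. \<eta> ?k * norm (probe (draws ?k w) (X ?k w))) (\<eta> ?k * G)"
    using pos(6)[of ?k] norm_probe by (intro rms_le_cmult rms_le_const) auto
  have ge: "0 < \<eta> ?k * G" using pos(6) G_pos by simp
  have re: "0 < \<rho> * e" using \<rho> e by simp
  have p: "0 < (1 - \<gamma> * \<delta>) * a" using gd a(2) by (intro mult_pos_pos) simp_all
  have p': "0 < \<gamma> * \<beta> * (\<rho> * e)" "0 < \<gamma> * \<beta> * a" "0 < (1 + \<gamma> * \<beta>) * (\<rho> * e)"
    by (intro mult_pos_pos add_pos_pos re b pos(5) a(2) zero_less_one)+
  have gd': "0 \<le> 1 - \<gamma> * \<delta>" "0 \<le> \<gamma> * \<beta>" "0 \<le> 1 + \<gamma> * \<beta>"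
    using gd mult_pos_pos[OF pos(5) b] by simp_all
  have an: "0 \<le> (1 - \<gamma> * \<delta>) * disagreement (X ?k w)" "0 \<le> \<gamma> * \<beta> * norm (X ?k w - H (Suc ?k) w)"
    "0 \<le> \<gamma> * \<beta> * disagreement (X ?k w)" "0 \<le> (1 + \<gamma> * \<beta>) * norm (X ?k w - H (Suc ?k) w)" for w
    by (intro mult_nonneg_nonneg gd' disagreement_nonneg norm_ge_zero)+
  have "rms_le (\<lambda>w. (1 - \<gamma> * \<delta>) * disagreement (X ?k w) + \<gamma> * \<beta> * norm (X ?k w - H (Suc ?k) w))
      ((1 - \<gamma> * \<delta>) * a + \<gamma> * \<beta> * (\<rho> * e))"
    by (rule rms_le_add[OF rms_le_cmult[OF a(1)] rms_le_cmult[OF y] p p'(1)])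
       (measurable, intro add_nonneg_nonneg an, rule order_refl)
  then show ?A
    by (rule rms_le_add[OF _ g add_pos_pos[OF p p'(1)] ge])
       (measurable, rule disagreement_nonneg,
        rule disagreement_step[OF S \<gamma> less_imp_le[OF pos(6)] X_Suc])
  have "rms_le (\<lambda>w. \<gamma> * \<beta> * disagreement (X ?k w) + (1 + \<gamma> * \<beta>) * norm (X ?k w - H (Suc ?k) w))
      (\<gamma> * \<beta> * a + (1 + \<gamma> * \<beta>) * (\<rho> * e))"
    by (rule rms_le_add[OF rms_le_cmult[OF a(1)] rms_le_cmult[OF y] p'(2,3)])
       (measurable, intro add_nonneg_nonneg an, rule order_refl)
  then show ?E
  proof (rule rms_le_add[OF _ g add_pos_pos[OF p'(2,3)] ge])
    fix w assume "w \<in> space M"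
    show "norm (X (Suc ?k) w - H (Suc ?k) w) \<le> \<gamma> * \<beta> * disagreement (X ?k w)
        + (1 + \<gamma> * \<beta>) * norm (X ?k w - H (Suc ?k) w) + \<eta> ?k * norm (probe (draws ?k w) (X ?k w))"
      by (rule estimate_error_step[OF S \<gamma> less_imp_le[OF pos(6)] X_Suc]) (rule X_Suc_in_S)
  qed simp_all
qed

lemma second_moment_start:
  "rms_le (\<lambda>w. disagreement (X 1 w)) (3 * (sqrt (real CARD('n)) * R))"
  "rms_le (\<lambda>w. norm (X 1 w - H 1 w)) (3 * (sqrt (real CARD('n)) * R))"
proof -
  define B where "B = sqrt (real CARD('n)) * R"
  have B: "0 < B" using pos(2) by (simp add: B_def)
  have XB: "norm (X k w) \<le> B" for k w unfolding B_def by (rule norm_X)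
  have dB: "\<bar>disagreement (X 1 w)\<bar> \<le> 3 * B" for w
    using disagreement_le_norm[of "X 1 w"] XB[of 1 w] B disagreement_nonneg[of "X 1 w"] by linarith
  show "rms_le (\<lambda>w. disagreement (X 1 w)) (3 * (sqrt (real CARD('n)) * R))"
    unfolding B_def[symmetric] by (rule rms_le_const[OF _ dB]) measurable
  have "rms_le (\<lambda>w. norm (X 0 w - H 0 w)) B"
    by (rule rms_le_const) (simp_all add: H_0 XB)
  then have "rms_le (\<lambda>w. norm (X 0 w - H (Suc 0) w)) (\<rho> * B)"
    by (rule estimate_error_contraction) (use B in simp)
  then have y: "rms_le (\<lambda>w. norm (X 0 w - H 1 w)) B"
    unfolding One_nat_def
    by (rule rms_le_weaken) (use \<rho>(1,2) B in \<open>simp_all add: mult_left_le_one_le\<close>)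
  have "\<bar>norm (X 1 w - X 0 w)\<bar> \<le> 2 * B" for w
    using norm_triangle_ineq4[of "X 1 w" "X 0 w"] XB[of 1 w] XB[of 0 w] by simp
  then have d: "rms_le (\<lambda>w. norm (X 1 w - X 0 w)) (2 * B)"
    by (intro rms_le_const) simp_all
  have "rms_le (\<lambda>w. norm (X 1 w - H 1 w)) (2 * B + B)"
  proof (rule rms_le_add[OF d y])
    show "norm (X 1 w - H 1 w) \<le> norm (X 1 w - X 0 w) + norm (X 0 w - H 1 w)" for w
      using norm_triangle_ineq[of "X 1 w - X 0 w" "X 0 w - H 1 w"] by simp
  qed (use B in simp_all)
  then show "rms_le (\<lambda>w. norm (X 1 w - H 1 w)) (3 * (sqrt (real CARD('n)) * R))"
    unfolding B_def[symmetric] by simp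
qed

section \<open>Expected descent\<close>

abbreviation f where "f \<equiv> local_objective P F"

lemma local_objective_lipschitz: "L-lipschitz_on UNIV (f i)"
proof (rule lipschitz_onI)
  interpret Pi: prob_space "P i" by (rule P_prob)
  fix x y
  have "\<bar>f i x - f i y\<bar> = \<bar>\<integral>s. F i x s - F i y s \<partial>P i\<bar>"
    unfolding local_objective_def by (subst Bochner_Integration.integral_diff[OF F_integrable F_integrable]) simp
  also have "\<dots> \<le> (\<integral>s. \<bar>F i x s - F i y s\<bar> \<partial>P i)" by (rule integral_abs_bound)
  also have "\<dots> \<le> (\<integral>s. L * dist x y \<partial>P i)"
    using lipschitz_onD[OF F_lipschitz, of _ i x y]
    by (intro integral_mono integrable_abs Bochner_Integration.integrable_diff F_integrable)
       (auto simp: dist_real_def)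
  finally show "dist (f i x) (f i y) \<le> L * dist x y"
    by (simp add: dist_real_def Pi.prob_space)
qed (use pos(1) in simp)

lemma local_objective_measurable [measurable]: "f i \<in> borel_measurable borel"
  by (intro borel_measurable_continuous_onI lipschitz_on_continuous_on[OF local_objective_lipschitz])

text \<open>
  Averaging over the sample turns the sampled objective in the two-point estimate into the expected one, to which the
  sphere inequality applies.
\<close>

lemma probe_gradient:
  assumes x: "x \<in> S" and z: "z \<in> S"
  shows "f i x - f i z - 2 * \<mu> * L
    \<le> (\<integral>\<tau>. (x - z) \<bullet> zo i x \<tau> \<partial>noise (i, k))"
proof -
  let ?U = "uniform_sphere :: 'v measure"
  let ?g = "\<lambda>u s. (x - z) \<bullet> zo_gradient (F i) \<mu> x u s"
  interpret U: prob_space ?U by (rule prob_space_uniform_sphere)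
  interpret PQ: pair_prob_space "P i" Q by (rule pair_prob_spaceI[OF P_prob prob_space_Q])
  interpret UPQ: pair_prob_space ?U "P i \<Otimes>\<^sub>M Q" by (rule pair_prob_spaceI[OF prob_space_uniform_sphere prob_space_P_Q])
  have gm: "(\<lambda>\<tau>. ?g (fst \<tau>) (fst (snd \<tau>))) \<in> borel_measurable (?U \<Otimes>\<^sub>M (P i \<Otimes>\<^sub>M Q))"
    by (intro borel_measurable_inner borel_measurable_const zo_gradient_compose) simp_all
  have gb: "\<bar>?g (fst \<tau>) (fst (snd \<tau>))\<bar> \<le> norm (x - z) * (real DIM('v) * L)"
    if "\<tau> \<in> space (?U \<Otimes>\<^sub>M (P i \<Otimes>\<^sub>M Q))" for \<tau>
  proof -
    have "norm (zo i x \<tau>) \<le> real DIM('v) * L"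
      using that by (intro zo_gradient_bound[where k=k]) simp
    then show ?thesis
      by (intro order_trans[OF Cauchy_Schwarz_ineq2] mult_left_mono) simp_all
  qed
  have gi: "integrable (?U \<Otimes>\<^sub>M (P i \<Otimes>\<^sub>M Q)) (\<lambda>\<tau>. ?g (fst \<tau>) (fst (snd \<tau>)))"
    by (rule UPQ.P.integrable_const_bound[OF AE_I2 gm]) (use gb in simp)
  have inner: "(\<integral>y. ?g u (fst y) \<partial>(P i \<Otimes>\<^sub>M Q)) = real DIM('v) / \<mu> * (f i (x + \<mu> *\<^sub>R u) - f i x) * (u \<bullet> (x - z))"
    if u: "u \<in> space ?U" for u
  proof -
    have m: "(\<lambda>y. ?g u (fst y)) \<in> borel_measurable (P i \<Otimes>\<^sub>M Q)"
      using measurable_compose[OF measurable_Pair1'[OF u] gm] by simp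
    have "integrable (P i \<Otimes>\<^sub>M Q) (\<lambda>y. ?g u (fst y))"
    proof (rule PQ.P.integrable_const_bound[OF AE_I2 m])
      fix y assume "y \<in> space (P i \<Otimes>\<^sub>M Q)"
      then show "norm (?g u (fst y)) \<le> norm (x - z) * (real DIM('v) * L)"
        using gb[of "(u, y)"] u by (simp add: space_pair_measure)
    qed
    from PQ.integral_fst'[OF this]
    have "(\<integral>y. ?g u (fst y) \<partial>(P i \<Otimes>\<^sub>M Q)) = (\<integral>s. ?g u s \<partial>P i)"
      using prob_space.prob_space[OF prob_space_Q] by simp
    also have "\<dots> = (\<integral>s. real DIM('v) / \<mu> * (u \<bullet> (x - z)) * (F i (x + \<mu> *\<^sub>R u) s - F i x s) \<partial>P i)"
      by (simp add: zo_gradient_def inner_commute mult_ac)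
    also have "\<dots> = real DIM('v) / \<mu> * (u \<bullet> (x - z)) * (f i (x + \<mu> *\<^sub>R u) - f i x)"
      unfolding local_objective_def
      by (subst integral_mult_right_zero) (simp add: Bochner_Integration.integral_diff[OF F_integrable F_integrable])
    finally show ?thesis by (simp add: mult_ac)
  qed
  have "f i x - f i z - 2 * \<mu> * L
      \<le> (\<integral>u. real DIM('v) / \<mu> * (f i (x + \<mu> *\<^sub>R u) - f i x) * (u \<bullet> (x - z)) \<partial>?U)"
    by (rule sphere_gradient[OF local_objective_lipschitz objective_convex S_margin[OF x] S_margin[OF z] pos(3)])
  also have "\<dots> = (\<integral>u. \<integral>y. ?g u (fst y) \<partial>(P i \<Otimes>\<^sub>M Q) \<partial>?U)"
    by (rule Bochner_Integration.integral_cong[OF refl]) (simp only: inner)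
  also have "\<dots> = (\<integral>\<tau>. ?g (fst \<tau>) (fst (snd \<tau>)) \<partial>(?U \<Otimes>\<^sub>M (P i \<Otimes>\<^sub>M Q)))"
    using UPQ.integral_fst'[OF gi] by simp
  finally show ?thesis by simp
qed

lemma integrable_local_objective: "integrable M (\<lambda>w. f i (X k w $ i))"
proof (rule integrable_const_bound[OF AE_I2])
  fix w
  have "\<bar>f i (X k w $ i) - f i 0\<bar> \<le> L * norm (X k w $ i)"
    using lipschitz_onD[OF local_objective_lipschitz, of "X k w $ i" 0 i] by (simp add: dist_norm)
  also have "\<dots> \<le> L * R" using X_bounded pos(1) by (intro mult_left_mono) simp_all
  finally show "norm (f i (X k w $ i)) \<le> \<bar>f i 0\<bar> + L * R" by simp
qed measurable

lemma expected_inner_product: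
  assumes z: "z \<in> S"
  shows "integrable M (\<lambda>w. (X (Suc k) w - vec z) \<bullet> probe (draws (Suc k) w) (X (Suc k) w))"
    and "(\<Sum>i\<in>UNIV. (\<integral>w. f i (X (Suc k) w $ i) \<partial>M) - f i z - 2 * \<mu> * L)
      \<le> (\<integral>w. (X (Suc k) w - vec z) \<bullet> probe (draws (Suc k) w) (X (Suc k) w) \<partial>M)"
proof -
  let ?k = "Suc k"
  let ?g = "\<lambda>i w. (X ?k w $ i - z) \<bullet> zo i (X ?k w $ i) (draw (i, ?k) w)"
  have zR: "norm z \<le> R" using z S_bounded by auto
  have step: "integrable M (?g i)" "(\<integral>w. f i (X ?k w $ i) \<partial>M) - f i z - 2 * \<mu> * L
      \<le> (\<integral>w. ?g i w \<partial>M)" for i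
  proof -
    let ?h = "\<lambda>p :: (('v^'n) \<times> ('v^'n)) \<times> ('v \<times> 's \<times> 'z).
      (fst (fst p) $ i - z) \<bullet> zo i (fst (fst p) $ i) (snd p)"
    have X1: "(\<lambda>p :: (('v^'n) \<times> ('v^'n)) \<times> ('v \<times> 's \<times> 'z). fst (fst p) $ i) \<in> borel_measurable ((borel \<Otimes>\<^sub>M borel) \<Otimes>\<^sub>M noise (i, ?k))"
      by measurable
    have hm: "?h \<in> borel_measurable ((borel \<Otimes>\<^sub>M borel) \<Otimes>\<^sub>M noise (i, ?k))"
    proof (rule borel_measurable_inner[OF borel_measurable_diff[OF X1 borel_measurable_const] zo_gradient_compose[OF X1]])
      show "snd \<in> (borel \<Otimes>\<^sub>M borel) \<Otimes>\<^sub>M noise (i, ?k) \<rightarrow>\<^sub>M uniform_sphere \<Otimes>\<^sub>M (P i \<Otimes>\<^sub>M Q)"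
        unfolding fst_conv by (rule measurable_snd)
    qed
    have m: "(\<lambda>w. ((X ?k w, H ?k w), draw (i, ?k) w)) \<in> M \<rightarrow>\<^sub>M (borel \<Otimes>\<^sub>M borel) \<Otimes>\<^sub>M noise (i, ?k)"
      by (intro measurable_Pair state_random draw_measurable)
    show gi: "integrable M (?g i)"
    proof (rule integrable_const_bound[OF AE_I2])
      fix w assume "w \<in> space M"
      then have 1: "norm (zo i (X ?k w $ i) (draw (i, ?k) w)) \<le> real DIM('v) * L"
        by (intro zo_gradient_bound[where k="?k"] draw_space)
      have 2: "norm (X ?k w $ i - z) \<le> 2 * R"
        using norm_triangle_ineq4[of "X ?k w $ i" z] X_bounded[of ?k w i] zR by simp
      have "norm (?g i w) \<le> norm (X ?k w $ i - z) * norm (zo i (X ?k w $ i) (draw (i, ?k) w))"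
        unfolding real_norm_def by (rule Cauchy_Schwarz_ineq2)
      also have "\<dots> \<le> 2 * R * (real DIM('v) * L)"
        using pos by (intro mult_mono 1 2) simp_all
      finally show "norm (?g i w) \<le> 2 * R * (real DIM('v) * L)" .
    next
      show "?g i \<in> borel_measurable M" using measurable_compose[OF m hm] by simp
    qed
    have hint: "integrable M (\<lambda>w. ?h ((X ?k w, H ?k w), draw (i, ?k) w))" using gi by simp
    have "(\<integral>w. f i (X ?k w $ i) \<partial>M) - f i z - 2 * \<mu> * L
        = (\<integral>w. f i (X ?k w $ i) - f i z - 2 * \<mu> * L \<partial>M)"
      using integrable_local_objective[of i ?k] by (simp add: prob_space)
    also have "\<dots> \<le> (\<integral>w. (\<integral>\<tau>. ?h ((X ?k w, H ?k w), \<tau>) \<partial>noise (i, ?k)) \<partial>M)"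
    proof (rule integral_mono)
      show "integrable M (\<lambda>w. f i (X ?k w $ i) - f i z - 2 * \<mu> * L)"
        using integrable_local_objective[of i ?k] by simp
      show "integrable M (\<lambda>w. \<integral>\<tau>. ?h ((X ?k w, H ?k w), \<tau>) \<partial>noise (i, ?k))"
        by (rule expectation_fresh_draw(1)[OF hm hint])
      show "f i (X ?k w $ i) - f i z - 2 * \<mu> * L
          \<le> (\<integral>\<tau>. ?h ((X ?k w, H ?k w), \<tau>) \<partial>noise (i, ?k))" for w
        using probe_gradient[OF X_Suc_in_S z] by simp
    qed
    also have "\<dots> = (\<integral>w. ?h ((X ?k w, H ?k w), draw (i, ?k) w) \<partial>M)"
      by (rule expectation_fresh_draw(2)[OF hm hint, symmetric])
    finally show "(\<integral>w. f i (X ?k w $ i) \<partial>M) - f i z - 2 * \<mu> * L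
      \<le> (\<integral>w. ?g i w \<partial>M)" by simp
  qed
  have eq: "(X ?k w - vec z) \<bullet> probe (draws ?k w) (X ?k w) = (\<Sum>i\<in>UNIV. ?g i w)" for w
    by (simp add: inner_vec_def probe_def)
  show "integrable M (\<lambda>w. (X ?k w - vec z) \<bullet> probe (draws ?k w) (X ?k w))"
    unfolding eq by (intro Bochner_Integration.integrable_sum step)
  have "(\<Sum>i\<in>UNIV. (\<integral>w. f i (X ?k w $ i) \<partial>M) - f i z - 2 * \<mu> * L)
      \<le> (\<Sum>i\<in>UNIV. (\<integral>w. ?g i w \<partial>M))" by (intro sum_mono step)
  also have "\<dots> = (\<integral>w. (\<Sum>i\<in>UNIV. ?g i w) \<partial>M)"
    by (rule Bochner_Integration.integral_sum[symmetric]) (rule step)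
  finally show "(\<Sum>i\<in>UNIV. (\<integral>w. f i (X ?k w $ i) \<partial>M) - f i z - 2 * \<mu> * L)
      \<le> (\<integral>w. (X ?k w - vec z) \<bullet> probe (draws ?k w) (X ?k w) \<partial>M)" unfolding eq .
qed

lemma objective_at_mean_le:
  "real CARD('n) * objective P F (mean Y)
     \<le> (\<Sum>i\<in>UNIV. f i (Y $ i)) + L * sqrt (real CARD('n)) * disagreement Y"
proof -
  have "(\<Sum>i\<in>UNIV. f i (mean Y)) \<le> (\<Sum>i\<in>UNIV. f i (Y $ i) + L * norm ((Y - vec (mean Y)) $ i))"
  proof (rule sum_mono)
    fix i
    show "f i (mean Y) \<le> f i (Y $ i) + L * norm ((Y - vec (mean Y)) $ i)"
      using lipschitz_onD[OF local_objective_lipschitz, of "mean Y" "Y $ i" i]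
      by (simp add: dist_norm norm_minus_commute)
  qed
  also have "\<dots> = (\<Sum>i\<in>UNIV. f i (Y $ i)) + L * (\<Sum>i\<in>UNIV. norm ((Y - vec (mean Y)) $ i))"
    by (simp add: sum.distrib sum_distrib_left)
  also have "(\<Sum>i\<in>UNIV. norm ((Y - vec (mean Y)) $ i)) \<le> sqrt (real CARD('n)) * disagreement Y"
    using L2_set_mult_ineq[of "\<lambda>_. 1" "\<lambda>i. norm ((Y - vec (mean Y)) $ i)" "UNIV :: 'n set"]
    unfolding disagreement_def norm_vec_def[of "Y - vec (mean Y)"] by (simp add: L2_set_def)
  finally show ?thesis using pos(1) by (simp add: objective_def mult.assoc)
qed

definition mean_distance :: "'v \<Rightarrow> nat \<Rightarrow> real" where
  "mean_distance z k = (\<integral>w. (norm (X k w - vec z))\<^sup>2 \<partial>M)"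

lemma norm_X_diff:
  assumes "z \<in> S" shows "norm (X k w - vec z) \<le> sqrt (real CARD('n)) * (2 * R)"
proof (rule norm_vec_uniform_bound)
  have "norm z \<le> R" using assms S_bounded by auto
  then show "norm ((X k w - vec z) $ i) \<le> 2 * R" for i
    using norm_triangle_ineq4[of "X k w $ i" z] X_bounded[of k w i] by simp
qed (use pos(2) in simp)

lemma mean_distance_integrable:
  assumes "z \<in> S" shows "integrable M (\<lambda>w. (norm (X k w - vec z))\<^sup>2)"
proof (rule integrable_const_bound[OF AE_I2])
  show "norm ((norm (X k w - vec z))\<^sup>2) \<le> (sqrt (real CARD('n)) * (2 * R))\<^sup>2" for w
    using power_mono[OF norm_X_diff[OF assms] norm_ge_zero, of k w 2] by simp
qed measurable

lemma mean_distance_bounds: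
  assumes "z \<in> S"
  shows "0 \<le> mean_distance z k" "mean_distance z k \<le> 4 * real CARD('n) * R\<^sup>2"
proof -
  show "0 \<le> mean_distance z k" by (simp add: mean_distance_def)
  have "mean_distance z k \<le> (\<integral>w. (sqrt (real CARD('n)) * (2 * R))\<^sup>2 \<partial>M)"
    unfolding mean_distance_def
    by (intro integral_mono mean_distance_integrable assms power_mono norm_X_diff) simp_all
  then show "mean_distance z k \<le> 4 * real CARD('n) * R\<^sup>2"
    by (simp add: prob_space power_mult_distrib)
qed

text \<open>
  Expectation of the distance bound, with the inner product replaced by a gap of objective values. The sum of the local
  objectives at the separate iterates is compared with the objective at their mean, at a cost proportional to the
  disagreement.
\<close>

lemma expected_step:
  assumes z: "z \<in> S"
    and a: "rms_le (\<lambda>w. disagreement (X (Suc k) w)) a" "0 < a"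
    and e: "rms_le (\<lambda>w. norm (X (Suc k) w - H (Suc k) w)) e" "0 < e"
  shows "integrable M (\<lambda>w. objective P F (mean (X (Suc k) w)))"
    and "real CARD('n) * (\<integral>w. objective P F (mean (X (Suc k) w)) \<partial>M) - (\<Sum>i\<in>UNIV. f i z)
      \<le> (mean_distance z (Suc k) - mean_distance z (Suc (Suc k))) / (2 * \<eta> (Suc k))
        + (3 * \<gamma> * \<beta> + 4 * \<gamma>\<^sup>2 * \<beta>\<^sup>2) * (a\<^sup>2 + e\<^sup>2) / (2 * \<eta> (Suc k)) + \<eta> (Suc k) * G\<^sup>2
        + 2 * real CARD('n) * \<mu> * L + L * sqrt (real CARD('n)) * a" (is ?step)
proof -
  let ?k = "Suc k" and ?n = "real CARD('n)"
  let ?K = "3 * \<gamma> * \<beta> + 4 * \<gamma>\<^sup>2 * \<beta>\<^sup>2"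
  let ?ip = "\<lambda>w. (X ?k w - vec z) \<bullet> probe (draws ?k w) (X ?k w)"
  have \<eta>: "0 < \<eta> ?k" by (rule pos(6))
  have \<gamma>: "0 \<le> \<gamma>" "\<gamma> \<le> 1" using pos(5) gamma_less by simp_all
  have K: "0 \<le> ?K" using \<gamma> laplacian_norm_pos by simp
  have y: "rms_le (\<lambda>w. norm (X ?k w - H (Suc ?k) w)) (\<rho> * e)"
    using e by (intro estimate_error_contraction) simp_all
  have y: "rms_le (\<lambda>w. norm (X ?k w - H (Suc ?k) w)) e"
    by (rule rms_le_weaken[OF y]) (use \<rho>(1,2) e(2) in \<open>simp_all add: mult_left_le_one_le\<close>)
  let ?A = "\<lambda>w. (disagreement (X ?k w))\<^sup>2" and ?Y = "\<lambda>w. (norm (X ?k w - H (Suc ?k) w))\<^sup>2"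
  have iA: "integrable M ?A" "(\<integral>w. ?A w \<partial>M) \<le> a\<^sup>2" and iY: "integrable M ?Y" "(\<integral>w. ?Y w \<partial>M) \<le> e\<^sup>2"
    using a y by (simp_all add: rms_le_def)
  have "2 * \<eta> ?k * (\<integral>w. ?ip w \<partial>M) = (\<integral>w. 2 * \<eta> ?k * ?ip w \<partial>M)" by simp
  also have "\<dots> \<le> (\<integral>w. (norm (X ?k w - vec z))\<^sup>2 - (norm (X (Suc ?k) w - vec z))\<^sup>2
      + ?K * (?A w + ?Y w) + 2 * (\<eta> ?k)\<^sup>2 * G\<^sup>2 \<partial>M)"
  proof (rule integral_mono)
    show "integrable M (\<lambda>w. 2 * \<eta> ?k * ?ip w)" using expected_inner_product(1)[OF z] by simp
    show "integrable M (\<lambda>w. (norm (X ?k w - vec z))\<^sup>2 - (norm (X (Suc ?k) w - vec z))\<^sup>2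
      + ?K * (?A w + ?Y w) + 2 * (\<eta> ?k)\<^sup>2 * G\<^sup>2)"
      by (intro Bochner_Integration.integrable_add Bochner_Integration.integrable_diff integrable_mult_right
          mean_distance_integrable z iA iY) simp
    fix w assume w: "w \<in> space M"
    have "2 * (\<eta> ?k)\<^sup>2 * (norm (probe (draws ?k w) (X ?k w)))\<^sup>2 \<le> 2 * (\<eta> ?k)\<^sup>2 * G\<^sup>2"
      using norm_probe[OF w] by (intro mult_left_mono power_mono) simp_all
    then show "2 * \<eta> ?k * ?ip w \<le> (norm (X ?k w - vec z))\<^sup>2 - (norm (X (Suc ?k) w - vec z))\<^sup>2
      + ?K * (?A w + ?Y w) + 2 * (\<eta> ?k)\<^sup>2 * G\<^sup>2"
      using distance_step[OF S \<gamma> less_imp_le[OF \<eta>] X_Suc z] by (rule order_trans[rotated, OF add_left_mono])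
  qed
  also have "\<dots> = mean_distance z ?k - mean_distance z (Suc ?k)
      + ?K * ((\<integral>w. ?A w \<partial>M) + (\<integral>w. ?Y w \<partial>M)) + 2 * (\<eta> ?k)\<^sup>2 * G\<^sup>2"
    using iA(1) iY(1) mean_distance_integrable[OF z] by (simp add: mean_distance_def prob_space)
  also have "\<dots> \<le> mean_distance z ?k - mean_distance z (Suc ?k) + ?K * (a\<^sup>2 + e\<^sup>2) + 2 * (\<eta> ?k)\<^sup>2 * G\<^sup>2"
    by (intro add_mono order_refl mult_left_mono iA iY K)
  finally have "(\<integral>w. ?ip w \<partial>M) \<le> (mean_distance z ?k - mean_distance z (Suc ?k) + ?K * (a\<^sup>2 + e\<^sup>2) + 2 * (\<eta> ?k)\<^sup>2 * G\<^sup>2) / (2 * \<eta> ?k)"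
    using \<eta> by (simp add: pos_le_divide_eq mult.commute)
  also have "\<dots> = (mean_distance z ?k - mean_distance z (Suc ?k)) / (2 * \<eta> ?k) + ?K * (a\<^sup>2 + e\<^sup>2) / (2 * \<eta> ?k) + \<eta> ?k * G\<^sup>2"
    using \<eta> by (simp add: add_divide_distrib power2_eq_square)
  finally have ip: "(\<integral>w. ?ip w \<partial>M) \<le> \<dots>" .
  have objective_sum: "?n * objective P F x = (\<Sum>i\<in>UNIV. f i x)" for x
    by (simp add: objective_def)
  show obj: "integrable M (\<lambda>w. objective P F (mean (X ?k w)))"
  proof (rule integrable_const_bound[OF AE_I2])
    fix w
    have mR: "norm (mean (X ?k w)) \<le> R"
    proof -
      have "norm (mean (X ?k w)) \<le> (\<Sum>i\<in>UNIV. norm (X ?k w $ i)) / ?n"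
        by (simp add: mean_def divide_right_mono norm_sum)
      also have "\<dots> \<le> (\<Sum>i\<in>(UNIV :: 'n set). R) / ?n" by (intro divide_right_mono sum_mono X_bounded) simp
      finally show ?thesis by simp
    qed
    have "\<bar>f i (mean (X ?k w))\<bar> \<le> \<bar>f i 0\<bar> + L * R" for i
    proof -
      have "\<bar>f i (mean (X ?k w)) - f i 0\<bar> \<le> L * norm (mean (X ?k w))"
        using lipschitz_onD[OF local_objective_lipschitz, of "mean (X ?k w)" 0 i] by (simp add: dist_norm)
      also have "\<dots> \<le> L * R" using mR pos(1) by (intro mult_left_mono) simp_all
      finally show ?thesis by linarith
    qed
    then have "\<bar>\<Sum>i\<in>UNIV. f i (mean (X ?k w))\<bar> \<le> (\<Sum>i\<in>UNIV. \<bar>f i 0\<bar> + L * R)"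
      by (intro order_trans[OF sum_abs] sum_mono)
    then show "norm (objective P F (mean (X ?k w))) \<le> (\<Sum>i\<in>UNIV. \<bar>f i 0\<bar> + L * R) / ?n"
      by (simp add: objective_def divide_right_mono)
  next
    show "(\<lambda>w. objective P F (mean (X ?k w))) \<in> borel_measurable M"
      unfolding objective_def mean_def by measurable
  qed
  have "?n * (\<integral>w. objective P F (mean (X ?k w)) \<partial>M) = (\<integral>w. ?n * objective P F (mean (X ?k w)) \<partial>M)" by simp
  also have "\<dots> \<le> (\<integral>w. (\<Sum>i\<in>UNIV. f i (X ?k w $ i)) + L * sqrt ?n * disagreement (X ?k w) \<partial>M)"
    using obj rms_le_expectation(1)[OF a(1) _ a(2)]
    by (intro integral_mono objective_at_mean_le integrable_mult_right Bochner_Integration.integrable_add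
        Bochner_Integration.integrable_sum integrable_local_objective) measurable
  also have "\<dots> = (\<Sum>i\<in>UNIV. (\<integral>w. f i (X ?k w $ i) \<partial>M)) + L * sqrt ?n * (\<integral>w. disagreement (X ?k w) \<partial>M)"
    using rms_le_expectation(1)[OF a(1) _ a(2)] integrable_local_objective by simp
  also have "\<dots> \<le> (\<Sum>i\<in>UNIV. (\<integral>w. f i (X ?k w $ i) \<partial>M)) + L * sqrt ?n * a"
    using rms_le_expectation(2)[OF a(1) _ a(2)] pos(1) by (intro add_left_mono mult_left_mono) simp_all
  finally have "?n * (\<integral>w. objective P F (mean (X ?k w)) \<partial>M)
      \<le> (\<Sum>i\<in>UNIV. (\<integral>w. f i (X ?k w $ i) \<partial>M)) + L * sqrt ?n * a" .
  moreover have "(\<Sum>i\<in>UNIV. (\<integral>w. f i (X ?k w $ i) \<partial>M)) - (\<Sum>i\<in>UNIV. f i z)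
      - 2 * ?n * \<mu> * L \<le> (\<integral>w. ?ip w \<partial>M)"
    using expected_inner_product(2)[OF z, of k] by (simp add: sum_subtractf mult.assoc mult.left_commute)
  ultimately show ?step
    using ip by linarith
qed

section \<open>Regret of the algorithm\<close>

text \<open>
  Two invariants identify the algorithm with the reduced process: the mismatch is the Laplacian of the estimates, as
  both start from zero and the increment of the former is the Laplacian of that of the latter; and every query lies in
  \<open>K\<close>, where the two families of sampled objectives agree.
\<close>

lemma com_dszo_eq:
  assumes agree: "\<And>i x s. x \<in> K \<Longrightarrow> s \<in> space (P i) \<Longrightarrow> F0 i x s = F i x s"
    and start: "\<And>i. cball (x0 i) \<mu> \<subseteq> K" and S_eq: "S = shrunk \<epsilon> \<Omega>" and w: "w \<in> space M"
  shows "com_dszo E W F0 C \<Omega> \<eta> \<mu> \<epsilon> \<psi> \<gamma> x0 (\<lambda>i k. u i k w) (\<lambda>i k. \<xi> i k w) (\<lambda>i k. \<zeta> i k w) k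
    = \<lparr> iterate = (\<lambda>i. X k w $ i), estimate = (\<lambda>i. H k w $ i), mismatch = (\<lambda>i. laplacian (H k w) $ i),
        message = (\<lambda>i. C (X k w $ i - H k w $ i) (\<zeta> i k w)) \<rparr>"
proof (induction k)
  case 0
  have "laplacian (0 :: 'v^'n) = 0" using laplacian_diff[of "0 :: 'v^'n" 0] by simp
  then show ?case by (simp add: X_0 H_0)
next
  case (Suc k)
  have zo: "zo_gradient (F0 i) \<mu> (X k w $ i) (u i k w) (\<xi> i k w) = probe (draws k w) (X k w) $ i" for i
  proof -
    have d: "draw (i, k) w \<in> space (noise (i, k))" by (rule draw_space[OF w])
    then have s: "\<xi> i k w \<in> space (P i)" by (simp add: draw_def space_pair_measure)
    have n: "norm (u i k w) = 1" using noise_sphere[OF d] by (simp add: draw_def)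
    have sub: "cball (X k w $ i) \<mu> \<subseteq> K"
    proof (cases k)
      case 0
      then show ?thesis using start by (simp add: X_0)
    next
      case (Suc m)
      then show ?thesis using S_margin[OF X_Suc_in_S] by simp
    qed
    have "X k w $ i \<in> cball (X k w $ i) \<mu>" using pos(3) by simp
    moreover have "X k w $ i + \<mu> *\<^sub>R u i k w \<in> cball (X k w $ i) \<mu>" using pos(3) n by (simp add: dist_norm)
    ultimately show ?thesis
      using sub s by (simp add: zo_gradient_def probe_def draw_def agree subsetD)
  qed
  have h: "H k w $ i + \<psi> *\<^sub>R C (X k w $ i - H k w $ i) (\<zeta> i k w) = H (Suc k) w $ i" for i
    by (simp add: H_Suc refine_def draw_def)
  have q: "laplacian (H k w) $ i + \<psi> *\<^sub>R (C (X k w $ i - H k w $ i) (\<zeta> i k w)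
      - (\<Sum>j\<in>neighbours E i. W $ i $ j *\<^sub>R C (X k w $ j - H k w $ j) (\<zeta> j k w))) = laplacian (H (Suc k) w) $ i" for i
  proof -
    let ?q = "(\<chi> i. C (X k w $ i - H k w $ i) (\<zeta> i k w)) :: 'v^'n"
    have "H (Suc k) w = H k w + \<psi> *\<^sub>R ?q" by (simp add: H_Suc refine_def draw_def)
    then have "laplacian (H (Suc k) w) = laplacian (H k w) + \<psi> *\<^sub>R laplacian ?q"
      by (simp only: laplacian_add laplacian_scaleR)
    moreover have "laplacian ?q $ i = C (X k w $ i - H k w $ i) (\<zeta> i k w)
        - (\<Sum>j\<in>neighbours E i. W $ i $ j *\<^sub>R C (X k w $ j - H k w $ j) (\<zeta> j k w))"
      by (simp add: laplacian_def mix_def sum_neighbours)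
    ultimately show ?thesis by simp
  qed
  have x: "closest_point (shrunk \<epsilon> \<Omega>) (X k w $ i - \<gamma> *\<^sub>R laplacian (H (Suc k) w) $ i
      - \<eta> k *\<^sub>R probe (draws k w) (X k w) $ i) = X (Suc k) w $ i" for i
    by (simp only: X_Suc project_def vec_lambda_beta vector_minus_component vector_scaleR_component S_eq[symmetric])
  show ?case
    by (simp add: Suc.IH Let_def zo h q x)
qed

lemma error_bounds_valid:
  defines "b \<equiv> error_bounds \<gamma> \<delta> \<beta> \<rho> (\<lambda>k. \<eta> k * G) (3 * (sqrt (real CARD('n)) * R))"
  shows "0 < fst (b k)" "0 < snd (b k)"
    "rms_le (\<lambda>w. disagreement (X (Suc k) w)) (fst (b k))"
    "rms_le (\<lambda>w. norm (X (Suc k) w - H (Suc k) w)) (snd (b k))"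
proof -
  have "0 < fst (b k) \<and> 0 < snd (b k) \<and> rms_le (\<lambda>w. disagreement (X (Suc k) w)) (fst (b k))
    \<and> rms_le (\<lambda>w. norm (X (Suc k) w - H (Suc k) w)) (snd (b k))"
  proof (induction k)
    case 0
    then show ?case using pos(2) second_moment_start by (simp add: b_def)
  next
    case (Suc k)
    define a e where "a = fst (b k)" and "e = snd (b k)"
    have IH: "0 < a" "0 < e" "rms_le (\<lambda>w. disagreement (X (Suc k) w)) a"
      "rms_le (\<lambda>w. norm (X (Suc k) w - H (Suc k) w)) e" using Suc by (simp_all add: a_def e_def)
    have b: "b (Suc k) = ((1 - \<gamma> * \<delta>) * a + \<gamma> * \<beta> * (\<rho> * e) + \<eta> (Suc k) * G,
        \<gamma> * \<beta> * a + (1 + \<gamma> * \<beta>) * (\<rho> * e) + \<eta> (Suc k) * G)"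
      by (simp add: b_def a_def e_def Let_def)
    have gd: "\<gamma> * \<delta> < 1"
      using mult_left_mono[OF gap(2) less_imp_le[OF pos(5)]] gamma_less by simp
    have p: "0 < (1 - \<gamma> * \<delta>) * a" using gd IH(1) by (intro mult_pos_pos) simp_all
    have p': "0 < \<gamma> * \<beta> * (\<rho> * e)" "0 < \<gamma> * \<beta> * a" "0 < (1 + \<gamma> * \<beta>) * (\<rho> * e)" "0 < \<eta> (Suc k) * G"
      by (intro mult_pos_pos add_pos_pos laplacian_norm_pos pos(5,6) IH \<rho>(1) G_pos zero_less_one)+
    show ?case
      unfolding b fst_conv snd_conv
      by (intro conjI add_pos_pos p p' second_moment_step IH)
  qed
  then show "0 < fst (b k)" "0 < snd (b k)"
    "rms_le (\<lambda>w. disagreement (X (Suc k) w)) (fst (b k))"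
    "rms_le (\<lambda>w. norm (X (Suc k) w - H (Suc k) w)) (snd (b k))" by auto
qed

text \<open>
  \<open>V\<close> stands for the contracting combination of the two error bounds. Its first power, which comes from comparing
  the iterates with their mean, is reduced to its weighted square and \<open>1 / \<surd>(k + c)\<close> by the inequality of
  arithmetic and geometric means.
\<close>

lemma summed_regret:
  fixes V :: "nat \<Rightarrow> real"
  defines "b \<equiv> error_bounds \<gamma> \<delta> \<beta> \<rho> (\<lambda>k. \<eta> k * G) (3 * (sqrt (real CARD('n)) * R))"
    and "K1 \<equiv> 3 * \<gamma> * \<beta> + 4 * \<gamma>\<^sup>2 * \<beta>\<^sup>2"
  assumes z: "z \<in> S" and m: "0 < m" and c: "0 \<le> c" and \<eta>: "\<And>k. \<eta> k = m / sqrt (real k + c)"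
    and V: "\<And>k. fst (b k) \<le> V (Suc k)" "\<And>k. snd (b k) \<le> v * V (Suc k)"
  shows "real CARD('n) * (\<Sum>k=1..T. \<integral>w. objective P F (mean (X k w)) \<partial>M) - real T * (\<Sum>i\<in>UNIV. f i z)
      \<le> 2 * real CARD('n) * R\<^sup>2 / m * sqrt (real T + c)
        + (K1 * (1 + v\<^sup>2) / (2 * m) + L * sqrt (real CARD('n)) / 2) * (\<Sum>k=1..T. sqrt (real k + c) * (V k)\<^sup>2)
        + (m * G\<^sup>2 + L * sqrt (real CARD('n)) / 2) * (2 * sqrt (real T))
        + 2 * real CARD('n) * L * (real T * \<mu>)"
proof -
  let ?n = "real CARD('n)" and ?w = "\<lambda>k. sqrt (real k + c)" and ?D = "mean_distance z"
  let ?p = "K1 * (1 + v\<^sup>2) / (2 * m) + L * sqrt ?n / 2" and ?q = "m * G\<^sup>2 + L * sqrt ?n / 2"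
  let ?f = "\<Sum>i\<in>UNIV. f i z"
  have K1: "0 \<le> K1" using laplacian_norm_pos pos(5) by (simp add: K1_def)
  have step: "?n * (\<integral>w. objective P F (mean (X k w)) \<partial>M) - ?f
      \<le> 1 / (2 * m) * (?w k * (?D k - ?D (Suc k))) + ?p * (?w k * (V k)\<^sup>2)
        + ?q * (1 / ?w k) + 2 * ?n * L * \<mu>" if "k \<in> {1..T}" for k
  proof -
    have "1 \<le> k" using that by simp
    then obtain j where k: "k = Suc j" by (cases k) auto
    have w: "0 < ?w k" using k c by simp
    let ?a = "fst (b j)" and ?e = "snd (b j)"
    have ae: "0 < ?a" "0 < ?e" unfolding b_def by (rule error_bounds_valid)+
    have "?n * (\<integral>w. objective P F (mean (X k w)) \<partial>M) - ?f
        \<le> (?D k - ?D (Suc k)) / (2 * \<eta> k) + K1 * (?a\<^sup>2 + ?e\<^sup>2) / (2 * \<eta> k) + \<eta> k * G\<^sup>2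
          + 2 * ?n * \<mu> * L + L * sqrt ?n * ?a"
      unfolding k K1_def b_def
      by (rule expected_step(2)[OF z error_bounds_valid(3,1,4,2)])
    moreover have "(?D k - ?D (Suc k)) / (2 * \<eta> k) = 1 / (2 * m) * (?w k * (?D k - ?D (Suc k)))"
      using w m by (simp add: \<eta>)
    moreover have "\<eta> k * G\<^sup>2 = m * G\<^sup>2 * (1 / ?w k)" by (simp add: \<eta>)
    moreover have "K1 * (?a\<^sup>2 + ?e\<^sup>2) / (2 * \<eta> k) \<le> K1 * (1 + v\<^sup>2) / (2 * m) * (?w k * (V k)\<^sup>2)"
    proof -
      have "?a\<^sup>2 \<le> (V k)\<^sup>2" "?e\<^sup>2 \<le> (v * V k)\<^sup>2"
        using ae V[of j] by (auto simp: k intro!: power_mono)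
      then have "?a\<^sup>2 + ?e\<^sup>2 \<le> (1 + v\<^sup>2) * (V k)\<^sup>2" by (simp add: power_mult_distrib algebra_simps)
      then have "K1 * (?a\<^sup>2 + ?e\<^sup>2) * (?w k / (2 * m)) \<le> K1 * ((1 + v\<^sup>2) * (V k)\<^sup>2) * (?w k / (2 * m))"
        using K1 w m by (intro mult_right_mono mult_left_mono) simp_all
      then show ?thesis by (simp add: \<eta> mult_ac)
    qed
    moreover have "L * sqrt ?n * ?a \<le> L * sqrt ?n / 2 * (?w k * (V k)\<^sup>2) + L * sqrt ?n / 2 * (1 / ?w k)"
    proof -
      have am: "p \<le> (t * p\<^sup>2 + 1 / t) / 2" if "0 < t" for p t :: real
      proof -
        have "(t * p - 1)\<^sup>2 / t = t * p\<^sup>2 - 2 * p + 1 / t"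
          using that by (simp add: field_simps power2_eq_square)
        moreover have "0 \<le> (t * p - 1)\<^sup>2 / t" using that by simp
        ultimately show ?thesis by simp
      qed
      note am[OF w, of "V k"]
      with V(1)[of j] have "?a \<le> (?w k * (V k)\<^sup>2 + 1 / ?w k) / 2" by (simp add: k)
      then have "L * sqrt ?n * ?a \<le> L * sqrt ?n * ((?w k * (V k)\<^sup>2 + 1 / ?w k) / 2)"
        using pos(1) by (intro mult_left_mono) simp_all
      also have "\<dots> = L * sqrt ?n / 2 * (?w k * (V k)\<^sup>2) + L * sqrt ?n / 2 * (1 / ?w k)"
        by (simp add: distrib_left add_divide_distrib)
      finally show ?thesis .
    qed
    moreover have "2 * ?n * \<mu> * L = 2 * ?n * L * \<mu>" by simp
    ultimately show ?thesis unfolding distrib_right by linarith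
  qed
  have "?n * (\<Sum>k=1..T. \<integral>w. objective P F (mean (X k w)) \<partial>M) - real T * ?f
      = (\<Sum>k=1..T. ?n * (\<integral>w. objective P F (mean (X k w)) \<partial>M) - ?f)"
    by (simp add: sum_subtractf sum_distrib_left)
  also have "\<dots> \<le> (\<Sum>k=1..T. 1 / (2 * m) * (?w k * (?D k - ?D (Suc k))) + ?p * (?w k * (V k)\<^sup>2)
        + ?q * (1 / ?w k) + 2 * ?n * L * \<mu>)"
    by (rule sum_mono) (rule step)
  also have "\<dots> = 1 / (2 * m) * (\<Sum>k=1..T. ?w k * (?D k - ?D (Suc k)))
      + ?p * (\<Sum>k=1..T. ?w k * (V k)\<^sup>2)
      + ?q * (\<Sum>k=1..T. 1 / ?w k) + 2 * ?n * L * (real T * \<mu>)"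
    by (simp add: sum.distrib sum_distrib_left)
  also have "\<dots> \<le> 1 / (2 * m) * (?w T * (4 * ?n * R\<^sup>2))
      + ?p * (\<Sum>k=1..T. ?w k * (V k)\<^sup>2)
      + ?q * (2 * sqrt (real T)) + 2 * ?n * L * (real T * \<mu>)"
    using m pos(1) c mean_distance_bounds[OF z]
    by (intro add_mono mult_left_mono order_refl weighted_telescope_le sum_inverse_sqrt_le) simp_all
  also have "1 / (2 * m) * (?w T * (4 * ?n * R\<^sup>2)) = 2 * ?n * R\<^sup>2 / m * ?w T" by simp
  finally show ?thesis .
qed

end

lemma shrunk_properties:
  fixes \<Omega> :: "'v::euclidean_space set"
  assumes "closed \<Omega>" "convex \<Omega>" "0 \<in> \<Omega>" "0 \<le> \<epsilon>" "\<epsilon> < 1"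
  shows "convex (shrunk \<epsilon> \<Omega>)" "closed (shrunk \<epsilon> \<Omega>)" "shrunk \<epsilon> \<Omega> \<noteq> {}" "shrunk \<epsilon> \<Omega> \<subseteq> \<Omega>"
proof -
  show "convex (shrunk \<epsilon> \<Omega>)" unfolding shrunk_def by (rule convex_scaling[OF assms(2)])
  show "closed (shrunk \<epsilon> \<Omega>)" unfolding shrunk_def by (rule closed_scaling[OF assms(1)])
  show "shrunk \<epsilon> \<Omega> \<noteq> {}" using assms(3) by (auto simp: shrunk_def)
  show "shrunk \<epsilon> \<Omega> \<subseteq> \<Omega>"
  proof
    fix y assume "y \<in> shrunk \<epsilon> \<Omega>"
    then obtain x where x: "x \<in> \<Omega>" "y = (1 - \<epsilon>) *\<^sub>R x" by (auto simp: shrunk_def)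
    have "(1 - \<epsilon>) *\<^sub>R x + \<epsilon> *\<^sub>R 0 \<in> \<Omega>"
      using assms x by (intro convexD) simp_all
    then show "y \<in> \<Omega>" using x by simp
  qed
qed

lemma network_average_eq_mean: "network_average \<lparr> iterate = (\<lambda>i. Y $ i), estimate = h, mismatch = b, message = q \<rparr> = mean Y"
  by (simp add: network_average_def mean_def)

theorem theorem1:
  fixes E :: "('n::finite \<times> 'n) set" and W :: "real^'n^'n"
    and \<Omega> U :: "(real^'d::finite) set"
    and P :: "'n \<Rightarrow> 's measure" and F :: "'n \<Rightarrow> real^'d \<Rightarrow> 's \<Rightarrow> real"
    and Q :: "'z measure" and C :: "real^'d \<Rightarrow> 'z \<Rightarrow> real^'d"
    and M :: "'w measure" and u :: "'n \<Rightarrow> nat \<Rightarrow> 'w \<Rightarrow> real^'d"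
    and \<xi> :: "'n \<Rightarrow> nat \<Rightarrow> 'w \<Rightarrow> 's" and \<zeta> :: "'n \<Rightarrow> nat \<Rightarrow> 'w \<Rightarrow> 'z"
    and x0 :: "nat \<Rightarrow> 'n \<Rightarrow> real^'d" and xstar :: "real^'d"
    and R_in R_out Lf \<sigma> r \<omega> Lm \<psi> \<gamma> c :: real
  defines "n \<equiv> real CARD('n)" and "d \<equiv> real CARD('d)"
    and "\<delta> \<equiv> spectral_gap W" and "\<beta> \<equiv> laplacian_norm W"
  defines "c0 \<equiv> const_c0 \<psi> r \<omega>"
  defines "\<kappa>0 \<equiv> const_\<kappa>0 \<psi> r \<omega> \<gamma> \<delta> \<beta>"
    and "\<kappa>3 \<equiv> n * d\<^sup>2 * Lf\<^sup>2 * const_C3 \<psi> r \<omega> \<gamma> \<delta>"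
    and "M1 \<equiv> (5 + 10 / n) * 4 * d * Lm"
  defines "\<mu> \<equiv> (\<lambda>T::nat. 1 / sqrt (real T))"
  defines "\<epsilon> \<equiv> (\<lambda>T::nat. \<mu> T / (2 * R_in))"
    and "\<eta> \<equiv> (\<lambda>k::nat. 1 / (M1 * sqrt (real k + c)))"
  defines "xbar \<equiv> (\<lambda>T k w. network_average (com_dszo E W F C \<Omega> \<eta> (\<mu> T) (\<epsilon> T) \<psi> \<gamma> (x0 T)
                      (\<lambda>i k. u i k w) (\<lambda>i k. \<xi> i k w) (\<lambda>i k. \<zeta> i k w) k))"
  assumes A1: "network_assumption E W"
    and A2: "constraint_assumption \<Omega> R_in R_out"
    and A3: "lipschitz_convex_assumption \<Omega> U P F Lf"
    and A4: "gradient_noise_assumption \<Omega> P F \<sigma>"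
    and A5: "compressor_assumption Q C r \<omega>"
    and A6: "smooth_assumption \<Omega> P F Lm"
    and fresh: "fresh_randomness M P Q u \<xi> \<zeta>"
    and init: "\<And>T i. x0 T i \<in> \<Omega>"
    and psi: "0 < \<psi>" "\<psi> \<le> 1 / r"
    and c: "c > 4"
    and gamma: "0 < \<gamma>" "\<gamma> < Min {1, \<delta> / const_\<kappa>1 c0 \<gamma> \<delta> \<beta>, c0 / const_\<kappa>2 c0 \<gamma> \<delta> \<beta>}"
    and optimal: "xstar \<in> \<Omega>" "\<And>x. x \<in> \<Omega> \<Longrightarrow> objective P F xstar \<le> objective P F x"
  shows "\<exists>e1 e2 e3 e4 e5 :: nat \<Rightarrow> real.
      e1 \<in> O(\<lambda>T. 1) \<and>
      e2 \<in> O(\<lambda>T. sqrt (real T)) \<and>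
      e3 \<in> O(\<lambda>T. 1 / real T) \<and>
      e4 \<in> O(\<lambda>T. 1 / sqrt (real T)) \<and>
      e5 \<in> O(\<lambda>T. \<kappa>3 / (1 - \<kappa>0) * (sqrt (real T + c) + ln (real T + c))) \<and>
      (\<forall>T\<ge>1. (\<Sum>k=1..T. (\<integral>w. (objective P F (xbar T k w) - objective P F xstar) \<partial>M))
               \<le> e1 T + e2 T + e3 T + e4 T + e5 T)"
proof -
  interpret Net: gossip E W by unfold_locales (rule A1)
  have \<Omega>: "closed \<Omega>" "convex \<Omega>" "cball 0 R_in \<subseteq> \<Omega>" "\<Omega> \<subseteq> cball 0 R_out" and Rin: "0 < R_in" and Rout: "0 < R_out"
    using A2 by (simp_all add: constraint_assumption_def)
  have zero: "0 \<in> \<Omega>" using \<Omega>(3) Rin by auto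
  have U: "open U" "\<Omega> \<subseteq> U" and Lf: "0 < Lf" and Pp: "\<And>i. prob_space (P i)"
    using A3 by (auto simp: lipschitz_convex_assumption_def)
  have Lm: "0 < Lm" using A6 by (simp add: smooth_assumption_def)
  have M: "prob_space M" using fresh by (simp add: fresh_randomness_def)
  have r\<omega>: "1 \<le> r" "0 < \<omega>" "\<omega> \<le> 1" using A5 by (simp_all add: compressor_assumption_def)
  have "U \<noteq> {}" using U zero by auto
  with A3 obtain F' where F': "\<And>i. (\<lambda>(x, s). F' i x s) \<in> borel_measurable (borel \<Otimes>\<^sub>M P i)"
    "\<And>i s. s \<in> space (P i) \<Longrightarrow> Lf-lipschitz_on UNIV (\<lambda>x. F' i x s)"
    "\<And>i x. integrable (P i) (F' i x)"
    "\<And>i x s. x \<in> U \<Longrightarrow> s \<in> space (P i) \<Longrightarrow> F' i x s = F i x s"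
    "\<And>i x. x \<in> U \<Longrightarrow> local_objective P F' i x = local_objective P F i x"
    "\<And>i. convex_on U (local_objective P F' i)"
    by (rule lipschitz_extension_exists) (rule that)
  have obj: "objective P F' x = objective P F x" if "x \<in> U" for x
    unfolding objective_def by (simp add: F'(5) that)

  have n: "1 \<le> n" "0 < n" unfolding n_def by (simp_all add: Suc_leI)
  have d: "0 < d" unfolding d_def by simp
  have M1: "0 < M1" using n d Lm unfolding M1_def by (simp add: add_pos_pos)
  define m where "m = 1 / M1"
  have m: "0 < m" using M1 by (simp add: m_def)
  have \<eta>_eq: "\<eta> k = m / sqrt (real k + c)" for k by (simp add: \<eta>_def m_def)
  have \<eta>_pos: "0 < \<eta> k" for k unfolding \<eta>_eq using m c by simp
  have c0: "0 < c0" "c0 \<le> 1"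
  proof -
    have "\<psi> * r \<le> 1" using psi r\<omega> by (simp add: pos_le_divide_eq)
    then have "\<psi> * r * \<omega> \<le> 1 * 1" using psi r\<omega> by (intro mult_mono) simp_all
    then show "0 < c0" "c0 \<le> 1" using psi r\<omega> by (simp_all add: c0_def const_c0_def)
  qed
  have \<delta>: "Net.\<delta> = \<delta>" and \<beta>: "Net.\<beta> = \<beta>" by (simp_all add: Net.\<delta>_def \<delta>_def Net.\<beta>_def \<beta>_def)
  have gapb: "0 < \<delta>" "\<delta> \<le> 1" "\<delta> \<le> \<beta>" "0 < \<beta>"
    using Net.gap Net.gap_le_laplacian_norm Net.laplacian_norm_pos unfolding \<delta> \<beta> by simp_all
  have \<gamma>1: "\<gamma> < 1" and \<gamma>2: "\<gamma> < c0 / const_\<kappa>2 c0 \<gamma> \<delta> \<beta>" using gamma(2) by simp_all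
  have "0 < const_\<kappa>2 c0 \<gamma> \<delta> \<beta>"
    using gamma(1) gapb unfolding const_\<kappa>2_def by (intro add_nonneg_pos mult_pos_pos) (simp_all add: add_pos_pos)
  with \<gamma>2 have small: "\<gamma> * const_\<kappa>2 c0 \<gamma> \<delta> \<beta> < c0" by (simp add: pos_less_divide_eq)
  define lam where "lam = \<delta> / (\<beta> * (1 + \<delta>))"
  have lam: "0 < lam" using gapb by (simp add: lam_def)
  obtain \<tau> where \<tau>: "0 < \<tau>" "\<tau> \<le> 1" and contract: "\<And>a e. 0 \<le> a \<Longrightarrow> 0 \<le> e \<Longrightarrow>
      ((1 - \<gamma> * \<delta>) * a + \<gamma> * \<beta> * ((1 - c0) * e)) + lam * (\<gamma> * \<beta> * a + (1 + \<gamma> * \<beta>) * ((1 - c0) * e))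
        \<le> (1 - \<tau>) * (a + lam * e)"
    using error_bounds_contraction[OF gamma(1) \<gamma>1 gapb(1,2,3) c0 small] unfolding lam_def by blast

  define G where "G = sqrt n * (d * Lf)"
  have G: "0 < G" using n d Lf by (simp add: G_def)
  define b where "b = error_bounds \<gamma> \<delta> \<beta> (1 - c0) (\<lambda>k. \<eta> k * G) (3 * (sqrt n * R_out))"
  have b_pos: "0 \<le> fst (b k) \<and> 0 \<le> snd (b k)" for k
  proof (induction k)
    case 0
    then show ?case using n Rout by (simp add: b_def)
  next
    case (Suc k)
    have gd: "\<gamma> * \<delta> \<le> 1" using gamma(1) \<gamma>1 gapb by (intro mult_le_one) simp_all
    have "0 \<le> (1 - \<gamma> * \<delta>) * fst (b k)" "0 \<le> \<gamma> * \<beta> * ((1 - c0) * snd (b k))"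
      "0 \<le> \<gamma> * \<beta> * fst (b k)" "0 \<le> (1 + \<gamma> * \<beta>) * ((1 - c0) * snd (b k))" "0 \<le> \<eta> (Suc k) * G"
      using Suc gd gamma(1) gapb c0 less_imp_le[OF \<eta>_pos] less_imp_le[OF G]
      by (simp_all only: mult_nonneg_nonneg diff_ge_0_iff_ge less_imp_le add_nonneg_nonneg zero_le_one)
    then show ?case by (simp add: b_def Let_def)
  qed
  define V where "V k = fst (b (k - 1)) + lam * snd (b (k - 1))" for k
  have V0: "0 \<le> V k" for k using b_pos lam by (simp add: V_def)
  have Vstep: "V (Suc k) \<le> (1 - \<tau>) * V k + (1 + lam) * (m * G) / sqrt (real k + c)" if "1 \<le> k" for k
  proof -
    from that obtain j where k: "k = Suc j" by (cases k) auto
    define a e where "a = fst (b j)" and "e = snd (b j)"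
    have "b (Suc j) = ((1 - \<gamma> * \<delta>) * a + \<gamma> * \<beta> * ((1 - c0) * e) + \<eta> (Suc j) * G,
        \<gamma> * \<beta> * a + (1 + \<gamma> * \<beta>) * ((1 - c0) * e) + \<eta> (Suc j) * G)"
      by (simp add: b_def a_def e_def Let_def)
    then have "V (Suc k) = ((1 - \<gamma> * \<delta>) * a + \<gamma> * \<beta> * ((1 - c0) * e))
        + lam * (\<gamma> * \<beta> * a + (1 + \<gamma> * \<beta>) * ((1 - c0) * e)) + (1 + lam) * (\<eta> k * G)"
      by (simp add: V_def k algebra_simps)
    also have "\<dots> \<le> (1 - \<tau>) * (a + lam * e) + (1 + lam) * (\<eta> k * G)"
      using b_pos[of j] by (intro add_right_mono contract) (simp_all add: a_def e_def)
    also have "a + lam * e = V k" by (simp add: V_def k a_def e_def)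
    finally show ?thesis by (simp add: \<eta>_eq)
  qed
  obtain B where B: "0 \<le> B" "\<And>T. (\<Sum>k=1..T. sqrt (real k + c) * (V k)\<^sup>2) \<le> B * sqrt (real T + c)"
    using contraction_weighted_square_sum[OF V0 Vstep \<tau>, of] lam m G c by (auto simp: less_imp_le)

  let ?sum = "\<lambda>T. \<Sum>k=1..T. (\<integral>w. (objective P F (xbar T k w) - objective P F xstar) \<partial>M)"
  define K1 where "K1 = 3 * \<gamma> * \<beta> + 4 * \<gamma>\<^sup>2 * \<beta>\<^sup>2"
  define k1 where "k1 = 2 * n * R_out\<^sup>2 / m"
  define k2 where "k2 = K1 * (1 + (1 / lam)\<^sup>2) / (2 * m) + Lf * sqrt n / 2"
  define k3 where "k3 = m * G\<^sup>2 + Lf * sqrt n / 2"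
  have k: "0 \<le> k1" "0 \<le> k2" "0 \<le> k3"
    using n m Lf lam gamma(1) gapb unfolding k1_def k2_def k3_def K1_def by simp_all
  define c2 where "c2 = (k1 + k2 * B) * sqrt (1 + c) + 2 * k3 + 2 * n * Lf + n * Lf * R_out / (2 * R_in)"
  have c2: "0 \<le> c2" using k B(1) c n Lf Rin Rout unfolding c2_def by simp

  have "compact \<Omega>"
    using \<Omega>(1,4) bounded_subset[OF bounded_cball] by (auto simp: compact_eq_bounded_closed)
  then obtain e0 where e0: "0 < e0" "(\<Union>x\<in>\<Omega>. cball x e0) \<subseteq> U"
    using compact_subset_open_imp_cball_epsilon_subset[OF _ U] by metis
  \<comment> \<open>The two smallness conditions on the horizon keep the perturbed queries inside \<open>U\<close> and the shrinking
    factor positive.\<close>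
  have bound: "?sum T \<le> c2 / n * sqrt (real T)"
    if T: "1 \<le> T" "\<mu> T \<le> e0" "\<epsilon> T \<le> 1 / 2" for T
  proof -
    have \<mu>: "0 < \<mu> T" using T(1) by (simp add: \<mu>_def)
    have \<epsilon>: "0 \<le> \<epsilon> T" "\<epsilon> T < 1" using \<mu> Rin T(3) by (simp_all add: \<epsilon>_def)
    let ?S = "shrunk (\<epsilon> T) \<Omega>"
    note S = shrunk_properties[OF \<Omega>(1,2) zero \<epsilon>]
    have margin: "cball x (\<mu> T) \<subseteq> U" if "x \<in> \<Omega>" for x
    proof -
      have "cball x (\<mu> T) \<subseteq> cball x e0" using T(2) by (rule subset_cball)
      also have "\<dots> \<subseteq> U" using e0(2) that by auto
      finally show ?thesis .
    qed
    interpret Run: stochastic_run E W M P F' Q C u \<xi> \<zeta> ?S U "x0 T" \<eta> Lf R_out "\<mu> T" \<psi> \<gamma> r \<omega>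
    proof (intro stochastic_run.intro stochastic_run_axioms.intro Net.gossip_axioms M)
      show "?S \<subseteq> cball 0 R_out" using S(4) \<Omega>(4) by (rule order_trans)
      show "cball x (\<mu> T) \<subseteq> U" if "x \<in> ?S" for x using that S(4) by (intro margin) auto
      show "norm (x0 T i) \<le> R_out" for i using init[of T i] \<Omega>(4) by auto
    qed (fact F' Pp A5 fresh S(1,2,3) Lf Rout \<mu> psi gamma(1) \<eta>_pos \<gamma>1)+
    have xbar: "xbar T k w = mean (Run.X k w)" if "w \<in> space M" for k w
      unfolding xbar_def
      by (subst Run.com_dszo_eq[OF _ _ refl that])
         (simp_all add: F'(4) margin init network_average_eq_mean)
    have meanS: "mean (Run.X k w) \<in> U" if "1 \<le> k" for k w
    proof -
      from that obtain j where k: "k = Suc j" by (cases k) auto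
      have "(\<Sum>i\<in>UNIV. (1 / n) *\<^sub>R Run.X k w $ i) \<in> ?S"
        by (rule convex_sum[OF _ S(1)]) (simp_all add: k Run.X_Suc_in_S n_def)
      then show ?thesis using S(4) U(2) by (auto simp: mean_def scaleR_sum_right n_def)
    qed
    define z where "z = (1 - \<epsilon> T) *\<^sub>R xstar"
    have z: "z \<in> ?S" using optimal(1) by (auto simp: z_def shrunk_def)
    have Gs: "Run.G = G" by (simp add: Run.G_def G_def n_def d_def)
    have rs: "Run.\<rho> = 1 - c0" by (simp add: Run.\<rho>_def c0_def)
    have bs: "error_bounds \<gamma> Net.\<delta> Net.\<beta> Run.\<rho> (\<lambda>k. \<eta> k * Run.G) (3 * (sqrt (real CARD('n)) * R_out)) = b"
      by (simp add: b_def \<delta> \<beta> Gs rs n_def)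
    have gap_k: "(\<integral>w. (objective P F (xbar T k w) - objective P F xstar) \<partial>M)
        = (\<integral>w. objective P F' (mean (Run.X k w)) \<partial>M) - objective P F xstar" if k: "k \<in> {1..T}" for k
    proof -
      from k obtain j where j: "k = Suc j" by (cases k) auto
      have int: "integrable M (\<lambda>w. objective P F' (mean (Run.X k w)))"
        unfolding j by (rule Run.expected_step(1)[OF z Run.error_bounds_valid(3,1,4,2)])
      have "(\<integral>w. (objective P F (xbar T k w) - objective P F xstar) \<partial>M)
          = (\<integral>w. objective P F' (mean (Run.X k w)) - objective P F xstar \<partial>M)"
        using k by (intro Bochner_Integration.integral_cong) (simp_all add: xbar obj meanS)
      then show ?thesis using int by (simp add: Run.prob_space)
    qed
    have fz: "(\<Sum>i\<in>UNIV. local_objective P F' i z) \<le> n * objective P F xstar + n * Lf * (\<epsilon> T * R_out)"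
    proof -
      have "local_objective P F' i z \<le> local_objective P F i xstar + Lf * (\<epsilon> T * R_out)" for i
      proof -
        have "dist z xstar = \<epsilon> T * norm xstar"
          using \<epsilon> by (simp add: z_def dist_norm algebra_simps)
        also have "\<dots> \<le> \<epsilon> T * R_out" using optimal(1) \<Omega>(4) \<epsilon> by (intro mult_left_mono) auto
        finally have "Lf * dist z xstar \<le> Lf * (\<epsilon> T * R_out)" using Lf by simp
        then show ?thesis
          using lipschitz_onD[OF Run.local_objective_lipschitz, of z xstar i] optimal(1) U(2) F'(5)[of xstar i]
          by (auto simp: dist_real_def)
      qed
      then have "(\<Sum>i\<in>UNIV. local_objective P F' i z) \<le> (\<Sum>i\<in>UNIV. local_objective P F i xstar + Lf * (\<epsilon> T * R_out))"
        by (rule sum_mono)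
      then show ?thesis by (simp add: sum.distrib objective_def n_def)
    qed
    let ?E = "\<Sum>k=1..T. \<integral>w. objective P F' (mean (Run.X k w)) \<partial>M"
    have "n * ?E - real T * (\<Sum>i\<in>UNIV. local_objective P F' i z)
        \<le> k1 * sqrt (real T + c) + k2 * (\<Sum>k=1..T. sqrt (real k + c) * (V k)\<^sup>2) + k3 * (2 * sqrt (real T))
          + 2 * n * Lf * (real T * \<mu> T)"
      unfolding k1_def k2_def k3_def K1_def n_def G_def[unfolded n_def, symmetric] \<delta>[symmetric] \<beta>[symmetric] Gs[symmetric]
    proof (rule Run.summed_regret[OF z m _ \<eta>_eq, unfolded bs])
      show "0 \<le> c" using c by simp
      show "fst (b k) \<le> V (Suc k)" for k using b_pos[of k] lam by (simp add: V_def)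
      show "snd (b k) \<le> 1 / lam * V (Suc k)" for k using b_pos[of k] lam by (simp add: V_def field_simps)
    qed
    also have "\<dots> \<le> k1 * (sqrt (1 + c) * sqrt (real T)) + k2 * (B * (sqrt (1 + c) * sqrt (real T))) + k3 * (2 * sqrt (real T))
          + 2 * n * Lf * (real T * \<mu> T)"
    proof -
      have "real T + c \<le> (1 + c) * real T" using T(1) c by (simp add: algebra_simps)
      then have w: "sqrt (real T + c) \<le> sqrt (1 + c) * sqrt (real T)"
        by (metis real_sqrt_le_mono real_sqrt_mult)
      then have "(\<Sum>k=1..T. sqrt (real k + c) * (V k)\<^sup>2) \<le> B * (sqrt (1 + c) * sqrt (real T))"
        using B by (meson mult_left_mono order_trans)
      with w k show ?thesis by (intro add_mono mult_left_mono order_refl)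
    qed
    also have T\<mu>: "real T * \<mu> T = sqrt (real T)" using T(1) by (simp add: \<mu>_def real_div_sqrt)
    finally have "n * ?E - real T * (\<Sum>i\<in>UNIV. local_objective P F' i z)
        \<le> ((k1 + k2 * B) * sqrt (1 + c) + 2 * k3 + 2 * n * Lf) * sqrt (real T)"
      by (simp add: algebra_simps)
    moreover have "real T * (\<Sum>i\<in>UNIV. local_objective P F' i z)
        \<le> real T * (n * objective P F xstar) + n * Lf * R_out / (2 * R_in) * sqrt (real T)"
    proof -
      have "real T * \<epsilon> T = sqrt (real T) / (2 * R_in)"
        unfolding \<epsilon>_def by (simp only: T\<mu> times_divide_eq_right)
      moreover have "real T * (n * Lf * (\<epsilon> T * R_out)) = n * Lf * R_out * (real T * \<epsilon> T)"
        by (simp only: mult_ac)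
      ultimately have "real T * (n * Lf * (\<epsilon> T * R_out)) = n * Lf * R_out / (2 * R_in) * sqrt (real T)"
        by simp
      with mult_left_mono[OF fz, of "real T"] show ?thesis by (simp add: distrib_left)
    qed
    ultimately have "n * ?E - real T * (n * objective P F xstar) \<le> c2 * sqrt (real T)"
      unfolding c2_def by (simp add: distrib_right)
    moreover have "?sum T = ?E - real T * objective P F xstar"
      using gap_k by (simp add: sum_subtractf)
    ultimately have "n * ?sum T \<le> c2 * sqrt (real T)" by (simp add: right_diff_distrib mult.left_commute)
    then show ?thesis using n by (simp add: pos_le_divide_eq mult.commute)
  qed

  have lim: "\<mu> \<longlonglongrightarrow> 0" "\<epsilon> \<longlonglongrightarrow> 0"
  proof -
    show \<mu>0: "\<mu> \<longlonglongrightarrow> 0" unfolding \<mu>_def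
      by (intro tendsto_divide_0[OF tendsto_const] filterlim_at_top_imp_at_infinity
          filterlim_compose[OF sqrt_at_top filterlim_real_sequentially])
    show "\<epsilon> \<longlonglongrightarrow> 0" unfolding \<epsilon>_def using tendsto_divide_zero[OF \<mu>0] by simp
  qed
  have "\<forall>\<^sub>F T in sequentially. ?sum T \<le> c2 / n * sqrt (real T)"
    using order_tendstoD(2)[OF lim(1) e0(1)] order_tendstoD(2)[OF lim(2), of "1/2", simplified] eventually_ge_at_top[of 1]
    by eventually_elim (rule bound, simp_all)
  \<comment> \<open>The positive part, because the sum is bounded only from above.\<close>
  then have e2: "(\<lambda>T. max 0 (?sum T)) \<in> O(\<lambda>T. sqrt (real T))"
    by (intro bigoI[where c="c2 / n"]) (auto elim!: eventually_mono simp: c2 n(2) less_imp_le)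
  show ?thesis
  proof (intro exI conjI allI impI)
    show "(\<lambda>T. max 0 (?sum T)) \<in> O(\<lambda>T. sqrt (real T))" by (rule e2)
    show "?sum T \<le> 0 + max 0 (?sum T) + 0 + 0 + 0" for T by simp
  qed simp_all
qed

end
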